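(* Let $d\geq 4$ and $1<k<d$. Then the mapping cones $\mathcal{EB}_k(d)$ and $\mathcal{EBCP}_k(d)$ are not typical.
   Context: $\mathbb{M}_d$ is the algebra of complex $d\times d$ matrices; a superscript $+$ denotes the cone of positive semidefinite matrices; $\mathsf{T}$ is the transpose map. A linear map $\Phi:\mathbb{M}_{d}\to\mathbb{M}_{d}$ is positive if it maps $\mathbb{M}_d^+$ into itself, $n$-positive if $\mathrm{id}_n\otimes\Phi$ is positive, and completely positive (CP) if it is $n$-positive for all $n\geq 1$. $X\in(\mathbb{M}_{m}\otimes\mathbb{M}_{n})^+$ is separable if $X=\sum_i A_i\otimes B_i$ (finite sum) with $A_i\in\mathbb{M}_m^+$, $B_i\in\mathbb{M}_n^+$. $\Phi$ is entanglement breaking (EB) if $(\mathrm{id}_m\otimes\Phi)(X)$ is separable for all $m\geq 1$, $X\in(\mathbb{M}_m\otimes\mathbb{M}_d)^+$. $\Phi$ is $k$-entanglement breaking if it is $k$-positive and $(\mathrm{id}_k\otimes\Phi)(X)$ is separable for every $X\in(\mathbb{M}_k\otimes\mathbb{M}_{d})^+$. A CP-map is $n$-partially entanglement breaking ($n$-PEB) if it has the form $X\mapsto\sum_i V_i^*XV_i$ with all $\mathrm{rank}(V_i)\leq n$. $\mathcal{P}(d)$, $\mathcal{P}_n(d)$, $\mathcal{CP}(d)$, $\mathcal{PEB}_n(d)$, $\mathcal{EB}(d)$, $\mathcal{EB}_k(d)$, $\mathcal{EBCP}_k(d)$ denote, respectively, the cones of positive, $n$-positive, CP, $n$-PEB,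 entanglement breaking, $k$-entanglement breaking, and both $k$-entanglement breaking and CP linear maps $\mathbb{M}_d\to\mathbb{M}_d$. A mapping cone is a closed convex cone $\mathscr{C}\subseteq\mathcal{P}(d)$ such that $\Phi\circ\Theta\circ\Psi\in\mathscr{C}$ for all $\Theta\in\mathscr{C}$ and all CP-maps $\Phi,\Psi$ on $\mathbb{M}_d$. Put $\mathscr{C}\circ\mathsf{T}=\{\Phi\circ\mathsf{T}:\Phi\in\mathscr{C}\}$, and let $\mathscr{C}_1\vee\mathscr{C}_2$ be the smallest closed convex cone containing $\mathscr{C}_1\cup\mathscr{C}_2$. A mapping cone is called typical if it arises from the cones $\mathcal{P}(d)$, $\mathcal{P}_n(d)$, $\mathcal{CP}(d)$, $\mathcal{PEB}_n(d)$, $\mathcal{EB}(d)$ ($n>1$) via the operations $\mathscr{C}\mapsto\mathscr{C}\circ\mathsf{T}$, $(\mathscr{C}_1,\mathscr{C}_2)\mapsto\mathscr{C}_1\cap\mathscr{C}_2$ and $(\mathscr{C}_1,\mathscr{C}_2)\mapsto\mathscr{C}_1\vee\mathscr{C}_2$. *)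

theory Defs
  imports
    "HOL-Analysis.Function_Topology"
    "Jordan_Normal_Form.Schur_Decomposition"
    "Jordan_Normal_Form.DL_Rank"
begin

text \<open>The algebra of complex \<open>n \<times> n\<close> matrices is \<open>carrier_mat n n\<close>. The order on \<open>complex\<close> is
  the one of \<open>Complex_Order\<close>: \<open>0 \<le> z\<close> means that \<open>z\<close> is real and nonnegative, so the condition
  below forces \<open>A\<close> to be Hermitian.\<close>

definition psd :: "nat \<Rightarrow> complex mat set" where
  "psd n = {A \<in> carrier_mat n n. \<forall>v \<in> carrier_vec n. 0 \<le> (A *\<^sub>v v) \<bullet>c v}"

definition mat_sum :: "nat \<Rightarrow> nat \<Rightarrow> (nat \<Rightarrow> complex mat) \<Rightarrow> complex mat" where
  "mat_sum d N F = mat d d (\<lambda>(i, j). \<Sum>l<N. F l $$ (i, j))"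

text \<open>The tensor product of matrix algebras is realised by the Kronecker product: the algebra of
  \<open>m \<times> m\<close> matrices tensored with that of \<open>n \<times> n\<close> matrices is \<open>carrier_mat (m * n) (m * n)\<close>, the
  pair of indices \<open>(i, a)\<close> with \<open>i < m\<close>, \<open>a < n\<close> being encoded as \<open>i * n + a\<close>.\<close>

definition kron :: "complex mat \<Rightarrow> complex mat \<Rightarrow> complex mat" where
  "kron A B = mat (dim_row A * dim_row B) (dim_col A * dim_col B)
     (\<lambda>(i, j). A $$ (i div dim_row B, j div dim_col B) * B $$ (i mod dim_row B, j mod dim_col B))"

definition separable :: "nat \<Rightarrow> nat \<Rightarrow> complex mat set" where
  "separable m n = {X \<in> psd (m * n). \<exists>N A B.
     (\<forall>l<N. A l \<in> psd m \<and> B l \<in> psd n) \<and> X = mat_sum (m * n) N (\<lambda>l. kron (A l) (B l))}"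

text \<open>Linear maps are represented as functions that are \<open>undefined\<close> outside \<open>carrier_mat d d\<close>, so
  that equality of functions is equality of linear maps.\<close>

definition lin_maps :: "nat \<Rightarrow> (complex mat \<Rightarrow> complex mat) set" where
  "lin_maps d = {\<Phi> \<in> carrier_mat d d \<rightarrow>\<^sub>E carrier_mat d d.
     (\<forall>X \<in> carrier_mat d d. \<forall>Y \<in> carrier_mat d d. \<Phi> (X + Y) = \<Phi> X + \<Phi> Y) \<and>
     (\<forall>c. \<forall>X \<in> carrier_mat d d. \<Phi> (c \<cdot>\<^sub>m X) = c \<cdot>\<^sub>m \<Phi> X)}"

definition lin_add :: "nat \<Rightarrow> (complex mat \<Rightarrow> complex mat) \<Rightarrow> (complex mat \<Rightarrow> complex mat)
    \<Rightarrow> complex mat \<Rightarrow> complex mat" where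
  "lin_add d \<Phi> \<Psi> = (\<lambda>X \<in> carrier_mat d d. \<Phi> X + \<Psi> X)"

definition lin_scale :: "nat \<Rightarrow> real \<Rightarrow> (complex mat \<Rightarrow> complex mat) \<Rightarrow> complex mat \<Rightarrow> complex mat"
  where "lin_scale d t \<Phi> = (\<lambda>X \<in> carrier_mat d d. complex_of_real t \<cdot>\<^sub>m \<Phi> X)"

definition lin_comp :: "nat \<Rightarrow> (complex mat \<Rightarrow> complex mat) \<Rightarrow> (complex mat \<Rightarrow> complex mat)
    \<Rightarrow> complex mat \<Rightarrow> complex mat" where
  "lin_comp d \<Phi> \<Psi> = compose (carrier_mat d d) \<Phi> \<Psi>"

definition transpose_map :: "nat \<Rightarrow> complex mat \<Rightarrow> complex mat" where
  "transpose_map d = (\<lambda>X \<in> carrier_mat d d. transpose_mat X)"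

definition block :: "nat \<Rightarrow> complex mat \<Rightarrow> nat \<Rightarrow> nat \<Rightarrow> complex mat" where
  "block d X r s = mat d d (\<lambda>(a, b). X $$ (r * d + a, s * d + b))"

text \<open>The map \<open>id\<^sub>n \<otimes> \<Phi>\<close>, applying \<open>\<Phi>\<close> to each of the \<open>d \<times> d\<close> blocks of an
  \<open>n d \<times> n d\<close> matrix.\<close>

definition id_tensor :: "nat \<Rightarrow> nat \<Rightarrow> (complex mat \<Rightarrow> complex mat) \<Rightarrow> complex mat \<Rightarrow> complex mat"
  where "id_tensor n d \<Phi> X =
    mat (n * d) (n * d) (\<lambda>(i, j). \<Phi> (block d X (i div d) (j div d)) $$ (i mod d, j mod d))"

lemma id_tensor_kron:
  assumes "\<Phi> \<in> lin_maps d" "A \<in> carrier_mat n n" "B \<in> carrier_mat d d"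
  shows "id_tensor n d \<Phi> (kron A B) = kron A (\<Phi> B)"
proof -
  have \<Phi>B: "\<Phi> B \<in> carrier_mat d d" using assms unfolding lin_maps_def by auto
  have blk: "block d (kron A B) r s = A $$ (r, s) \<cdot>\<^sub>m B" if "r < n" "s < n" for r s
  proof (rule eq_matI)
    fix a b assume "a < dim_row (A $$ (r, s) \<cdot>\<^sub>m B)" "b < dim_col (A $$ (r, s) \<cdot>\<^sub>m B)"
    then have ab: "a < d" "b < d" using assms by auto
    have lt: "r * d + a < n * d" if "r < n" "a < d" for r a
      using mult_le_mono1[of "Suc r" n d] that by auto
    show "block d (kron A B) r s $$ (a, b) = (A $$ (r, s) \<cdot>\<^sub>m B) $$ (a, b)"
      using ab that assms lt[OF that(1) ab(1)] lt[OF that(2) ab(2)]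
      by (auto simp: block_def kron_def)
  qed (use assms in \<open>auto simp: block_def\<close>)
  show ?thesis
  proof (rule eq_matI)
    fix i j assume "i < dim_row (kron A (\<Phi> B))" "j < dim_col (kron A (\<Phi> B))"
    then have ij: "i < n * d" "j < n * d" using assms \<Phi>B by (auto simp: kron_def)
    then have d: "0 < d" by (cases d) auto
    have lt: "i div d < n" "j div d < n" using ij by (auto simp: less_mult_imp_div_less)
    have "id_tensor n d \<Phi> (kron A B) $$ (i, j)
        = \<Phi> (A $$ (i div d, j div d) \<cdot>\<^sub>m B) $$ (i mod d, j mod d)"
      using ij by (simp add: id_tensor_def blk[OF lt])
    also have "\<Phi> (A $$ (i div d, j div d) \<cdot>\<^sub>m B) = A $$ (i div d, j div d) \<cdot>\<^sub>m \<Phi> B"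
      using assms unfolding lin_maps_def by auto
    also have "(A $$ (i div d, j div d) \<cdot>\<^sub>m \<Phi> B) $$ (i mod d, j mod d) = kron A (\<Phi> B) $$ (i, j)"
      using ij d assms(2) \<Phi>B by (simp add: kron_def)
    finally show "id_tensor n d \<Phi> (kron A B) $$ (i, j) = kron A (\<Phi> B) $$ (i, j)" .
  qed (use assms \<Phi>B in \<open>auto simp: id_tensor_def kron_def\<close>)
qed

text \<open>In the cones indexed by a natural number the index is meant to be at least \<open>1\<close>.\<close>

definition P_cone :: "nat \<Rightarrow> (complex mat \<Rightarrow> complex mat) set" where
  "P_cone d = {\<Phi> \<in> lin_maps d. \<forall>X \<in> psd d. \<Phi> X \<in> psd d}"

definition Pn_cone :: "nat \<Rightarrow> nat \<Rightarrow> (complex mat \<Rightarrow> complex mat) set" where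
  "Pn_cone n d = {\<Phi> \<in> lin_maps d. \<forall>X \<in> psd (n * d). id_tensor n d \<Phi> X \<in> psd (n * d)}"

definition CP_cone :: "nat \<Rightarrow> (complex mat \<Rightarrow> complex mat) set" where
  "CP_cone d = {\<Phi> \<in> lin_maps d. \<forall>n\<ge>1. \<Phi> \<in> Pn_cone n d}"

definition PEB_cone :: "nat \<Rightarrow> nat \<Rightarrow> (complex mat \<Rightarrow> complex mat) set" where
  "PEB_cone n d = {\<Phi> \<in> CP_cone d. \<exists>N V.
     (\<forall>l<N. V l \<in> carrier_mat d d \<and> vec_space.rank d (V l) \<le> n) \<and>
     (\<forall>X \<in> carrier_mat d d. \<Phi> X = mat_sum d N (\<lambda>l. mat_adjoint (V l) * X * V l))}"

definition EB_cone :: "nat \<Rightarrow> (complex mat \<Rightarrow> complex mat) set" where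
  "EB_cone d = {\<Phi> \<in> lin_maps d. \<forall>m\<ge>1. \<forall>X \<in> psd (m * d). id_tensor m d \<Phi> X \<in> separable m d}"

definition EBk_cone :: "nat \<Rightarrow> nat \<Rightarrow> (complex mat \<Rightarrow> complex mat) set" where
  "EBk_cone k d = {\<Phi> \<in> Pn_cone k d. \<forall>X \<in> psd (k * d). id_tensor k d \<Phi> X \<in> separable k d}"

definition EBCPk_cone :: "nat \<Rightarrow> nat \<Rightarrow> (complex mat \<Rightarrow> complex mat) set" where
  "EBCPk_cone k d = EBk_cone k d \<inter> CP_cone d"

text \<open>The topology of the finite-dimensional space \<open>lin_maps d\<close>: convergence of all entries of all
  values.\<close>

definition entries :: "nat \<Rightarrow> (complex mat \<Rightarrow> complex mat) \<Rightarrow> complex mat \<times> nat \<times> nat \<Rightarrow> complex"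
  where "entries d \<Phi> = (\<lambda>(X, i, j).
    if X \<in> carrier_mat d d \<and> i < d \<and> j < d then \<Phi> X $$ (i, j) else 0)"

definition lin_maps_topology :: "nat \<Rightarrow> (complex mat \<Rightarrow> complex mat) topology" where
  "lin_maps_topology d = pullback_topology (lin_maps d) (entries d) euclidean"

definition closed_convex_cone :: "nat \<Rightarrow> (complex mat \<Rightarrow> complex mat) set \<Rightarrow> bool" where
  "closed_convex_cone d C \<longleftrightarrow>
     closedin (lin_maps_topology d) C \<and> C \<noteq> {} \<and>
     (\<forall>\<Phi>\<in>C. \<forall>\<Psi>\<in>C. lin_add d \<Phi> \<Psi> \<in> C) \<and>
     (\<forall>t\<ge>0. \<forall>\<Phi>\<in>C. lin_scale d t \<Phi> \<in> C)"

definition mapping_cone :: "nat \<Rightarrow> (complex mat \<Rightarrow> complex mat) set \<Rightarrow> bool" where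
  "mapping_cone d C \<longleftrightarrow>
     closed_convex_cone d C \<and> C \<subseteq> P_cone d \<and>
     (\<forall>\<Theta>\<in>C. \<forall>\<Phi>\<in>CP_cone d. \<forall>\<Psi>\<in>CP_cone d. lin_comp d \<Phi> (lin_comp d \<Theta> \<Psi>) \<in> C)"

definition cone_transpose :: "nat \<Rightarrow> (complex mat \<Rightarrow> complex mat) set
    \<Rightarrow> (complex mat \<Rightarrow> complex mat) set" where
  "cone_transpose d C = {lin_comp d \<Phi> (transpose_map d) | \<Phi>. \<Phi> \<in> C}"

definition cone_join :: "nat \<Rightarrow> (complex mat \<Rightarrow> complex mat) set
    \<Rightarrow> (complex mat \<Rightarrow> complex mat) set \<Rightarrow> (complex mat \<Rightarrow> complex mat) set" where
  "cone_join d C1 C2 = \<Inter> {C. closed_convex_cone d C \<and> C1 \<union> C2 \<subseteq> C}"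

inductive typical :: "nat \<Rightarrow> (complex mat \<Rightarrow> complex mat) set \<Rightarrow> bool" for d :: nat where
  P: "typical d (P_cone d)"
| Pn: "n > 1 \<Longrightarrow> typical d (Pn_cone n d)"
| CP: "typical d (CP_cone d)"
| PEB: "n > 1 \<Longrightarrow> typical d (PEB_cone n d)"
| EB: "typical d (EB_cone d)"
| transpose: "typical d C \<Longrightarrow> typical d (cone_transpose d C)"
| inter: "typical d C1 \<Longrightarrow> typical d C2 \<Longrightarrow> typical d (C1 \<inter> C2)"
| join: "typical d C1 \<Longrightarrow> typical d C2 \<Longrightarrow> typical d (cone_join d C1 C2)"

end

theory Submission
  imports Defs "HOL-Analysis.Function_Metric"
begin

text \<open>A typical cone is either as small as the cone of entanglement breaking maps or rather large,
  while the cones of \<open>k\<close>-entanglement breaking maps are neither. The precise form is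
  \<open>typical_dichotomy\<close>: every typical cone is contained in the cone \<open>pairing_cone\<close>, which is cut
  out by two linear inequalities valid for entanglement breaking maps, or it contains \<open>ppt_map\<close>.
  The latter is a map whose Choi matrix is an entangled \<open>2 \<times> 4\<close> matrix with positive partial
  transpose, placed in a corner of the \<open>d \<times> d\<close> matrices; this is where \<open>d \<ge> 4\<close> is used. Since the
  Choi matrix and its partial transpose are positive and only two input dimensions are involved,
  both \<open>ppt_map\<close> and its composition with the transposition have Kraus operators of rank at most
  \<open>2\<close>, so they belong to every generating cone other than \<open>EB_cone\<close> (\<open>ppt_map_PEB\<close>). The dichotomy
  then survives transpositions, intersections and joins.

  Neither alternative holds for a cone between \<open>EBCPk_cone k d\<close> and \<open>EBk_cone k d\<close>. The map
  \<open>ppt_map\<close> is not \<open>k\<close>-entanglement breaking for \<open>k \<ge> 2\<close>, because its Choi matrix violates the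
  range criterion (\<open>ppt_choi_not_separable\<close>). On the other hand \<open>X \<mapsto> k Tr(X) 1 - X\<^sup>T\<close>
  (\<open>werner_map\<close>) is completely positive and \<open>k\<close>-entanglement breaking, by an explicit
  decomposition into rank one products for inputs of Schmidt rank at most \<open>k\<close>
  (\<open>separable_werner_rank_one\<close>), but for \<open>k < d\<close> it violates one of the two inequalities.

  That the two cones are mapping cones is immediate from the behaviour of separable matrices under
  local positive maps, except for closedness. The latter follows from \<open>closed_separable\<close>, where
  Caratheodory's theorem bounds the number of terms of a separable decomposition and thereby gives
  compactness.\<close>

section \<open>Positive quadratic forms and Gram decompositions\<close>

text \<open>Indexing vectors and matrices by functions on the naturals avoids carrier conditions; only
  the values below the dimension enter.\<close>

definition qform :: "nat \<Rightarrow> (nat \<Rightarrow> nat \<Rightarrow> complex) \<Rightarrow> (nat \<Rightarrow> complex) \<Rightarrow> complex" where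
  "qform n X v = (\<Sum>i<n. \<Sum>j<n. cnj (v i) * X i j * v j)"

lemma qform_matrix:
  assumes "A \<in> carrier_mat n n"
  shows "qform n (\<lambda>i j. A $$ (i, j)) v = (A *\<^sub>v vec n v) \<bullet>c vec n v"
  using assms
  by (auto simp: qform_def scalar_prod_def atLeast0LessThan sum_distrib_right sum_distrib_left
      intro!: sum.cong)

lemma psd_iff_qform:
  "A \<in> psd n \<longleftrightarrow> A \<in> carrier_mat n n \<and> (\<forall>v. 0 \<le> qform n (\<lambda>i j. A $$ (i, j)) v)"
proof -
  have "(\<forall>v \<in> carrier_vec n. 0 \<le> (A *\<^sub>v v) \<bullet>c v) \<longleftrightarrow>
      (\<forall>v. 0 \<le> (A *\<^sub>v vec n v) \<bullet>c vec n v)"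
  proof safe
    fix v :: "complex vec"
    assume v: "v \<in> carrier_vec n" and *: "\<forall>v. 0 \<le> (A *\<^sub>v vec n v) \<bullet>c vec n v"
    have "v = vec n (\<lambda>i. v $ i)" using v by auto
    with * show "0 \<le> (A *\<^sub>v v) \<bullet>c v" by metis
  qed auto
  then show ?thesis unfolding psd_def by (auto simp: qform_matrix)
qed

lemma qform_cong:
  assumes "\<And>i j. i < n \<Longrightarrow> j < n \<Longrightarrow> X i j = Y i j" "\<And>i. i < n \<Longrightarrow> v i = w i"
  shows "qform n X v = qform n Y w"
  unfolding qform_def using assms by (auto intro!: sum.cong)

lemma qform_Suc:
  "qform (Suc n) X v = qform n X v + cnj (v n) * X n n * v n
    + (\<Sum>i<n. cnj (v i) * X i n) * v n + cnj (v n) * (\<Sum>j<n. X n j * v j)"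
  by (simp add: qform_def sum.distrib sum_distrib_left sum_distrib_right algebra_simps)

lemma qform_two_point:
  assumes "i < n" "j < n" "i \<noteq> j"
  shows "qform n X (\<lambda>x. if x = i then s else if x = j then t else 0) =
    cnj s * X i i * s + cnj s * X i j * t + cnj t * X j i * s + cnj t * X j j * t"
proof -
  let ?v = "\<lambda>x. if x = i then s else if x = j then t else (0::complex)"
  have inner: "(\<Sum>x<n. f x * ?v x) = f i * s + f j * t" for f :: "nat \<Rightarrow> complex"
  proof -
    have "(\<Sum>x<n. f x * ?v x) = (\<Sum>x<n. (if x = i then f x * s else 0) + (if x = j then f x * t else 0))"
      using assms by (intro sum.cong) auto
    then show ?thesis using assms by (simp add: sum.distrib)
  qed
  have "qform n X ?v = (\<Sum>x<n. cnj (?v x) * (\<Sum>y<n. X x y * ?v y))"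
    by (simp add: qform_def sum_distrib_left mult.assoc)
  also have "\<dots> = (\<Sum>x<n. (X x i * s + X x j * t) * cnj (?v x))"
    by (simp add: inner mult.commute)
  also have "\<dots> = cnj (\<Sum>x<n. cnj (X x i * s + X x j * t) * ?v x)"
    by simp
  also have "\<dots> = (X i i * s + X i j * t) * cnj s + (X j i * s + X j j * t) * cnj t"
    unfolding inner by simp
  finally show ?thesis by (simp add: algebra_simps)
qed

lemma qform_one_point:
  assumes "i < n"
  shows "qform n X (\<lambda>x. if x = i then 1 else 0) = X i i"
proof -
  have "qform n X (\<lambda>x. if x = i then 1 else 0)
      = (\<Sum>x<n. if x = i then (\<Sum>y<n. if y = i then X x y else 0) else 0)"
    unfolding qform_def by (intro sum.cong refl) (simp add: if_distrib cong: if_cong)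
  with assms show ?thesis by simp
qed

text \<open>As the values of the form are real, its value at \<open>e\<^sub>i + e\<^sub>j\<close> shows that \<open>X i j + X j i\<close> is
  real, and its value at \<open>e\<^sub>i + \<i> e\<^sub>j\<close> that \<open>X i j - X j i\<close> is imaginary.\<close>

lemma nonneg_qform_hermitian:
  assumes pos: "\<And>v. 0 \<le> qform n X v" and ij: "i < n" "j < n"
  shows "X j i = cnj (X i j)"
proof (cases "i = j")
  case True
  then show ?thesis using pos[of "\<lambda>x. if x = i then 1 else 0"] ij
    by (simp add: qform_one_point less_eq_complex_def complex_eq_iff)
next
  case False
  have d: "0 \<le> X i i" "0 \<le> X j j"
    using pos[of "\<lambda>x. if x = i then 1 else 0"] pos[of "\<lambda>x. if x = j then 1 else 0"] ij
    by (simp_all add: qform_one_point)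
  have 1: "0 \<le> cnj 1 * X i i * 1 + cnj 1 * X i j * 1 + cnj 1 * X j i * 1 + cnj 1 * X j j * 1"
    using pos[of "\<lambda>x. if x = i then 1 else if x = j then 1 else 0"] 
    by (simp only: qform_two_point[OF ij False])
  have 2: "0 \<le> cnj 1 * X i i * 1 + cnj 1 * X i j * \<i> + cnj \<i> * X j i * 1 + cnj \<i> * X j j * \<i>"
    using pos[of "\<lambda>x. if x = i then 1 else if x = j then \<i> else 0"] 
    by (simp only: qform_two_point[OF ij False])
  show ?thesis using 1 2 d by (auto simp: less_eq_complex_def complex_eq_iff)
qed

lemma nonneg_qform_zero_diag:
  assumes pos: "\<And>v. 0 \<le> qform n X v" and ij: "i < n" "j < n" and 0: "X j j = 0"
  shows "X i j = 0"
proof (cases "i = j")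
  case False
  define x where "x = Re (X i i)"
  define z where "z = X i j"
  have h: "X j i = cnj z" unfolding z_def by (rule nonneg_qform_hermitian[OF pos ij])
  have x0: "X i i = of_real x" "x \<ge> 0"
    using pos[of "\<lambda>x. if x = i then 1 else 0"] ij
    by (auto simp: qform_one_point less_eq_complex_def complex_eq_iff x_def)
  show ?thesis
  proof (rule ccontr)
    assume "X i j \<noteq> 0"
    then have zp: "(cmod z)\<^sup>2 > 0" by (simp add: z_def)
    \<comment> \<open>If \<open>z \<noteq> 0\<close>, the form at \<open>e\<^sub>i + s e\<^sub>j\<close> is \<open>x + 2 Re (s z)\<close>, since \<open>X j j = 0\<close>;
      this \<open>s\<close> makes it equal to \<open>- x - 2 \<bar>z\<bar>\<^sup>2 < 0\<close>.\<close>
    define s where "s = - of_real (x / (cmod z)\<^sup>2 + 1) * cnj z"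
    have "0 \<le> cnj 1 * X i i * 1 + cnj 1 * X i j * s + cnj s * X j i * 1 + cnj s * X j j * s"
      using pos[of "\<lambda>x. if x = i then 1 else if x = j then s else 0"]
      by (simp only: qform_two_point[OF ij False])
    then have "0 \<le> of_real x - 2 * of_real (x / (cmod z)\<^sup>2 + 1) * (z * cnj z)"
      by (simp add: x0 h 0 s_def flip: z_def) (simp add: algebra_simps)
    then have "0 \<le> of_real x - 2 * of_real (x / (cmod z)\<^sup>2 + 1) * complex_of_real ((cmod z)\<^sup>2)"
      by (simp only: complex_norm_square)
    then have "2 * (x / (cmod z)\<^sup>2 + 1) * (cmod z)\<^sup>2 \<le> x"
      by (auto simp: less_eq_complex_def simp flip: of_real_power)
    moreover have "2 * (x / (cmod z)\<^sup>2 + 1) * (cmod z)\<^sup>2 = 2 * x + 2 * (cmod z)\<^sup>2"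
      using zp by (simp add: field_simps)
    ultimately show False using zp x0 by linarith
  qed
qed (use 0 in auto)

text \<open>Cholesky elimination of the last index \<open>n\<close>. If the pivot \<open>X n n\<close> vanishes, so do its row and
  column. Otherwise the Schur complement \<open>Y\<close> is again positive, because its form at \<open>v\<close> is that of
  \<open>X\<close> at the extension of \<open>v\<close> that minimises over the last coordinate, and \<open>X - Y = v v\<^sup>*\<close> with
  the pivot column divided by the root of the pivot as \<open>v\<close>.\<close>

lemma gram_decomposition:
  assumes "\<And>v. 0 \<le> qform n X v"
  shows "\<exists>N V. \<forall>i<n. \<forall>j<n. X i j = (\<Sum>l<N::nat. V l i * cnj (V l j))"
  using assms
proof (induction n arbitrary: X)
  case 0
  then show ?case by auto
next
  case (Suc n)
  note pos = Suc.prems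
  define x where "x = Re (X n n)"
  have x: "X n n = of_real x" "x \<ge> 0"
    using pos[of "\<lambda>x. if x = n then 1 else 0"]
    by (auto simp: qform_one_point less_eq_complex_def complex_eq_iff x_def)
  have herm: "X j i = cnj (X i j)" if "i < Suc n" "j < Suc n" for i j
    using nonneg_qform_hermitian[OF pos that] .
  show ?case
  proof (cases "x = 0")
    case True
    have col: "X i n = 0" if "i < Suc n" for i
      using nonneg_qform_zero_diag[OF pos that] x True by simp
    have row: "X n i = 0" if "i < Suc n" for i
      using herm[of i n] col[OF that] that by simp
    have "0 \<le> qform n X v" for v
      using pos[of v] by (simp add: qform_Suc col row)
    from Suc.IH[OF this] obtain N V
      where V: "\<forall>i<n. \<forall>j<n. X i j = (\<Sum>l<N::nat. V l i * cnj (V l j))" by blast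
    have "\<forall>i<Suc n. \<forall>j<Suc n. X i j =
        (\<Sum>l<N. (if i = n then 0 else V l i) * cnj (if j = n then 0 else V l j))"
      using V col row by (auto simp: less_Suc_eq)
    then show ?thesis by (intro exI[of _ N] exI[of _ "\<lambda>l i. if i = n then 0 else V l i"]) simp
  next
    case False
    with x have xp: "x > 0" by simp
    define Y where "Y = (\<lambda>i j. X i j - X i n * X n j / of_real x)"
    have "0 \<le> qform n Y v" for v
    proof -
      define c where "c = (\<Sum>j<n. X n j * v j)"
      \<comment> \<open>The minimiser of the form over the last coordinate.\<close>
      define w where "w = (\<lambda>i. if i = n then - c / of_real x else v i)"
      have c': "(\<Sum>i<n. cnj (v i) * X i n) = cnj c"
      proof -
        have "cnj (v i) * X i n = cnj (X n i * v i)" if "i < n" for i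
          using herm[of i n] that by simp
        then show ?thesis unfolding c_def cnj_sum by (intro sum.cong) auto
      qed
      have "qform n Y v = qform n X v - (\<Sum>i<n. cnj (v i) * X i n) * c / of_real x"
        by (simp add: Y_def qform_def c_def algebra_simps sum_subtractf sum_distrib_left
            sum_distrib_right sum_divide_distrib)
      also have "\<dots> = qform (Suc n) X w"
      proof -
        have "qform (Suc n) X w = qform n X v + cnj (- c / of_real x) * X n n * (- c / of_real x)
           + cnj c * (- c / of_real x) + cnj (- c / of_real x) * c"
        proof -
          have "qform n X w = qform n X v" by (intro qform_cong) (auto simp: w_def)
          moreover have "(\<Sum>i<n. cnj (w i) * X i n) = cnj c" "(\<Sum>j<n. X n j * w j) = c"
            unfolding c'[symmetric] unfolding c_def by (auto simp: w_def intro!: sum.cong)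
          moreover have "w n = - c / of_real x" by (simp add: w_def)
          ultimately show ?thesis by (simp only: qform_Suc)
        qed
        also have "\<dots> = qform n X v - cnj c * c / of_real x"
          using xp by (simp add: x field_simps)
        finally show ?thesis by (simp add: c')
      qed
      finally show ?thesis using pos[of w] by simp
    qed
    from Suc.IH[OF this] obtain N V
      where V: "\<forall>i<n. \<forall>j<n. Y i j = (\<Sum>l<N::nat. V l i * cnj (V l j))" by blast
    define V' where "V' = (\<lambda>l i. if l = N then X i n / of_real (sqrt x) else if i = n then 0 else V l i)"
    have sq: "complex_of_real (sqrt x) * complex_of_real (sqrt x) = of_real x"
      using xp by (simp flip: of_real_mult)
    have "X i j = (\<Sum>l<Suc N. V' l i * cnj (V' l j))" if "i < Suc n" "j < Suc n" for i j
    proof -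
      have "(\<Sum>l<Suc N. V' l i * cnj (V' l j))
          = (\<Sum>l<N. V' l i * cnj (V' l j)) + X i n * X n j / of_real x"
        using herm[of j n] that by (simp add: V'_def sq)
      also have "(\<Sum>l<N. V' l i * cnj (V' l j)) = (if i = n \<or> j = n then 0 else Y i j)"
      proof (cases "i = n \<or> j = n")
        case True
        then show ?thesis by (auto simp: V'_def intro!: sum.neutral)
      next
        case False
        with that V show ?thesis by (auto simp: V'_def less_Suc_eq intro!: sum.cong)
      qed
      also have "\<dots> + X i n * X n j / of_real x = X i j"
        using xp by (auto simp: Y_def x)
      finally show ?thesis by simp
    qed
    then show ?thesis by blast
  qed
qed

lemma psd_decompose:
  assumes "A \<in> psd n"
  shows "\<exists>N V. \<forall>i<n. \<forall>j<n. A $$ (i, j) = (\<Sum>l<N::nat. V l i * cnj (V l j))"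
  using gram_decomposition[of n "\<lambda>i j. A $$ (i, j)"] assms by (auto simp: psd_iff_qform)

lemma qform_rank_one:
  "qform n (\<lambda>i j. v i * cnj (v j)) w = of_real ((cmod (\<Sum>i<n. cnj (v i) * w i))\<^sup>2)"
proof -
  have "qform n (\<lambda>i j. v i * cnj (v j)) w
      = cnj (\<Sum>i<n. cnj (v i) * w i) * (\<Sum>j<n. cnj (v j) * w j)"
    by (simp add: qform_def sum_product algebra_simps)
  also have "\<dots> = of_real ((cmod (\<Sum>i<n. cnj (v i) * w i))\<^sup>2)"
    by (simp only: complex_norm_square mult.commute)
  finally show ?thesis .
qed

lemma qform_sum:
  "qform n (\<lambda>i j. \<Sum>l\<in>L. X l i j) v = (\<Sum>l\<in>L. qform n (X l) v)"
  unfolding qform_def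
  by (simp add: sum_distrib_left sum_distrib_right sum.swap[of _ L])

lemma psdI_rank_ones:
  assumes "A \<in> carrier_mat n n"
    and "\<And>i j. i < n \<Longrightarrow> j < n \<Longrightarrow> A $$ (i, j) = (\<Sum>l\<in>L. V l i * cnj (V l j))"
  shows "A \<in> psd n"
proof -
  have "0 \<le> qform n (\<lambda>i j. A $$ (i, j)) v" for v
  proof -
    have "qform n (\<lambda>i j. A $$ (i, j)) v = qform n (\<lambda>i j. \<Sum>l\<in>L. V l i * cnj (V l j)) v"
      using assms by (intro qform_cong) auto
    also have "\<dots> = (\<Sum>l\<in>L. of_real ((cmod (\<Sum>i<n. cnj (V l i) * v i))\<^sup>2))"
      by (simp only: qform_sum qform_rank_one)
    also have "0 \<le> \<dots>" by (intro sum_nonneg) (simp add: less_eq_complex_def flip: of_real_power)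
    finally show ?thesis .
  qed
  with assms show ?thesis by (simp add: psd_iff_qform)
qed

section \<open>Separable matrices as sums of rank one products\<close>

lemma sum_pair_index:
  fixes f :: "nat \<Rightarrow> 'a::comm_monoid_add"
  shows "(\<Sum>p<m * n. f p) = (\<Sum>i<m. \<Sum>a<n. f (i * n + a))"
proof -
  have "(\<Sum>p<m * n. f p) = (\<Sum>i<m. sum f {i * n..<i * n + n})"
    by (rule sum.nat_group[symmetric])
  also have "\<dots> = (\<Sum>i<m. \<Sum>a<n. f (i * n + a))"
  proof -
    have "sum f {k..<k + n} = (\<Sum>a<n. f (k + a))" for k by (induction n) simp_all
    then show ?thesis by simp
  qed
  finally show ?thesis .
qed

lemma pair_index_less:
  fixes i a m n :: nat
  assumes "i < m" "a < n" shows "i * n + a < m * n"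
  using mult_le_mono1[of "Suc i" m n] assms by auto

lemma pair_index_cases:
  fixes p m n :: nat
  assumes "p < m * n"
  obtains i a where "p = i * n + a" "i < m" "a < n"
proof -
  from assms have "0 < n" by (cases n) auto
  then have "p = (p div n) * n + p mod n" "p div n < m" "p mod n < n"
    using assms by (auto simp: less_mult_imp_div_less)
  then show ?thesis by (rule that)
qed

lemma qform_pair:
  "qform (m * n) X v = (\<Sum>i<m. \<Sum>a<n. \<Sum>j<m. \<Sum>b<n.
     cnj (v (i * n + a)) * X (i * n + a) (j * n + b) * v (j * n + b))"
  unfolding qform_def sum_pair_index ..

text \<open>Together with \<open>separable_decompose\<close> this reduces separability to sums of matrices \<open>a a\<^sup>* \<otimes> b
  b\<^sup>*\<close>, as the positive matrices \<open>A\<^sub>l\<close> and \<open>B\<^sub>l\<close> are themselves sums of matrices \<open>v v\<^sup>*\<close>. Any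
  finite index set is allowed, so that nested decompositions can be flattened.\<close>

lemma separableI:
  assumes X: "X \<in> carrier_mat (m * n) (m * n)" and L: "finite L"
    and e: "\<And>i j p q. i < m \<Longrightarrow> j < m \<Longrightarrow> p < n \<Longrightarrow> q < n \<Longrightarrow> X $$ (i * n + p, j * n + q) =
      (\<Sum>l\<in>L. (a l i * cnj (a l j)) * (b l p * cnj (b l q)))"
  shows "X \<in> separable m n"
proof -
  have psd: "X \<in> psd (m * n)"
  proof (rule psdI_rank_ones[OF X])
    fix p q assume "p < m * n" "q < m * n"
    then show "X $$ (p, q) = (\<Sum>l\<in>L. (a l (p div n) * b l (p mod n)) *
        cnj (a l (q div n) * b l (q mod n)))"
      by (auto elim!: pair_index_cases simp: e mult_ac)
  qed
  obtain h where h: "bij_betw h {..<card L} L"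
    using ex_bij_betw_nat_finite[OF L] by (auto simp: atLeast0LessThan)
  define A where "A = (\<lambda>l. mat m m (\<lambda>(i, j). a (h l) i * cnj (a (h l) j)))"
  define B where "B = (\<lambda>l. mat n n (\<lambda>(i, j). b (h l) i * cnj (b (h l) j)))"
  have "A l \<in> psd m" "B l \<in> psd n" for l
    by (rule psdI_rank_ones[where L="{()}" and V="\<lambda>_. a (h l)"], auto simp: A_def)
       (rule psdI_rank_ones[where L="{()}" and V="\<lambda>_. b (h l)"], auto simp: B_def)
  moreover have "X = mat_sum (m * n) (card L) (\<lambda>l. kron (A l) (B l))"
  proof (rule eq_matI)
    fix r s assume "r < dim_row (mat_sum (m * n) (card L) (\<lambda>l. kron (A l) (B l)))"
      "s < dim_col (mat_sum (m * n) (card L) (\<lambda>l. kron (A l) (B l)))"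
    then have rs: "r < m * n" "s < m * n" by (auto simp: mat_sum_def)
    from rs(1) obtain i p where i: "r = i * n + p" "i < m" "p < n" by (rule pair_index_cases)
    from rs(2) obtain j q where j: "s = j * n + q" "j < m" "q < n" by (rule pair_index_cases)
    show "X $$ (r, s) = mat_sum (m * n) (card L) (\<lambda>l. kron (A l) (B l)) $$ (r, s)"
      using i j rs
      by (simp add: e mat_sum_def kron_def A_def B_def sum.reindex_bij_betw[OF h, symmetric])
  qed (use X in \<open>auto simp: mat_sum_def\<close>)
  ultimately show ?thesis unfolding separable_def using psd by blast
qed

lemma separable_decompose:
  assumes "X \<in> separable m n"
  shows "\<exists>N a b. \<forall>i<m. \<forall>j<m. \<forall>p<n. \<forall>q<n. X $$ (i * n + p, j * n + q) =
      (\<Sum>l<N::nat. (a l i * cnj (a l j)) * (b l p * cnj (b l q)))"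
proof -
  from assms obtain N A B where AB: "\<And>l. l < N \<Longrightarrow> A l \<in> psd m" "\<And>l. l < N \<Longrightarrow> B l \<in> psd n"
    and X: "X = mat_sum (m * n) N (\<lambda>l. kron (A l) (B l))"
    unfolding separable_def by blast
  have "\<forall>l. \<exists>S. l < N \<longrightarrow> (\<exists>V. \<forall>i<m. \<forall>j<m. A l $$ (i, j) = (\<Sum>s<S::nat. V s i * cnj (V s j)))"
    using psd_decompose[OF AB(1)] by blast
  then obtain S V where V: "\<And>l i j. l < N \<Longrightarrow> i < m \<Longrightarrow> j < m \<Longrightarrow>
      A l $$ (i, j) = (\<Sum>s<S l::nat. V l s i * cnj (V l s j))" by metis
  have "\<forall>l. \<exists>S. l < N \<longrightarrow> (\<exists>V. \<forall>i<n. \<forall>j<n. B l $$ (i, j) = (\<Sum>s<S::nat. V s i * cnj (V s j)))"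
    using psd_decompose[OF AB(2)] by blast
  then obtain T W where W: "\<And>l i j. l < N \<Longrightarrow> i < n \<Longrightarrow> j < n \<Longrightarrow>
      B l $$ (i, j) = (\<Sum>s<T l::nat. W l s i * cnj (W l s j))" by metis
  define L where "L = (SIGMA l:{..<N}. {..<S l} \<times> {..<T l})"
  have L: "finite L" by (auto simp: L_def)
  obtain h where h: "bij_betw h {..<card L} L"
    using ex_bij_betw_nat_finite[OF L] by (auto simp: atLeast0LessThan)
  define a where "a = (\<lambda>(l, s, t :: nat). V l s)"
  define b where "b = (\<lambda>(l, s :: nat, t). W l t)"
  have "X $$ (i * n + p, j * n + q) =
      (\<Sum>l<card L. (a (h l) i * cnj (a (h l) j)) * (b (h l) p * cnj (b (h l) q)))"
    if ij: "i < m" "j < m" "p < n" "q < n" for i j p q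
  proof -
    have dim: "A l \<in> carrier_mat m m" "B l \<in> carrier_mat n n" if "l < N" for l
      using AB[OF that] by (auto simp: psd_def)
    have "X $$ (i * n + p, j * n + q) = (\<Sum>l<N. A l $$ (i, j) * B l $$ (p, q))"
    proof -
      have "kron (A l) (B l) $$ (i * n + p, j * n + q) = A l $$ (i, j) * B l $$ (p, q)"
        if "l < N" for l
        using pair_index_less[OF ij(1,3)] pair_index_less[OF ij(2,4)] ij
          carrier_matD[OF dim(1)[OF that]] carrier_matD[OF dim(2)[OF that]]
        by (simp add: kron_def)
      then show ?thesis
        unfolding X mat_sum_def using pair_index_less[OF ij(1,3)] pair_index_less[OF ij(2,4)]
        by simp
    qed
    also have "\<dots> = (\<Sum>l<N. \<Sum>(s, t)\<in>{..<S l} \<times> {..<T l}.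
        (V l s i * cnj (V l s j)) * (W l t p * cnj (W l t q)))"
      using ij by (intro sum.cong) (simp_all add: V W sum_product sum.cartesian_product)
    also have "\<dots> = (\<Sum>x\<in>L. (a x i * cnj (a x j)) * (b x p * cnj (b x q)))"
      unfolding L_def by (subst sum.Sigma) (auto simp: a_def b_def intro!: sum.cong)
    finally show ?thesis by (simp add: sum.reindex_bij_betw[OF h, symmetric])
  qed
  then show ?thesis by (intro exI[of _ "card L"] exI[of _ "\<lambda>l. a (h l)"] exI[of _ "\<lambda>l. b (h l)"] allI impI)
qed

section \<open>Linear maps, their amplifications and the cones\<close>

lemma id_tensor_carrier [simp]: "id_tensor n d \<Phi> X \<in> carrier_mat (n * d) (n * d)"
  by (simp add: id_tensor_def)

lemma id_tensor_index:
  assumes "i < n" "j < n" "a < d" "b < d"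
  shows "id_tensor n d \<Phi> X $$ (i * d + a, j * d + b) = \<Phi> (block d X i j) $$ (a, b)"
  using assms pair_index_less[OF assms(1,3)] pair_index_less[OF assms(2,4)]
  by (simp add: id_tensor_def)

lemma block_carrier [simp]: "block d X i j \<in> carrier_mat d d"
  by (simp add: block_def)

lemma block_index: "a < d \<Longrightarrow> b < d \<Longrightarrow> block d X i j $$ (a, b) = X $$ (i * d + a, j * d + b)"
  by (simp add: block_def)

lemma block_id_tensor:
  assumes "\<Phi> \<in> lin_maps d" "i < n" "j < n"
  shows "block d (id_tensor n d \<Phi> X) i j = \<Phi> (block d X i j)"
proof -
  have "\<Phi> (block d X i j) \<in> carrier_mat d d" using assms by (auto simp: lin_maps_def)
  then show ?thesis using assms
    by (intro eq_matI) (auto simp: block_index id_tensor_index carrier_matD[OF block_carrier])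
qed

lemma mat_eq_pairI:
  assumes "X \<in> carrier_mat (m * n) (m * n)" "Y \<in> carrier_mat (m * n) (m * n)"
    "\<And>i j a b. i < m \<Longrightarrow> j < m \<Longrightarrow> a < n \<Longrightarrow> b < n \<Longrightarrow>
       X $$ (i * n + a, j * n + b) = Y $$ (i * n + a, j * n + b)"
  shows "X = Y"
  using assms by (intro eq_matI) (auto elim!: pair_index_cases)

lemma lin_maps_carrier: "\<Phi> \<in> lin_maps d \<Longrightarrow> X \<in> carrier_mat d d \<Longrightarrow> \<Phi> X \<in> carrier_mat d d"
  by (auto simp: lin_maps_def)

lemma lin_maps_add: "\<Phi> \<in> lin_maps d \<Longrightarrow> X \<in> carrier_mat d d \<Longrightarrow> Y \<in> carrier_mat d d \<Longrightarrow>
    \<Phi> (X + Y) = \<Phi> X + \<Phi> Y"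
  by (auto simp: lin_maps_def)

lemma lin_maps_scale: "\<Phi> \<in> lin_maps d \<Longrightarrow> X \<in> carrier_mat d d \<Longrightarrow> \<Phi> (c \<cdot>\<^sub>m X) = c \<cdot>\<^sub>m \<Phi> X"
  by (auto simp: lin_maps_def)

lemma lin_maps_zero:
  assumes "\<Phi> \<in> lin_maps d"
  shows "\<Phi> (0\<^sub>m d d) = 0\<^sub>m d d"
proof -
  have "\<Phi> (0 \<cdot>\<^sub>m 0\<^sub>m d d) = 0 \<cdot>\<^sub>m \<Phi> (0\<^sub>m d d)" by (rule lin_maps_scale[OF assms]) simp
  moreover have "0 \<cdot>\<^sub>m A = 0\<^sub>m d d" if "A \<in> carrier_mat d d" for A :: "complex mat"
    using that by (intro eq_matI) auto
  ultimately show ?thesis using lin_maps_carrier[OF assms, of "0\<^sub>m d d"] by simp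
qed

text \<open>Stated entrywise, so that it applies to blocks of matrices that are known only through a
  rank one decomposition.\<close>

lemma lin_maps_sum:
  assumes \<Phi>: "\<Phi> \<in> lin_maps d" and L: "finite L" and X: "X \<in> carrier_mat d d"
    and Y: "\<And>l. l \<in> L \<Longrightarrow> Y l \<in> carrier_mat d d"
    and e: "\<And>i j. i < d \<Longrightarrow> j < d \<Longrightarrow> X $$ (i, j) = (\<Sum>l\<in>L. c l * Y l $$ (i, j))"
    and ab: "a < d" "b < d"
  shows "\<Phi> X $$ (a, b) = (\<Sum>l\<in>L. c l * \<Phi> (Y l) $$ (a, b))"
  using L X Y e
proof (induction L arbitrary: X)
  case empty
  then have "X = 0\<^sub>m d d" by (intro eq_matI) auto
  then show ?case using lin_maps_zero[OF \<Phi>] ab by simp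
next
  case (insert l L)
  define Z where "Z = mat d d (\<lambda>(i, j). \<Sum>l\<in>L. c l * Y l $$ (i, j))"
  have Z: "Z \<in> carrier_mat d d" by (simp add: Z_def)
  have Yl: "Y l \<in> carrier_mat d d" using insert.prems by auto
  have "X = c l \<cdot>\<^sub>m Y l + Z"
    using insert.prems(1,3) insert.hyps carrier_matD[OF Yl] by (intro eq_matI) (auto simp: Z_def)
  then have "\<Phi> X = c l \<cdot>\<^sub>m \<Phi> (Y l) + \<Phi> Z"
    using Yl Z by (simp add: lin_maps_add[OF \<Phi>] lin_maps_scale[OF \<Phi>])
  then have "\<Phi> X $$ (a, b) = c l * \<Phi> (Y l) $$ (a, b) + \<Phi> Z $$ (a, b)"
    using lin_maps_carrier[OF \<Phi> Yl] lin_maps_carrier[OF \<Phi> Z] ab by simp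
  also have "\<Phi> Z $$ (a, b) = (\<Sum>l\<in>L. c l * \<Phi> (Y l) $$ (a, b))"
    using insert.prems by (intro insert.IH) (auto simp: Z_def)
  finally show ?case using insert.hyps by simp
qed

lemma lin_maps_ext:
  assumes "\<Phi> \<in> lin_maps d" "\<Psi> \<in> lin_maps d" "\<And>X. X \<in> carrier_mat d d \<Longrightarrow> \<Phi> X = \<Psi> X"
  shows "\<Phi> = \<Psi>"
  using assms by (intro extensionalityI[where A="carrier_mat d d"]) (auto simp: lin_maps_def PiE_iff)

lemma lin_mapsI_index:
  assumes c: "\<And>X. X \<in> carrier_mat d d \<Longrightarrow> F X \<in> carrier_mat d d"
    and add: "\<And>X Y a b. X \<in> carrier_mat d d \<Longrightarrow> Y \<in> carrier_mat d d \<Longrightarrow> a < d \<Longrightarrow> b < d \<Longrightarrow>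
      F (X + Y) $$ (a, b) = F X $$ (a, b) + F Y $$ (a, b)"
    and scale: "\<And>k X a b. X \<in> carrier_mat d d \<Longrightarrow> a < d \<Longrightarrow> b < d \<Longrightarrow>
      F (k \<cdot>\<^sub>m X) $$ (a, b) = k * F X $$ (a, b)"
  shows "(\<lambda>X\<in>carrier_mat d d. F X) \<in> lin_maps d"
proof -
  have "F (X + Y) = F X + F Y" if X: "X \<in> carrier_mat d d" and Y: "Y \<in> carrier_mat d d" for X Y
    using carrier_matD[OF c[OF X]] carrier_matD[OF c[OF Y]] carrier_matD[OF c[of "X + Y"]] X Y
    by (intro eq_matI) (simp_all add: add)
  moreover have "F (k \<cdot>\<^sub>m X) = k \<cdot>\<^sub>m F X" if X: "X \<in> carrier_mat d d" for X k
    using carrier_matD[OF c[OF X]] carrier_matD[OF c[of "k \<cdot>\<^sub>m X"]] X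
    by (intro eq_matI) (simp_all add: scale)
  ultimately show ?thesis using c by (simp add: lin_maps_def restrict_PiE_iff)
qed

lemma lin_add_lin_maps:
  assumes "\<Phi> \<in> lin_maps d" "\<Psi> \<in> lin_maps d"
  shows "lin_add d \<Phi> \<Psi> \<in> lin_maps d"
  unfolding lin_add_def
proof (rule lin_mapsI_index)
  note c = lin_maps_carrier[OF assms(1)] lin_maps_carrier[OF assms(2)]
  fix X Y :: "complex mat" and a b k assume X: "X \<in> carrier_mat d d" and ab: "a < d" "b < d"
  note cX = carrier_matD[OF c(1)[OF X]] carrier_matD[OF c(2)[OF X]]
  show "(\<Phi> (k \<cdot>\<^sub>m X) + \<Psi> (k \<cdot>\<^sub>m X)) $$ (a, b) = k * (\<Phi> X + \<Psi> X) $$ (a, b)"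
    using X ab cX assms by (simp add: lin_maps_scale algebra_simps)
  assume Y: "Y \<in> carrier_mat d d"
  note cY = carrier_matD[OF c(1)[OF Y]] carrier_matD[OF c(2)[OF Y]]
  show "(\<Phi> (X + Y) + \<Psi> (X + Y)) $$ (a, b) = (\<Phi> X + \<Psi> X) $$ (a, b) + (\<Phi> Y + \<Psi> Y) $$ (a, b)"
    using X Y ab cX cY assms by (simp add: lin_maps_add)
qed (use assms in \<open>simp add: lin_maps_carrier\<close>)

lemma lin_scale_lin_maps:
  assumes "\<Phi> \<in> lin_maps d"
  shows "lin_scale d t \<Phi> \<in> lin_maps d"
  unfolding lin_scale_def
proof (rule lin_mapsI_index)
  note c = lin_maps_carrier[OF assms]
  fix X Y :: "complex mat" and a b k assume X: "X \<in> carrier_mat d d" and ab: "a < d" "b < d"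
  show "(complex_of_real t \<cdot>\<^sub>m \<Phi> (k \<cdot>\<^sub>m X)) $$ (a, b) = k * (complex_of_real t \<cdot>\<^sub>m \<Phi> X) $$ (a, b)"
    using X ab carrier_matD[OF c[OF X]] assms by (simp add: lin_maps_scale)
  assume Y: "Y \<in> carrier_mat d d"
  show "(complex_of_real t \<cdot>\<^sub>m \<Phi> (X + Y)) $$ (a, b) =
      (complex_of_real t \<cdot>\<^sub>m \<Phi> X) $$ (a, b) + (complex_of_real t \<cdot>\<^sub>m \<Phi> Y) $$ (a, b)"
    using X Y ab carrier_matD[OF c[OF X]] carrier_matD[OF c[OF Y]] assms
    by (simp add: lin_maps_add algebra_simps)
qed (use assms in \<open>simp add: lin_maps_carrier\<close>)

lemma lin_comp_lin_maps:
  assumes "\<Phi> \<in> lin_maps d" "\<Psi> \<in> lin_maps d"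
  shows "lin_comp d \<Phi> \<Psi> \<in> lin_maps d"
  unfolding lin_comp_def compose_def
proof (rule lin_mapsI_index)
  note c = lin_maps_carrier[OF assms(1)] lin_maps_carrier[OF assms(2)]
  fix X Y :: "complex mat" and a b k assume X: "X \<in> carrier_mat d d" and ab: "a < d" "b < d"
  note cX = c(2)[OF X] carrier_matD[OF c(1)[OF c(2)[OF X]]]
  show "\<Phi> (\<Psi> (k \<cdot>\<^sub>m X)) $$ (a, b) = k * \<Phi> (\<Psi> X) $$ (a, b)"
    using X ab cX assms by (simp add: lin_maps_scale)
  assume Y: "Y \<in> carrier_mat d d"
  note cY = c(2)[OF Y] carrier_matD[OF c(1)[OF c(2)[OF Y]]]
  show "\<Phi> (\<Psi> (X + Y)) $$ (a, b) = \<Phi> (\<Psi> X) $$ (a, b) + \<Phi> (\<Psi> Y) $$ (a, b)"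
    using X Y ab cX cY assms by (simp add: lin_maps_add)
qed (use assms in \<open>simp add: lin_maps_carrier\<close>)

lemma transpose_map_lin_maps: "transpose_map d \<in> lin_maps d"
  unfolding transpose_map_def by (rule lin_mapsI_index) auto

lemma id_tensor_lin_add:
  assumes "\<Phi> \<in> lin_maps d" "\<Psi> \<in> lin_maps d"
  shows "id_tensor n d (lin_add d \<Phi> \<Psi>) X = id_tensor n d \<Phi> X + id_tensor n d \<Psi> X"
proof (rule mat_eq_pairI[where m=n and n=d])
  fix i j a b assume ij: "i < n" "j < n" "a < d" "b < d"
  have "\<Phi> (block d X i j) \<in> carrier_mat d d" "\<Psi> (block d X i j) \<in> carrier_mat d d"
    using assms by (auto intro: lin_maps_carrier)
  then show "id_tensor n d (lin_add d \<Phi> \<Psi>) X $$ (i * d + a, j * d + b) =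
      (id_tensor n d \<Phi> X + id_tensor n d \<Psi> X) $$ (i * d + a, j * d + b)"
    using ij pair_index_less[OF ij(1,3)] pair_index_less[OF ij(2,4)]
      carrier_matD[OF id_tensor_carrier[of n d \<Psi> X]]
    by (simp add: id_tensor_index lin_add_def)
qed (auto simp: id_tensor_def)

lemma id_tensor_lin_scale:
  assumes "\<Phi> \<in> lin_maps d"
  shows "id_tensor n d (lin_scale d t \<Phi>) X = complex_of_real t \<cdot>\<^sub>m id_tensor n d \<Phi> X"
proof (rule mat_eq_pairI[where m=n and n=d])
  fix i j a b assume ij: "i < n" "j < n" "a < d" "b < d"
  have "\<Phi> (block d X i j) \<in> carrier_mat d d"
    using assms by (auto intro: lin_maps_carrier)
  then show "id_tensor n d (lin_scale d t \<Phi>) X $$ (i * d + a, j * d + b) =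
      (complex_of_real t \<cdot>\<^sub>m id_tensor n d \<Phi> X) $$ (i * d + a, j * d + b)"
    using ij pair_index_less[OF ij(1,3)] pair_index_less[OF ij(2,4)]
      carrier_matD[OF id_tensor_carrier[of n d \<Phi> X]]
    by (simp add: id_tensor_index lin_scale_def)
qed (auto simp: id_tensor_def)

lemma id_tensor_lin_comp:
  assumes "\<Psi> \<in> lin_maps d"
  shows "id_tensor n d (lin_comp d \<Phi> \<Psi>) X = id_tensor n d \<Phi> (id_tensor n d \<Psi> X)"
  by (rule mat_eq_pairI[where m=n and n=d])
     (auto simp: id_tensor_index lin_comp_def compose_def block_id_tensor[OF assms])

lemma psd_add:
  assumes "A \<in> psd n" "B \<in> psd n"
  shows "A + B \<in> psd n"
proof -
  have c: "A \<in> carrier_mat n n" "B \<in> carrier_mat n n" using assms by (auto simp: psd_def)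
  have "qform n (\<lambda>i j. (A + B) $$ (i, j)) v
      = qform n (\<lambda>i j. A $$ (i, j)) v + qform n (\<lambda>i j. B $$ (i, j)) v" for v
    using c by (simp add: qform_def algebra_simps sum.distrib)
  with assms c show ?thesis by (auto simp: psd_iff_qform)
qed

lemma psd_scale:
  assumes "A \<in> psd n" "t \<ge> 0"
  shows "complex_of_real t \<cdot>\<^sub>m A \<in> psd n"
proof -
  have c: "A \<in> carrier_mat n n" using assms by (auto simp: psd_def)
  have "qform n (\<lambda>i j. (complex_of_real t \<cdot>\<^sub>m A) $$ (i, j)) v
      = of_real t * qform n (\<lambda>i j. A $$ (i, j)) v" for v
    using c by (simp add: qform_def sum_distrib_left algebra_simps)
  moreover have "0 \<le> complex_of_real t" using assms by (simp add: less_eq_complex_def)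
  ultimately show ?thesis using assms c by (auto simp: psd_iff_qform intro!: mult_nonneg_nonneg)
qed

lemma separable_psd: "X \<in> separable m n \<Longrightarrow> X \<in> psd (m * n)"
  by (simp add: separable_def)

lemma separable_sum:
  assumes X: "X \<in> carrier_mat (m * n) (m * n)" and I: "finite I"
    and F: "\<And>x. x \<in> I \<Longrightarrow> F x \<in> separable m n"
    and e: "\<And>i j p q. i < m \<Longrightarrow> j < m \<Longrightarrow> p < n \<Longrightarrow> q < n \<Longrightarrow> X $$ (i * n + p, j * n + q) =
      (\<Sum>x\<in>I. F x $$ (i * n + p, j * n + q))"
  shows "X \<in> separable m n"
proof -
  define P where "P = (\<lambda>x N a b. \<forall>i<m. \<forall>j<m. \<forall>p<n. \<forall>q<n. F x $$ (i * n + p, j * n + q) =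
      (\<Sum>l<N::nat. (a l i * cnj (a l j)) * (b l p * cnj (b l q))))"
  have "\<exists>N a b. P x N a b" if "x \<in> I" for x
    unfolding P_def using F[OF that] by (rule separable_decompose)
  then obtain N a b where "\<And>x. x \<in> I \<Longrightarrow> P x (N x) (a x) (b x)" by metis
  then have ab: "F x $$ (i * n + p, j * n + q) =
      (\<Sum>l<N x. (a x l i * cnj (a x l j)) * (b x l p * cnj (b x l q)))"
    if "x \<in> I" "i < m" "j < m" "p < n" "q < n" for x i j p q
    using that unfolding P_def by simp
  show ?thesis
  proof (rule separableI[OF X, where L="SIGMA x:I. {..<N x}" and a="\<lambda>(x, l). a x l"
        and b="\<lambda>(x, l). b x l"])
    fix i j p q assume ij: "i < m" "j < m" "p < n" "q < n"
    have "X $$ (i * n + p, j * n + q) =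
        (\<Sum>x\<in>I. \<Sum>l<N x. (a x l i * cnj (a x l j)) * (b x l p * cnj (b x l q)))"
      using ij by (simp add: e ab)
    also have "\<dots> = (\<Sum>l\<in>(SIGMA x:I. {..<N x}).
        ((case l of (x, l) \<Rightarrow> a x l) i * cnj ((case l of (x, l) \<Rightarrow> a x l) j)) *
        ((case l of (x, l) \<Rightarrow> b x l) p * cnj ((case l of (x, l) \<Rightarrow> b x l) q)))"
      using I by (subst sum.Sigma) (auto intro!: sum.cong)
    finally show "X $$ (i * n + p, j * n + q) = \<dots>" .
  qed (use I in auto)
qed

lemma separable_add:
  assumes "X \<in> separable m n" "Y \<in> separable m n"
  shows "X + Y \<in> separable m n"
proof -
  have c: "X \<in> carrier_mat (m * n) (m * n)" "Y \<in> carrier_mat (m * n) (m * n)"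
    using assms by (auto simp: separable_def psd_def)
  show ?thesis
  proof (rule separable_sum[where I="{0, 1 :: nat}" and F="\<lambda>x. if x = 0 then X else Y"])
    fix i j p q assume ij: "i < m" "j < m" "p < n" "q < n"
    show "(X + Y) $$ (i * n + p, j * n + q) =
        (\<Sum>x\<in>{0, 1 :: nat}. (if x = 0 then X else Y) $$ (i * n + p, j * n + q))"
      using carrier_matD[OF c(2)] pair_index_less[OF ij(1,3)] pair_index_less[OF ij(2,4)] by simp
  qed (use assms c in auto)
qed

lemma separable_scale:
  assumes "X \<in> separable m n" "t \<ge> 0"
  shows "complex_of_real t \<cdot>\<^sub>m X \<in> separable m n"
proof -
  have c: "X \<in> carrier_mat (m * n) (m * n)"
    using assms by (auto simp: separable_def psd_def)
  obtain N a b where ab: "\<And>i j p q. i < m \<Longrightarrow> j < m \<Longrightarrow> p < n \<Longrightarrow> q < n \<Longrightarrow>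
     X $$ (i * n + p, j * n + q) =
      (\<Sum>l<N::nat. (a l i * cnj (a l j)) * (b l p * cnj (b l q)))"
    using separable_decompose[OF assms(1)] by blast
  have sq: "complex_of_real (sqrt t) * (complex_of_real (sqrt t) * x) = of_real t * x" for x
    using assms(2) by (simp flip: of_real_mult mult.assoc)
  show ?thesis
  proof (rule separableI[where L="{..<N}" and a="\<lambda>l i. of_real (sqrt t) * a l i" and b=b])
    fix i j p q assume ij: "i < m" "j < m" "p < n" "q < n"
    have "(complex_of_real t \<cdot>\<^sub>m X) $$ (i * n + p, j * n + q) = of_real t * X $$ (i * n + p, j * n + q)"
      using carrier_matD[OF c] pair_index_less[OF ij(1,3)] pair_index_less[OF ij(2,4)] by simp
    also have "\<dots> = (\<Sum>l<N. (of_real (sqrt t) * a l i * cnj (of_real (sqrt t) * a l j)) *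
        (b l p * cnj (b l q)))"
      by (simp add: ab[OF ij] sum_distrib_left sq mult_ac)
    finally show "(complex_of_real t \<cdot>\<^sub>m X) $$ (i * n + p, j * n + q) = \<dots>" .
  qed (use c in auto)
qed

text \<open>\<open>id \<otimes> \<Phi>\<close> sends \<open>a a\<^sup>* \<otimes> b b\<^sup>*\<close> to \<open>a a\<^sup>* \<otimes> \<Phi>(b b\<^sup>*)\<close>, and positivity of \<open>\<Phi>\<close> suffices to
  decompose the second factor again.\<close>

lemma separable_id_tensor:
  assumes \<Phi>: "\<Phi> \<in> P_cone d" and X: "X \<in> separable n d"
  shows "id_tensor n d \<Phi> X \<in> separable n d"
proof -
  have lin: "\<Phi> \<in> lin_maps d" using \<Phi> by (simp add: P_cone_def)
  obtain N a b where ab: "\<And>i j p q. i < n \<Longrightarrow> j < n \<Longrightarrow> p < d \<Longrightarrow> q < d \<Longrightarrow>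
     X $$ (i * d + p, j * d + q) =
      (\<Sum>l<N::nat. (a l i * cnj (a l j)) * (b l p * cnj (b l q)))"
    using separable_decompose[OF X] by blast
  define B where "B = (\<lambda>l. mat d d (\<lambda>(p, q). b l p * cnj (b l q)))"
  have B: "B l \<in> psd d" for l
    by (rule psdI_rank_ones[where L="{()}" and V="\<lambda>_. b l"]) (auto simp: B_def)
  define P where "P = (\<lambda>l S W. \<forall>i<d. \<forall>j<d. \<Phi> (B l) $$ (i, j) = (\<Sum>s<S::nat. W s i * cnj (W s j)))"
  have "\<exists>S W. P l S W" for l
    unfolding P_def using \<Phi> B by (intro psd_decompose) (auto simp: P_cone_def)
  then obtain S W where "\<And>l. P l (S l) (W l)" by metis
  then have W: "\<Phi> (B l) $$ (i, j) = (\<Sum>s<S l. W l s i * cnj (W l s j))" if "i < d" "j < d" for l i j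
    using that unfolding P_def by simp
  show ?thesis
  proof (rule separableI[where L="SIGMA l:{..<N}. {..<S l}" and a="\<lambda>(l, s). a l" and b="\<lambda>(l, s). W l s"])
    fix i j p q assume ij: "i < n" "j < n" "p < d" "q < d"
    have "id_tensor n d \<Phi> X $$ (i * d + p, j * d + q) = \<Phi> (block d X i j) $$ (p, q)"
      using ij by (simp add: id_tensor_index)
    also have "\<dots> = (\<Sum>l<N. (a l i * cnj (a l j)) * \<Phi> (B l) $$ (p, q))"
      by (rule lin_maps_sum[OF lin]) (use ij in \<open>auto simp: B_def block_index ab\<close>)
    also have "\<dots> = (\<Sum>l<N. \<Sum>s<S l. (a l i * cnj (a l j)) * (W l s p * cnj (W l s q)))"
      using ij by (simp add: W sum_distrib_left)
    also have "\<dots> = (\<Sum>l\<in>(SIGMA l:{..<N}. {..<S l}).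
        ((case l of (l, s) \<Rightarrow> a l) i * cnj ((case l of (l, s) \<Rightarrow> a l) j)) *
        ((case l of (l, s) \<Rightarrow> W l s) p * cnj ((case l of (l, s) \<Rightarrow> W l s) q)))"
      by (subst sum.Sigma) (auto intro!: sum.cong)
    finally show "id_tensor n d \<Phi> X $$ (i * d + p, j * d + q) = \<dots>" .
  qed auto
qed

lemma Pn_cone_subset_P_cone:
  assumes "n \<ge> 1"
  shows "Pn_cone n d \<subseteq> P_cone d"
proof
  fix \<Phi> assume \<Phi>: "\<Phi> \<in> Pn_cone n d"
  then have lin: "\<Phi> \<in> lin_maps d" by (simp add: Pn_cone_def)
  have "\<Phi> X \<in> psd d" if X: "X \<in> psd d" for X
  proof -
    have Xc: "X \<in> carrier_mat d d" using X by (simp add: psd_def)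
    \<comment> \<open>Place \<open>X\<close> in the upper left block.\<close>
    define Y where "Y = mat (n * d) (n * d) (\<lambda>(p, q). if p < d \<and> q < d then X $$ (p, q) else 0)"
    obtain N V where V: "\<And>i j. i < d \<Longrightarrow> j < d \<Longrightarrow> X $$ (i, j) = (\<Sum>l<N::nat. V l i * cnj (V l j))"
      using psd_decompose[OF X] by blast
    have "Y \<in> psd (n * d)"
      by (rule psdI_rank_ones[where L="{..<N}" and V="\<lambda>l p. if p < d then V l p else 0"])
         (auto simp: Y_def V)
    then have pos: "0 \<le> qform (n * d) (\<lambda>i j. id_tensor n d \<Phi> Y $$ (i, j)) v" for v
      using \<Phi> by (auto simp: Pn_cone_def psd_iff_qform)
    have dn: "p < n * d" if "p < d" for p using pair_index_less[of 0 n p d] that assms by linarith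
    have blk: "block d Y 0 0 = X" using Xc by (intro eq_matI) (auto simp: block_def Y_def dn)
    have "0 \<le> qform d (\<lambda>i j. \<Phi> X $$ (i, j)) v" for v
    proof -
      have sum0: "(\<Sum>p<n * d. if p < d then f p else 0) = (\<Sum>p<d. f p)" for f :: "nat \<Rightarrow> complex"
        by (rule sum.mono_neutral_cong_right) (use dn assms in auto)
      have "qform (n * d) (\<lambda>i j. id_tensor n d \<Phi> Y $$ (i, j)) (\<lambda>p. if p < d then v p else 0) =
        (\<Sum>p<n * d. if p < d then (\<Sum>q<n * d. if q < d
          then cnj (v p) * id_tensor n d \<Phi> Y $$ (p, q) * v q else 0) else 0)"
        unfolding qform_def by (intro sum.cong refl) (auto intro!: sum.cong)
      also have "\<dots> = (\<Sum>p<d. \<Sum>q<d. cnj (v p) * id_tensor n d \<Phi> Y $$ (p, q) * v q)"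
        by (simp only: sum0)
      also have "\<dots> = qform d (\<lambda>i j. \<Phi> X $$ (i, j)) v"
        unfolding qform_def
        by (intro sum.cong refl) (use assms id_tensor_index[of 0 n 0 _ d _ \<Phi> Y] in \<open>auto simp: blk\<close>)
      finally show ?thesis using pos[of "\<lambda>p. if p < d then v p else 0"] by simp
    qed
    with lin_maps_carrier[OF lin Xc] show ?thesis by (simp add: psd_iff_qform)
  qed
  with lin show "\<Phi> \<in> P_cone d" by (simp add: P_cone_def)
qed

lemma Pn_cone_add: "\<Phi> \<in> Pn_cone n d \<Longrightarrow> \<Psi> \<in> Pn_cone n d \<Longrightarrow> lin_add d \<Phi> \<Psi> \<in> Pn_cone n d"
  by (auto simp: Pn_cone_def lin_add_lin_maps id_tensor_lin_add psd_add)

lemma Pn_cone_scale: "\<Phi> \<in> Pn_cone n d \<Longrightarrow> t \<ge> 0 \<Longrightarrow> lin_scale d t \<Phi> \<in> Pn_cone n d"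
  by (auto simp: Pn_cone_def lin_scale_lin_maps id_tensor_lin_scale psd_scale)

lemma Pn_cone_comp: "\<Phi> \<in> Pn_cone n d \<Longrightarrow> \<Psi> \<in> Pn_cone n d \<Longrightarrow> lin_comp d \<Phi> \<Psi> \<in> Pn_cone n d"
  by (auto simp: Pn_cone_def lin_comp_lin_maps id_tensor_lin_comp)

lemma CP_cone_add: "\<Phi> \<in> CP_cone d \<Longrightarrow> \<Psi> \<in> CP_cone d \<Longrightarrow> lin_add d \<Phi> \<Psi> \<in> CP_cone d"
  by (auto simp: CP_cone_def lin_add_lin_maps Pn_cone_add)

lemma CP_cone_scale: "\<Phi> \<in> CP_cone d \<Longrightarrow> t \<ge> 0 \<Longrightarrow> lin_scale d t \<Phi> \<in> CP_cone d"
  by (auto simp: CP_cone_def lin_scale_lin_maps Pn_cone_scale)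

lemma CP_cone_comp: "\<Phi> \<in> CP_cone d \<Longrightarrow> \<Psi> \<in> CP_cone d \<Longrightarrow> lin_comp d \<Phi> \<Psi> \<in> CP_cone d"
  by (auto simp: CP_cone_def lin_comp_lin_maps Pn_cone_comp)

lemma CP_cone_subset_Pn_cone: "n \<ge> 1 \<Longrightarrow> CP_cone d \<subseteq> Pn_cone n d"
  by (auto simp: CP_cone_def)

lemma EBk_cone_add: "\<Phi> \<in> EBk_cone k d \<Longrightarrow> \<Psi> \<in> EBk_cone k d \<Longrightarrow> lin_add d \<Phi> \<Psi> \<in> EBk_cone k d"
  using Pn_cone_add[of \<Phi> k d \<Psi>]
  by (auto simp: EBk_cone_def Pn_cone_def id_tensor_lin_add separable_add)

lemma EBk_cone_scale: "\<Phi> \<in> EBk_cone k d \<Longrightarrow> t \<ge> 0 \<Longrightarrow> lin_scale d t \<Phi> \<in> EBk_cone k d"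
  using Pn_cone_scale[of \<Phi> k d t]
  by (auto simp: EBk_cone_def Pn_cone_def id_tensor_lin_scale separable_scale)

text \<open>The inner map \<open>\<Psi>\<close> preserves positivity of the input, so that \<open>\<Theta>\<close> produces a separable
  matrix, and the outer map \<open>\<Phi>\<close> preserves separability.\<close>

lemma EBk_cone_comp:
  assumes \<Theta>: "\<Theta> \<in> EBk_cone k d" and \<Phi>: "\<Phi> \<in> CP_cone d" and \<Psi>: "\<Psi> \<in> CP_cone d" and k: "k \<ge> 1"
  shows "lin_comp d \<Phi> (lin_comp d \<Theta> \<Psi>) \<in> EBk_cone k d"
proof -
  have n: "\<Phi> \<in> Pn_cone k d" "\<Psi> \<in> Pn_cone k d" "\<Theta> \<in> Pn_cone k d"
    using assms CP_cone_subset_Pn_cone[OF k] by (auto simp: EBk_cone_def)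
  then have lin: "\<Phi> \<in> lin_maps d" "\<Psi> \<in> lin_maps d" "\<Theta> \<in> lin_maps d" by (auto simp: Pn_cone_def)
  have P: "\<Phi> \<in> P_cone d" using n Pn_cone_subset_P_cone[OF k] by auto
  have "id_tensor k d (lin_comp d \<Phi> (lin_comp d \<Theta> \<Psi>)) X \<in> separable k d" if "X \<in> psd (k * d)" for X
  proof -
    have "id_tensor k d \<Psi> X \<in> psd (k * d)" using n that by (auto simp: Pn_cone_def)
    then have "id_tensor k d \<Theta> (id_tensor k d \<Psi> X) \<in> separable k d"
      using \<Theta> by (auto simp: EBk_cone_def)
    then show ?thesis using lin
      by (simp add: id_tensor_lin_comp lin_comp_lin_maps separable_id_tensor[OF P])
  qed
  with n show ?thesis by (simp add: EBk_cone_def Pn_cone_comp)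
qed

section \<open>Closedness of the set of separable matrices and of the cones\<close>

lemma topspace_lin_maps: "topspace (lin_maps_topology d) = lin_maps d"
  by (simp add: lin_maps_topology_def topspace_pullback_topology)

lemma closedin_lin_maps:
  assumes "continuous_on UNIV F" "closed K"
  shows "closedin (lin_maps_topology d) {\<Phi> \<in> lin_maps d. F (entries d \<Phi>) \<in> K}"
  unfolding closedin_def topspace_lin_maps
proof
  have "open (F -` (- K))" using assms by (intro open_vimage) auto
  moreover have "lin_maps d - {\<Phi> \<in> lin_maps d. F (entries d \<Phi>) \<in> K} =
      entries d -` (F -` (- K)) \<inter> lin_maps d" by auto
  ultimately show "openin (lin_maps_topology d) (lin_maps d - {\<Phi> \<in> lin_maps d. F (entries d \<Phi>) \<in> K})"
    unfolding lin_maps_topology_def openin_pullback_topology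
    by (intro exI[of _ "F -` (- K)"] conjI) simp_all
qed auto

text \<open>An entry of \<open>(id \<otimes> \<Phi>)(X)\<close> is an entry of \<open>\<Phi>\<close> at a block of \<open>X\<close>, hence depends continuously
  on \<open>\<Phi>\<close>. Matrices are described by functions on pairs of indices, so that closedness refers to a
  product topology; values outside the matrix are ignored.\<close>

lemma closedin_id_tensor:
  assumes "closed {h. mat (n * d) (n * d) h \<in> S}"
  shows "closedin (lin_maps_topology d) {\<Phi> \<in> lin_maps d. id_tensor n d \<Phi> X \<in> S}"
proof -
  define F :: "(complex mat \<times> nat \<times> nat \<Rightarrow> complex) \<Rightarrow> nat \<times> nat \<Rightarrow> complex"
    where "F = (\<lambda>g (i, j). g (block d X (i div d) (j div d), i mod d, j mod d))"
  have "continuous_on UNIV F"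
  proof (rule continuous_on_coordinatewise_then_product)
    fix p :: "nat \<times> nat"
    show "continuous_on UNIV (\<lambda>g. F g p)"
      by (cases p) (simp add: F_def)
  qed
  from closedin_lin_maps[OF this assms, of d]
  have "closedin (lin_maps_topology d)
      {\<Phi> \<in> lin_maps d. mat (n * d) (n * d) (F (entries d \<Phi>)) \<in> S}" by simp
  moreover have "mat (n * d) (n * d) (F (entries d \<Phi>)) = id_tensor n d \<Phi> X" for \<Phi>
  proof (rule eq_matI)
    fix i j assume "i < dim_row (id_tensor n d \<Phi> X)" "j < dim_col (id_tensor n d \<Phi> X)"
    then have ij: "i < n * d" "j < n * d" by (auto simp: id_tensor_def)
    then have "0 < d" by (cases d) auto
    then show "mat (n * d) (n * d) (F (entries d \<Phi>)) $$ (i, j) = id_tensor n d \<Phi> X $$ (i, j)"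
      using ij by (simp add: F_def id_tensor_def entries_def)
  qed (auto simp: id_tensor_def)
  ultimately show ?thesis by simp
qed

lemma closed_psd: "closed {h. mat n n h \<in> psd n}"
proof -
  have "{h. mat n n h \<in> psd n} =
      {h. \<forall>v. 0 \<le> Re (\<Sum>i<n. \<Sum>j<n. cnj (v i) * h (i, j) * v j) \<and>
        Im (\<Sum>i<n. \<Sum>j<n. cnj (v i) * h (i, j) * v j) = 0}"
    by (auto simp: psd_iff_qform qform_def less_eq_complex_def)
  also have "closed \<dots>"
    by (intro closed_Collect_all closed_Collect_conj closed_Collect_le closed_Collect_eq
        continuous_intros continuous_on_product_coordinates)
  finally show ?thesis .
qed

lemma closedin_lin_maps_all:
  assumes "\<And>X. X \<in> I \<Longrightarrow> closedin (lin_maps_topology d) {\<Phi> \<in> lin_maps d. P X \<Phi>}"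
  shows "closedin (lin_maps_topology d) {\<Phi> \<in> lin_maps d. \<forall>X\<in>I. P X \<Phi>}"
proof (cases "I = {}")
  case True
  then show ?thesis using closedin_topspace[of "lin_maps_topology d"] by (simp add: topspace_lin_maps)
next
  case False
  then have "{\<Phi> \<in> lin_maps d. \<forall>X\<in>I. P X \<Phi>} = (\<Inter>X\<in>I. {\<Phi> \<in> lin_maps d. P X \<Phi>})" by auto
  with False assms show ?thesis by auto
qed

lemma closedin_Pn_cone: "closedin (lin_maps_topology d) (Pn_cone n d)"
  unfolding Pn_cone_def by (intro closedin_lin_maps_all closedin_id_tensor closed_psd)

lemma closedin_CP_cone: "closedin (lin_maps_topology d) (CP_cone d)"
proof -
  have "CP_cone d = {\<Phi> \<in> lin_maps d. \<forall>n\<in>{1..}. \<Phi> \<in> Pn_cone n d}" by (auto simp: CP_cone_def)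
  moreover have "{\<Phi> \<in> lin_maps d. \<Phi> \<in> Pn_cone n d} = Pn_cone n d" for n by (auto simp: Pn_cone_def)
  ultimately show ?thesis by (simp only:) (intro closedin_lin_maps_all, simp add: closedin_Pn_cone)
qed

text \<open>The vectors, padded with zeros, are the columns of a square matrix whose row number \<open>D\<close> is
  zero; hence the determinant vanishes.\<close>

lemma linear_relation_exists:
  fixes f :: "'l \<Rightarrow> nat \<Rightarrow> real"
  assumes L: "finite L" and card: "D < card L"
  shows "\<exists>t. (\<exists>l\<in>L. t l \<noteq> 0) \<and> (\<forall>i<D. (\<Sum>l\<in>L. t l * f l i) = 0)"
proof -
  define N where "N = card L"
  obtain h where h: "bij_betw h {..<N} L"
    using ex_bij_betw_nat_finite[OF L] by (auto simp: atLeast0LessThan N_def)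
  define A where "A = mat N N (\<lambda>(i, l). if i < D then f (h l) i else 0)"
  have A: "A \<in> carrier_mat N N" by (simp add: A_def)
  have "transpose_mat A *\<^sub>v unit_vec N D = 0\<^sub>v N"
    using card by (intro eq_vecI) (auto simp: A_def N_def)
  moreover have "unit_vec N D \<noteq> (0\<^sub>v N :: real vec)" using card by (simp add: N_def)
  ultimately have "det (transpose_mat A) = 0"
    using A by (subst det_0_iff_vec_prod_zero_field[where n=N]) (auto intro!: exI[of _ "unit_vec N D"])
  then have "det A = 0" using det_transpose[OF A] by simp
  then obtain v where v: "v \<in> carrier_vec N" "v \<noteq> 0\<^sub>v N" "A *\<^sub>v v = 0\<^sub>v N"
    using det_0_iff_vec_prod_zero_field[OF A] by blast
  define t where "t = (\<lambda>l. v $ (inv_into {..<N} h l))"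
  have th: "t (h l) = v $ l" if "l < N" for l
    using that h by (simp add: t_def bij_betw_def)
  have "\<exists>l<N. v $ l \<noteq> 0"
  proof (rule ccontr)
    assume "\<not> ?thesis"
    then have "v = 0\<^sub>v N" using v(1) by (intro eq_vecI) auto
    with v(2) show False by simp
  qed
  then have "\<exists>l\<in>L. t l \<noteq> 0" using th h by (auto simp: bij_betw_def)
  moreover have "(\<Sum>l\<in>L. t l * f l i) = 0" if i: "i < D" for i
  proof -
    have "(\<Sum>l\<in>L. t l * f l i) = (\<Sum>l<N. v $ l * f (h l) i)"
      by (subst sum.reindex_bij_betw[OF h, symmetric]) (simp add: th)
    also have "\<dots> = (A *\<^sub>v v) $ i"
      using i card v(1) by (simp add: A_def N_def scalar_prod_def atLeast0LessThan mult.commute)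
    also have "\<dots> = 0" using v(3) i card by (simp add: N_def)
    finally show ?thesis .
  qed
  ultimately show ?thesis by blast
qed

text \<open>Caratheodory's theorem for cones. Subtracting a multiple of a linear relation \<open>t\<close> from the
  coefficients \<open>1\<close> keeps the sum; the multiple \<open>1 / max t\<close> is the largest that keeps all
  coefficients nonnegative, and it removes a term.\<close>

lemma conic_caratheodory:
  fixes f :: "'l \<Rightarrow> nat \<Rightarrow> real"
  assumes "finite L"
  shows "\<exists>c. (\<forall>l\<in>L. 0 \<le> c l) \<and> card {l\<in>L. c l \<noteq> 0} \<le> D \<and>
    (\<forall>i<D. (\<Sum>l\<in>L. c l * f l i) = (\<Sum>l\<in>L. f l i))"
  using assms
proof (induction L arbitrary: f rule: finite_psubset_induct)
  case (psubset L)
  show ?case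
  proof (cases "card L \<le> D")
    case True
    then show ?thesis by (intro exI[of _ "\<lambda>_. 1"]) simp
  next
    case False
    then obtain t0 where t0: "\<exists>l\<in>L. t0 l \<noteq> 0" "\<forall>i<D. (\<Sum>l\<in>L. t0 l * f l i) = 0"
      using linear_relation_exists[OF psubset.hyps, of D f] by auto
    define t where "t = (if \<exists>l\<in>L. t0 l > 0 then t0 else (\<lambda>l. - t0 l))"
    have t: "\<exists>l\<in>L. t l > 0" "\<And>i. i < D \<Longrightarrow> (\<Sum>l\<in>L. t l * f l i) = 0"
      using t0 by (auto simp: t_def sum_negf not_less order_le_less)
    define T where "T = Max (t ` L)"
    have T: "T \<in> t ` L" "\<And>l. l \<in> L \<Longrightarrow> t l \<le> T"
      using t(1) psubset.hyps by (auto simp: T_def intro!: Max_in)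
    have Tp: "T > 0" using t(1) T(2) by force
    define c0 where "c0 = (\<lambda>l. 1 - t l / T)"
    have c0: "0 \<le> c0 l" if "l \<in> L" for l using T(2)[OF that] Tp by (simp add: c0_def)
    define L' where "L' = {l \<in> L. c0 l \<noteq> 0}"
    have "L' \<subset> L"
    proof -
      obtain l where "l \<in> L" "t l = T" using T(1) by auto
      then have "l \<in> L - L'" using Tp by (simp add: L'_def c0_def)
      then show ?thesis by (auto simp: L'_def)
    qed
    from psubset.IH[OF this, of "\<lambda>l i. c0 l * f l i"] obtain c where
      c: "\<forall>l\<in>L'. 0 \<le> c l" "card {l\<in>L'. c l \<noteq> 0} \<le> D"
        "\<forall>i<D. (\<Sum>l\<in>L'. c l * (c0 l * f l i)) = (\<Sum>l\<in>L'. c0 l * f l i)" by blast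
    define e where "e = (\<lambda>l. if l \<in> L' then c l * c0 l else 0)"
    have "{l \<in> L. e l \<noteq> 0} \<subseteq> {l\<in>L'. c l \<noteq> 0}" by (auto simp: e_def)
    moreover have "finite {l\<in>L'. c l \<noteq> 0}" using psubset.hyps by (auto simp: L'_def)
    ultimately have "card {l\<in>L. e l \<noteq> 0} \<le> D" using card_mono c(2) order_trans by blast
    moreover have "\<forall>l\<in>L. 0 \<le> e l" using c(1) c0 by (auto simp: e_def L'_def)
    moreover have "(\<Sum>l\<in>L. e l * f l i) = (\<Sum>l\<in>L. f l i)" if i: "i < D" for i
    proof -
      have "(\<Sum>l\<in>L. e l * f l i) = (\<Sum>l\<in>L'. c l * (c0 l * f l i))"
        using psubset.hyps
        by (intro sum.mono_neutral_cong_right) (auto simp: e_def L'_def)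
      also have "\<dots> = (\<Sum>l\<in>L'. c0 l * f l i)" using c(3) i by simp
      also have "\<dots> = (\<Sum>l\<in>L. c0 l * f l i)"
        using psubset.hyps by (intro sum.mono_neutral_left) (auto simp: L'_def)
      also have "\<dots> = (\<Sum>l\<in>L. f l i) - (\<Sum>l\<in>L. t l * f l i) / T"
        by (simp add: c0_def left_diff_distrib sum_subtractf sum_divide_distrib)
      finally show ?thesis using t(2)[OF i] by simp
    qed
    ultimately show ?thesis by blast
  qed
qed

text \<open>The number of product terms can be bounded by the real dimension of the space of matrices. A
  bound independent of the matrix is what makes the compactness argument for \<open>closed_separable\<close>
  possible.\<close>

lemma separable_few_terms:
  assumes "X \<in> separable m n"
  shows "\<exists>a b. \<forall>i<m. \<forall>j<m. \<forall>p<n. \<forall>q<n. X $$ (i * n + p, j * n + q) =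
      (\<Sum>l<2 * (m * n * (m * n)). (a l i * cnj (a l j)) * (b l p * cnj (b l q)))"
proof -
  define K where "K = m * n"
  define D where "D = 2 * (K * K)"
  obtain N a b where ab: "\<And>i j p q. i < m \<Longrightarrow> j < m \<Longrightarrow> p < n \<Longrightarrow> q < n \<Longrightarrow>
     X $$ (i * n + p, j * n + q) =
      (\<Sum>l<N::nat. (a l i * cnj (a l j)) * (b l p * cnj (b l q)))"
    using separable_decompose[OF assms] by blast
  define z where "z = (\<lambda>l r s. (a l (r div n) * cnj (a l (s div n))) * (b l (r mod n) * cnj (b l (s mod n))))"
  \<comment> \<open>List the real and imaginary parts of the entries of one term as a real vector.\<close>
  define f where "f = (\<lambda>l i. let w = z l (i div 2 div K) (i div 2 mod K) in if even i then Re w else Im w)"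
  obtain c where c: "\<forall>l\<in>{..<N}. 0 \<le> c l" "card {l\<in>{..<N}. c l \<noteq> 0} \<le> D"
    "\<forall>i<D. (\<Sum>l<N. c l * f l i) = (\<Sum>l<N. f l i)"
    using conic_caratheodory[of "{..<N}" D f] by auto
  have cz: "(\<Sum>l<N. of_real (c l) * z l r s) = (\<Sum>l<N. z l r s)" if rs: "r < K" "s < K" for r s
  proof -
    define i where "i = r * K + s"
    have i: "i < K * K" unfolding i_def using pair_index_less rs by blast
    have "i div K = r" "i mod K = s" using rs by (auto simp: i_def)
    then have "f l (2 * i) = Re (z l r s)" "f l (2 * i + 1) = Im (z l r s)" for l
      by (simp_all add: f_def)
    moreover have "2 * i < D" "2 * i + 1 < D" using i by (auto simp: D_def)
    ultimately have "(\<Sum>l<N. c l * Re (z l r s)) = (\<Sum>l<N. Re (z l r s))"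
      "(\<Sum>l<N. c l * Im (z l r s)) = (\<Sum>l<N. Im (z l r s))"
      using c(3)[rule_format, of "2 * i"] c(3)[rule_format, of "2 * i + 1"] by simp_all
    then show ?thesis by (simp add: complex_eq_iff)
  qed
  define M where "M = {l\<in>{..<N}. c l \<noteq> 0}"
  have M: "finite M" by (simp add: M_def)
  obtain h where h: "bij_betw h {..<card M} M"
    using ex_bij_betw_nat_finite[OF M] by (auto simp: atLeast0LessThan)
  define a' where "a' = (\<lambda>l. if l < card M then a (h l) else (\<lambda>_. 0))"
  define b' where "b' = (\<lambda>l p. of_real (sqrt (c (h l))) * b (h l) p)"
  have "X $$ (i * n + p, j * n + q) = (\<Sum>l<D. (a' l i * cnj (a' l j)) * (b' l p * cnj (b' l q)))"
    if ij: "i < m" "j < m" "p < n" "q < n" for i j p q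
  proof -
    let ?r = "i * n + p" let ?s = "j * n + q"
    have rs: "?r < K" "?s < K" using pair_index_less ij by (auto simp: K_def)
    have zi: "z l ?r ?s = (a l i * cnj (a l j)) * (b l p * cnj (b l q))" for l
      using ij by (simp add: z_def)
    have "X $$ (?r, ?s) = (\<Sum>l<N. of_real (c l) * z l ?r ?s)"
      unfolding cz[OF rs] using ab[OF ij] by (simp add: zi)
    also have "\<dots> = (\<Sum>l\<in>M. of_real (c l) * z l ?r ?s)"
      by (rule sum.mono_neutral_right) (auto simp: M_def)
    also have "\<dots> = (\<Sum>l<card M. of_real (c (h l)) * z (h l) ?r ?s)"
      by (rule sum.reindex_bij_betw[OF h, symmetric])
    also have "\<dots> = (\<Sum>l<card M. (a' l i * cnj (a' l j)) * (b' l p * cnj (b' l q)))"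
    proof (rule sum.cong)
      fix l assume l: "l \<in> {..<card M}"
      then have "h l \<in> M" using h by (auto simp: bij_betw_def)
      then have "c (h l) \<ge> 0" using c(1) by (auto simp: M_def)
      then have "complex_of_real (sqrt (c (h l))) * complex_of_real (sqrt (c (h l))) = of_real (c (h l))"
        by (simp flip: of_real_mult)
      then show "of_real (c (h l)) * z (h l) ?r ?s = (a' l i * cnj (a' l j)) * (b' l p * cnj (b' l q))"
        using l by (simp add: zi a'_def b'_def mult_ac)
    qed simp
    also have "\<dots> = (\<Sum>l<D. (a' l i * cnj (a' l j)) * (b' l p * cnj (b' l q)))"
      using c(2) by (intro sum.mono_neutral_left) (auto simp: a'_def M_def)
    finally show ?thesis .
  qed
  then show ?thesis unfolding D_def K_def by (intro exI[of _ a'] exI[of _ b'] allI impI)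
qed

text \<open>The first factor can be normalised. Then the squared norms of the second factors add up to
  the trace.\<close>

lemma separable_bounded_terms:
  assumes X: "X \<in> separable m n" and tr: "Re (\<Sum>r<m * n. X $$ (r, r)) \<le> c"
  shows "\<exists>a b. (\<forall>l i. cmod (a l i) \<le> 1) \<and> (\<forall>l p. cmod (b l p) \<le> 1 + c) \<and>
    (\<forall>i<m. \<forall>j<m. \<forall>p<n. \<forall>q<n. X $$ (i * n + p, j * n + q) =
      (\<Sum>l<2 * (m * n * (m * n)). (a l i * cnj (a l j)) * (b l p * cnj (b l q))))"
proof -
  define D where "D = 2 * (m * n * (m * n))"
  obtain a b where ab: "\<And>i j p q. i < m \<Longrightarrow> j < m \<Longrightarrow> p < n \<Longrightarrow> q < n \<Longrightarrow>
     X $$ (i * n + p, j * n + q) = (\<Sum>l<D. (a l i * cnj (a l j)) * (b l p * cnj (b l q)))"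
    using separable_few_terms[OF X] unfolding D_def by blast
  define s where "s = (\<lambda>l. sqrt (\<Sum>i<m. (cmod (a l i))\<^sup>2))"
  have s0: "s l \<ge> 0" for l by (simp add: s_def sum_nonneg)
  have ss: "(s l)\<^sup>2 = (\<Sum>i<m. (cmod (a l i))\<^sup>2)" for l by (simp add: s_def sum_nonneg)
  have as: "cmod (a l i) \<le> s l" if "i < m" for l i
    unfolding s_def by (rule real_le_rsqrt) (use that in \<open>auto intro!: member_le_sum\<close>)
  \<comment> \<open>Division by zero yields \<open>0\<close>, which is the right value when the first factor vanishes.\<close>
  define a' where "a' = (\<lambda>l i. if i < m then a l i / of_real (s l) else 0)"
  define b' where "b' = (\<lambda>l p. if l < D \<and> p < n then of_real (s l) * b l p else 0)"
  have "cmod (a' l i) \<le> 1" for l i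
    using as[of i l] s0[of l] by (auto simp: a'_def norm_divide divide_le_eq_1)
  have e: "(a' l i * cnj (a' l j)) * (b' l p * cnj (b' l q)) = (a l i * cnj (a l j)) * (b l p * cnj (b l q))"
    if "i < m" "j < m" "p < n" "q < n" "l < D" for l i j p q
    using as[of i l] that by (auto simp: a'_def b'_def)
  have "cmod (b' l p) \<le> 1 + c" for l p
  proof -
    have c0: "0 \<le> c"
    proof -
      have "0 \<le> (\<Sum>r<m * n. X $$ (r, r))"
      proof (rule sum_nonneg)
        fix r assume "r \<in> {..<m * n}"
        then show "0 \<le> X $$ (r, r)"
          using separable_psd[OF X] qform_one_point[of r "m * n" "\<lambda>i j. X $$ (i, j)"]
          by (auto simp: psd_iff_qform dest!: spec[of _ "\<lambda>x. if x = r then 1 else 0"])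
      qed
      then show ?thesis using tr by (simp add: less_eq_complex_def)
    qed
    show ?thesis
    proof (cases "l < D \<and> p < n")
      case True
      have "(cmod (b' l p))\<^sup>2 = (s l)\<^sup>2 * (cmod (b l p))\<^sup>2"
        using True by (simp add: b'_def norm_mult power_mult_distrib)
      also have "\<dots> = (\<Sum>i<m. (cmod (a l i))\<^sup>2 * (cmod (b l p))\<^sup>2)"
        by (simp add: ss sum_distrib_right)
      also have "\<dots> \<le> (\<Sum>i<m. \<Sum>q<n. \<Sum>k<D. (cmod (a k i))\<^sup>2 * (cmod (b k q))\<^sup>2)"
      proof (rule sum_mono)
        fix i assume "i \<in> {..<m}"
        have "(cmod (a l i))\<^sup>2 * (cmod (b l p))\<^sup>2 \<le> (\<Sum>k<D. (cmod (a k i))\<^sup>2 * (cmod (b k p))\<^sup>2)"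
          using True by (intro member_le_sum) auto
        also have "\<dots> \<le> (\<Sum>q<n. \<Sum>k<D. (cmod (a k i))\<^sup>2 * (cmod (b k q))\<^sup>2)"
          using True by (intro member_le_sum[of p _ "\<lambda>q. \<Sum>k<D. (cmod (a k i))\<^sup>2 * (cmod (b k q))\<^sup>2"])
            (auto intro!: sum_nonneg)
        finally show "(cmod (a l i))\<^sup>2 * (cmod (b l p))\<^sup>2 \<le> \<dots>" .
      qed
      also have "\<dots> = Re (\<Sum>r<m * n. X $$ (r, r))"
      proof -
        have "Re (X $$ (i * n + q, i * n + q)) = (\<Sum>k<D. (cmod (a k i))\<^sup>2 * (cmod (b k q))\<^sup>2)"
          if "i < m" "q < n" for i q
          using that by (simp add: ab flip: complex_norm_square of_real_power of_real_mult)
        then show ?thesis unfolding sum_pair_index by simp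
      qed
      also have "\<dots> \<le> c" by (rule tr)
      finally have sq: "(cmod (b' l p))\<^sup>2 \<le> c" .
      have "cmod (b' l p) \<le> 1 + (cmod (b' l p))\<^sup>2"
      proof -
        have "0 \<le> (cmod (b' l p) - 1)\<^sup>2" by simp
        then have "2 * cmod (b' l p) \<le> 1 + (cmod (b' l p))\<^sup>2" by (simp add: power2_diff)
        then show ?thesis using norm_ge_zero[of "b' l p"] by linarith
      qed
      with sq show ?thesis by linarith
    next
      case False
      with c0 show ?thesis by (auto simp: b'_def)
    qed
  qed
  moreover have "X $$ (i * n + p, j * n + q) = (\<Sum>l<D. (a' l i * cnj (a' l j)) * (b' l p * cnj (b' l q)))"
    if "i < m" "j < m" "p < n" "q < n" for i j p q
    using that by (simp add: ab e)
  ultimately show ?thesis using \<open>\<And>l i. cmod (a' l i) \<le> 1\<close>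
    unfolding D_def by (intro exI[of _ a'] exI[of _ b'] conjI allI impI)
qed

lemma compact_complex_square: "compact {z. \<bar>Re z\<bar> \<le> B \<and> \<bar>Im z\<bar> \<le> B}"
proof -
  have "compact ((\<lambda>(x, y). of_real x + \<i> * of_real y) ` ({-B..B} \<times> {-B..B}))"
    unfolding case_prod_beta
    by (intro compact_continuous_image compact_Times compact_Icc continuous_intros)
  moreover have "(\<lambda>(x, y). of_real x + \<i> * of_real y) ` ({-B..B} \<times> {-B..B}) =
      {z. \<bar>Re z\<bar> \<le> B \<and> \<bar>Im z\<bar> \<le> B}" (is "?l = ?r")
  proof
    show "?r \<subseteq> ?l"
    proof
      fix z assume "z \<in> ?r"
      then show "z \<in> ?l" by (intro image_eqI[where x="(Re z, Im z)"]) (auto simp: complex_eq_iff)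
    qed
  qed auto
  ultimately show ?thesis by simp
qed

lemma compact_function_box: "compact {g :: 'i \<Rightarrow> complex. \<forall>x. \<bar>Re (g x)\<bar> \<le> B \<and> \<bar>Im (g x)\<bar> \<le> B}"
proof -
  have "{g :: 'i \<Rightarrow> complex. \<forall>x. \<bar>Re (g x)\<bar> \<le> B \<and> \<bar>Im (g x)\<bar> \<le> B} =
      PiE UNIV (\<lambda>_. {z. \<bar>Re z\<bar> \<le> B \<and> \<bar>Im z\<bar> \<le> B})"
    by (auto simp: PiE_def Pi_def)
  moreover have "compactin (product_topology (\<lambda>_. euclidean) UNIV)
      (PiE UNIV (\<lambda>_ :: 'i. {z. \<bar>Re z\<bar> \<le> B \<and> \<bar>Im z\<bar> \<le> B}))"
    by (subst compactin_PiE) (simp add: compactin_euclidean_iff compact_complex_square)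
  ultimately show ?thesis by (simp add: euclidean_product_topology compactin_euclidean_iff)
qed

text \<open>With the number of terms fixed to \<open>D\<close>, the product decompositions whose vectors lie in a box
  form a compact set, and so do the matrices that they represent. Near a given \<open>h\<close> the trace is
  bounded by some \<open>c\<close>, and the separable matrices of trace at most \<open>c\<close> belong to one such compact
  set \<open>C\<close>, which consists of separable matrices. Hence the complement is open.\<close>

lemma closed_separable: "closed {h. mat (m * n) (m * n) h \<in> separable m n}"
proof -
  define K where "K = m * n"
  define D where "D = 2 * (K * K)"
  define S where "S = {h. mat K K h \<in> separable m n}"
  \<comment> \<open>\<open>R\<close> erases the values outside the matrix, on which separability says nothing; \<open>G\<close> maps the
    vectors of a decomposition, with \<open>True\<close> marking the first factors, to the represented matrix.\<close>
  define R :: "(nat \<times> nat \<Rightarrow> complex) \<Rightarrow> nat \<times> nat \<Rightarrow> complex"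
    where "R = (\<lambda>h (r, s). if r < K \<and> s < K then h (r, s) else 0)"
  define G :: "(nat \<times> bool \<times> nat \<Rightarrow> complex) \<Rightarrow> nat \<times> nat \<Rightarrow> complex"
    where "G = (\<lambda>g. R (\<lambda>(r, s). \<Sum>l<D. (g (l, True, r div n) * cnj (g (l, True, s div n))) *
      (g (l, False, r mod n) * cnj (g (l, False, s mod n)))))"
  have contR: "continuous_on UNIV R"
  proof (rule continuous_on_coordinatewise_then_product)
    fix p :: "nat \<times> nat"
    show "continuous_on UNIV (\<lambda>g. R g p)"
      by (cases p; cases "fst p < K \<and> snd p < K") (auto simp: R_def)
  qed
  have contG: "continuous_on UNIV G"
  proof (rule continuous_on_coordinatewise_then_product)
    fix p :: "nat \<times> nat"
    obtain r s where p: "p = (r, s)" by (cases p)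
    have "continuous_on UNIV (\<lambda>g :: nat \<times> bool \<times> nat \<Rightarrow> complex. \<Sum>l<D. (g (l, True, r div n) * cnj (g (l,
      True, s div n))) *
      (g (l, False, r mod n) * cnj (g (l, False, s mod n))))"
      by (intro continuous_intros continuous_on_product_coordinates)
    then show "continuous_on UNIV (\<lambda>g. G g p)"
      by (cases "r < K \<and> s < K") (auto simp: p G_def R_def)
  qed
  have G_sep: "h \<in> S" if "R h = G g" for h g
  proof -
    have e: "h (r, s) = (\<Sum>l<D. (g (l, True, r div n) * cnj (g (l, True, s div n))) *
      (g (l, False, r mod n) * cnj (g (l, False, s mod n))))" if "r < K" "s < K" for r s
      using fun_cong[OF \<open>R h = G g\<close>, of "(r, s)"] that by (simp add: R_def G_def)
    have "mat K K h \<in> separable m n"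
    proof (rule separableI[where L="{..<D}" and a="\<lambda>l i. g (l, True, i)" and b="\<lambda>l i. g (l, False, i)"])
      fix i j p q assume ij: "i < m" "j < m" "p < n" "q < n"
      have "i * n + p < K" "j * n + q < K" using pair_index_less ij by (auto simp: K_def)
      then show "mat K K h $$ (i * n + p, j * n + q) = (\<Sum>l<D. (g (l, True, i) * cnj (g (l, True, j))) *
          (g (l, False, p) * cnj (g (l, False, q))))"
        using ij by (simp add: e)
    qed (auto simp: K_def)
    then show ?thesis by (simp add: S_def)
  qed
  have sep_G: "\<exists>g. (\<forall>x. \<bar>Re (g x)\<bar> \<le> 1 + c \<and> \<bar>Im (g x)\<bar> \<le> 1 + c) \<and> R h = G g"
    if h: "h \<in> S" and c: "Re (\<Sum>r<K. h (r, r)) \<le> c" "0 \<le> c" for h c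
  proof -
    have "Re (\<Sum>r<m * n. mat K K h $$ (r, r)) \<le> c" using c by (simp add: K_def)
    with h obtain a b where ab: "\<And>l i. cmod (a l i) \<le> 1" "\<And>l p. cmod (b l p) \<le> 1 + c"
      "\<And>i j p q. i < m \<Longrightarrow> j < m \<Longrightarrow> p < n \<Longrightarrow> q < n \<Longrightarrow> mat K K h $$ (i * n + p, j * n + q) =
      (\<Sum>l<D. (a l i * cnj (a l j)) * (b l p * cnj (b l q)))"
      using separable_bounded_terms[of "mat K K h" m n c] unfolding S_def D_def K_def by blast
    define g where "g = (\<lambda>(l, x, i). if x then a l i else b l i)"
    have "cmod (g x) \<le> 1 + c" for x
      using ab(1,2) c(2) by (auto simp: g_def split: prod.splits intro: order_trans[of _ 1])
    then have "\<bar>Re (g x)\<bar> \<le> 1 + c \<and> \<bar>Im (g x)\<bar> \<le> 1 + c" for x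
      using abs_Re_le_cmod abs_Im_le_cmod order_trans by blast
    moreover have "R h = G g"
    proof
      fix x :: "nat \<times> nat"
      obtain r s where x: "x = (r, s)" by (cases x)
      show "R h x = G g x"
      proof (cases "r < K \<and> s < K")
        case True
        then have "r < m * n" "s < m * n" by (auto simp: K_def)
        from this(1) obtain i p where i: "r = i * n + p" "i < m" "p < n" by (rule pair_index_cases)
        from \<open>s < m * n\<close> obtain j q where j: "s = j * n + q" "j < m" "q < n" by (rule pair_index_cases)
        have "h (r, s) = (\<Sum>l<D. (a l i * cnj (a l j)) * (b l p * cnj (b l q)))"
          using ab(3)[of i j p q] i j True by simp
        with True show ?thesis using i j by (simp add: x R_def G_def g_def)
      next
        case False
        then show ?thesis by (auto simp: x R_def G_def)
      qed
    qed
    ultimately show ?thesis by blast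
  qed
  have "open (- S)"
  proof (subst open_subopen, intro ballI)
    fix h assume h: "h \<in> - S"
    define c where "c = \<bar>Re (\<Sum>r<K. h (r, r))\<bar> + 1"
    define C where "C = G ` {g. \<forall>x. \<bar>Re (g x)\<bar> \<le> 1 + c \<and> \<bar>Im (g x)\<bar> \<le> 1 + c}"
    have "compact C" unfolding C_def
      using contG by (intro compact_continuous_image compact_function_box) (auto intro: continuous_on_subset)
    then have "closed C" by (rule compact_imp_closed)
    then have "open (R -` (- C))" using contR by (intro open_vimage) auto
    moreover have "open {h. Re (\<Sum>r<K. h (r, r)) < c}"
      by (intro open_Collect_less continuous_intros continuous_on_product_coordinates)
    ultimately have "open ({h. Re (\<Sum>r<K. h (r, r)) < c} \<inter> R -` (- C))" by (rule open_Int[rotated])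
    moreover have "h \<in> {h. Re (\<Sum>r<K. h (r, r)) < c} \<inter> R -` (- C)"
      using h G_sep by (auto simp: C_def c_def)
    moreover have "{h. Re (\<Sum>r<K. h (r, r)) < c} \<inter> R -` (- C) \<subseteq> - S"
    proof
      fix h' assume h': "h' \<in> {h. Re (\<Sum>r<K. h (r, r)) < c} \<inter> R -` (- C)"
      show "h' \<in> - S"
      proof
        assume "h' \<in> S"
        from sep_G[OF this, of c] h' have "R h' \<in> C" unfolding C_def c_def by auto
        with h' show False by simp
      qed
    qed
    ultimately show "\<exists>T. open T \<and> h \<in> T \<and> T \<subseteq> - S" by blast
  qed
  then show ?thesis by (simp add: closed_def S_def K_def)
qed

lemma closedin_EBk_cone: "closedin (lin_maps_topology d) (EBk_cone k d)"
proof -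
  have "EBk_cone k d = Pn_cone k d \<inter>
      {\<Phi> \<in> lin_maps d. \<forall>X\<in>psd (k * d). id_tensor k d \<Phi> X \<in> separable k d}"
    by (auto simp: EBk_cone_def Pn_cone_def)
  then show ?thesis
    by (simp only:) (intro closedin_Int closedin_Pn_cone closedin_lin_maps_all closedin_id_tensor
      closed_separable)
qed

lemma mapping_cone_EBk:
  assumes "k \<ge> 1" "EBk_cone k d \<noteq> {}"
  shows "mapping_cone d (EBk_cone k d)"
proof -
  have "EBk_cone k d \<subseteq> P_cone d" using Pn_cone_subset_P_cone[OF assms(1)] by (auto simp: EBk_cone_def)
  then show ?thesis unfolding mapping_cone_def closed_convex_cone_def
    using assms closedin_EBk_cone EBk_cone_add EBk_cone_scale EBk_cone_comp by auto
qed

lemma mapping_cone_EBCPk: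
  assumes "k \<ge> 1" "EBCPk_cone k d \<noteq> {}"
  shows "mapping_cone d (EBCPk_cone k d)"
proof -
  have "EBCPk_cone k d \<subseteq> P_cone d"
    using Pn_cone_subset_P_cone[OF assms(1)] by (auto simp: EBCPk_cone_def EBk_cone_def)
  moreover have "closedin (lin_maps_topology d) (EBCPk_cone k d)"
    unfolding EBCPk_cone_def by (intro closedin_Int closedin_EBk_cone closedin_CP_cone)
  ultimately show ?thesis unfolding mapping_cone_def closed_convex_cone_def
    using assms EBk_cone_add EBk_cone_scale EBk_cone_comp CP_cone_add CP_cone_scale CP_cone_comp
    by (auto simp: EBCPk_cone_def)
qed

section \<open>The map \<open>X \<mapsto> k Tr(X) 1 - X\<^sup>T\<close> is completely positive and \<open>k\<close>-entanglement breaking\<close>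

lemma separable_conic_sum:
  assumes X: "X \<in> carrier_mat (m * n) (m * n)" and I: "finite I"
    and c: "\<And>x. x \<in> I \<Longrightarrow> 0 \<le> c x"
    and A: "\<And>x. x \<in> I \<Longrightarrow> A x \<in> psd m" and B: "\<And>x. x \<in> I \<Longrightarrow> B x \<in> psd n"
    and e: "\<And>i j p q. i < m \<Longrightarrow> j < m \<Longrightarrow> p < n \<Longrightarrow> q < n \<Longrightarrow> X $$ (i * n + p, j * n + q) =
      (\<Sum>x\<in>I. complex_of_real (c x) * (A x $$ (i, j) * B x $$ (p, q)))"
  shows "X \<in> separable m n"
proof (rule separable_sum[OF X I])
  fix x assume x: "x \<in> I"
  obtain N V where V: "\<And>i j. i < m \<Longrightarrow> j < m \<Longrightarrow> A x $$ (i, j) = (\<Sum>l<N::nat. V l i * cnj (V l j))"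
    using psd_decompose[OF A[OF x]] by blast
  obtain M W where W: "\<And>i j. i < n \<Longrightarrow> j < n \<Longrightarrow> B x $$ (i, j) = (\<Sum>l<M::nat. W l i * cnj (W l j))"
    using psd_decompose[OF B[OF x]] by blast
  have dim: "A x \<in> carrier_mat m m" "B x \<in> carrier_mat n n" using A[OF x] B[OF x] by (auto simp: psd_def)
  have kr: "kron (A x) (B x) \<in> separable m n"
  proof (rule separableI[where L="{..<N} \<times> {..<M}" and a="\<lambda>(s, t). V s" and b="\<lambda>(s, t). W t"])
    fix i j p q assume ij: "i < m" "j < m" "p < n" "q < n"
    have "kron (A x) (B x) $$ (i * n + p, j * n + q) = A x $$ (i, j) * B x $$ (p, q)"
      using pair_index_less[OF ij(1,3)] pair_index_less[OF ij(2,4)] ij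
        carrier_matD[OF dim(1)] carrier_matD[OF dim(2)] by (simp add: kron_def)
    also have "\<dots> = (\<Sum>l\<in>{..<N} \<times> {..<M}.
       ((case l of (s, t) \<Rightarrow> V s) i * cnj ((case l of (s, t) \<Rightarrow> V s) j)) *
       ((case l of (s, t) \<Rightarrow> W t) p * cnj ((case l of (s, t) \<Rightarrow> W t) q)))"
      using ij by (simp add: V W sum_product sum.cartesian_product case_prod_beta)
    finally show "kron (A x) (B x) $$ (i * n + p, j * n + q) = \<dots>" .
  qed (use dim in \<open>auto simp: kron_def\<close>)
  show "complex_of_real (c x) \<cdot>\<^sub>m kron (A x) (B x) \<in> separable m n"
    by (rule separable_scale[OF kr c[OF x]])
next
  fix i j p q assume ij: "i < m" "j < m" "p < n" "q < n"
  have "(complex_of_real (c x) \<cdot>\<^sub>m kron (A x) (B x)) $$ (i * n + p, j * n + q) =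
      complex_of_real (c x) * (A x $$ (i, j) * B x $$ (p, q))" if x: "x \<in> I" for x
  proof -
    have dim: "A x \<in> carrier_mat m m" "B x \<in> carrier_mat n n" using A[OF x] B[OF x] by (auto simp: psd_def)
    show ?thesis
      using pair_index_less[OF ij(1,3)] pair_index_less[OF ij(2,4)] ij
        carrier_matD[OF dim(1)] carrier_matD[OF dim(2)] by (simp add: kron_def)
  qed
  then show "X $$ (i * n + p, j * n + q) =
      (\<Sum>x\<in>I. (complex_of_real (c x) \<cdot>\<^sub>m kron (A x) (B x)) $$ (i * n + p, j * n + q))"
    by (simp add: e[OF ij])
qed

definition orthonormal :: "nat \<Rightarrow> nat \<Rightarrow> (nat \<Rightarrow> nat \<Rightarrow> complex) \<Rightarrow> bool" where
  "orthonormal d r f \<longleftrightarrow> (\<forall>a<r. \<forall>b<r. (\<Sum>p<d. cnj (f a p) * f b p) = (if a = b then 1 else 0))"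

text \<open>The bound \<open>r \<le> k\<close> is the Schmidt rank bound for a vector of \<open>\<complex>\<^sup>k \<otimes> \<complex>\<^sup>d\<close> whose components are
  the \<open>m i\<close>; it is where the number \<open>k\<close> enters the proof that the map is \<open>k\<close>-entanglement
  breaking.\<close>

lemma gram_schmidt_expansion:
  fixes m :: "nat \<Rightarrow> nat \<Rightarrow> complex"
  shows "\<exists>r f A. r \<le> k \<and> orthonormal d r f \<and>
    (\<forall>i<k. \<forall>p<d. m i p = (\<Sum>a<r. A i a * f a p))"
proof (induction k)
  case 0
  have "orthonormal d 0 f" for f by (simp add: orthonormal_def)
  then show ?case by blast
next
  case (Suc k)
  then obtain r f A where r: "r \<le> k" and on: "orthonormal d r f"
    and m: "\<forall>i<k. \<forall>p<d. m i p = (\<Sum>a<r. A i a * f a p)" by blast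
  define c where "c = (\<lambda>a. \<Sum>p<d. cnj (f a p) * m k p)"
  define w where "w = (\<lambda>p. m k p - (\<Sum>a<r. c a * f a p))"
  define s where "s = (\<Sum>p<d. (cmod (w p))\<^sup>2)"
  show ?case
  proof (cases "s = 0")
    case True
    then have "w p = 0" if "p < d" for p
      using that by (simp add: s_def sum_nonneg_eq_0_iff)
    then have "m i p = (\<Sum>a<r. (if i = k then c a else A i a) * f a p)" if "i < Suc k" "p < d" for i p
      using that m by (auto simp: w_def less_Suc_eq)
    then show ?thesis using r on
      by (intro exI[of _ r] exI[of _ f] exI[of _ "\<lambda>i a. if i = k then c a else A i a"]) auto
  next
    case False
    then have s: "s > 0" using sum_nonneg[of "{..<d}" "\<lambda>p. (cmod (w p))\<^sup>2"] unfolding s_def by simp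
    have sq: "complex_of_real (sqrt s) * complex_of_real (sqrt s) = of_real s"
      using s by (simp flip: of_real_mult)
    have orth: "(\<Sum>p<d. cnj (f b p) * w p) = 0" if b: "b < r" for b
    proof -
      have "(\<Sum>p<d. cnj (f b p) * w p) = c b - (\<Sum>p<d. \<Sum>a<r. c a * (cnj (f b p) * f a p))"
        by (simp add: w_def c_def right_diff_distrib sum_subtractf sum_distrib_left mult_ac)
      also have "(\<Sum>p<d. \<Sum>a<r. c a * (cnj (f b p) * f a p)) = (\<Sum>a<r. c a * (\<Sum>p<d. cnj (f b p) * f a p))"
        by (subst sum.swap) (simp add: sum_distrib_left)
      also have "\<dots> = (\<Sum>a<r. if a = b then c a else 0)"
        using on b by (intro sum.cong) (auto simp: orthonormal_def)
      also have "\<dots> = c b" using b by simp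
      finally show ?thesis by simp
    qed
    have orth': "(\<Sum>p<d. cnj (w p) * f b p) = 0" if "b < r" for b
    proof -
      have "(\<Sum>p<d. cnj (w p) * f b p) = cnj (\<Sum>p<d. cnj (f b p) * w p)" by (simp add: mult.commute)
      then show ?thesis using orth[OF that] by simp
    qed
    have ww: "(\<Sum>p<d. cnj (w p) * w p) = of_real s"
      by (simp only: s_def of_real_sum complex_norm_square mult.commute)
    define f' where "f' = (\<lambda>a. if a = r then (\<lambda>p. w p / of_real (sqrt s)) else f a)"
    define A' where "A' = (\<lambda>i a. if i = k then (if a = r then of_real (sqrt s) else c a)
      else if a = r then 0 else A i a)"
    have ip: "(\<Sum>p<d. cnj (f' a p) * f' b p) = (if a = b then 1 else 0)" if ab: "a < Suc r" "b < Suc r" for a b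
    proof -
      consider "a < r" "b < r" | "a = r" "b < r" | "a < r" "b = r" | "a = r" "b = r"
        using ab by (auto simp: less_Suc_eq)
      then show ?thesis
      proof cases
        case 1
        then show ?thesis using on by (simp add: f'_def orthonormal_def)
      next
        case 2
        then have "(\<Sum>p<d. cnj (f' a p) * f' b p) = (\<Sum>p<d. cnj (w p) * f b p) / of_real (sqrt s)"
          by (simp add: f'_def sum_divide_distrib)
        with 2 orth' show ?thesis by simp
      next
        case 3
        then have "(\<Sum>p<d. cnj (f' a p) * f' b p) = (\<Sum>p<d. cnj (f a p) * w p) / of_real (sqrt s)"
          by (simp add: f'_def sum_divide_distrib)
        with 3 orth show ?thesis by simp
      next
        case 4
        then have "(\<Sum>p<d. cnj (f' a p) * f' b p) =
            (\<Sum>p<d. cnj (w p) * w p) / (of_real (sqrt s) * of_real (sqrt s))"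
          by (simp add: f'_def sum_divide_distrib)
        also have "\<dots> = 1" using s unfolding ww sq by simp
        finally show ?thesis using 4 by simp
      qed
    qed
    have "m i p = (\<Sum>a<Suc r. A' i a * f' a p)" if ip: "i < Suc k" "p < d" for i p
    proof -
      have "(\<Sum>a<r. A' i a * f' a p) = (\<Sum>a<r. (if i = k then c a else A i a) * f a p)"
        by (intro sum.cong) (auto simp: A'_def f'_def)
      moreover have "A' i r * f' r p = (if i = k then w p else 0)"
        using s by (simp add: A'_def f'_def)
      ultimately show ?thesis using ip m by (auto simp: w_def less_Suc_eq)
    qed
    then show ?thesis using r ip
      by (intro exI[of _ "Suc r"] exI[of _ f'] exI[of _ A']) (auto simp: orthonormal_def)
  qed
qed

lemma orthonormal_cnj:
  assumes "orthonormal d r f"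
  shows "orthonormal d r (\<lambda>a p. cnj (f a p))"
proof -
  have "(\<Sum>p<d. cnj (cnj (f a p)) * cnj (f b p)) = (if a = b then 1 else 0)"
    if "a < r" "b < r" for a b
  proof -
    have "(\<Sum>p<d. cnj (cnj (f a p)) * cnj (f b p)) = cnj (\<Sum>p<d. cnj (f a p) * f b p)" by simp
    also have "(\<Sum>p<d. cnj (f a p) * f b p) = (if a = b then 1 else 0)"
      using assms that by (simp only: orthonormal_def)
    finally show ?thesis by simp
  qed
  then show ?thesis unfolding orthonormal_def by blast
qed

text \<open>The squared distance of \<open>v\<close> to its orthogonal projection \<open>w\<close> is the difference of the two
  sides.\<close>

lemma bessel_inequality:
  assumes on: "orthonormal d r f"
  shows "(\<Sum>a<r. (cmod (\<Sum>p<d. cnj (f a p) * v p))\<^sup>2) \<le> (\<Sum>p<d. (cmod (v p))\<^sup>2)"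
proof -
  define c where "c = (\<lambda>a. \<Sum>p<d. cnj (f a p) * v p)"
  define w where "w = (\<lambda>p. \<Sum>a<r. c a * f a p)"
  have vw: "(\<Sum>p<d. cnj (w p) * v p) = (\<Sum>a<r. cnj (c a) * c a)"
  proof -
    have "(\<Sum>p<d. cnj (w p) * v p) = (\<Sum>p<d. \<Sum>a<r. cnj (c a) * (cnj (f a p) * v p))"
      unfolding w_def cnj_sum sum_distrib_right by (intro sum.cong refl) (simp add: mult_ac)
    also have "\<dots> = (\<Sum>a<r. cnj (c a) * (\<Sum>p<d. cnj (f a p) * v p))"
      by (subst sum.swap) (simp add: sum_distrib_left)
    finally show ?thesis by (simp add: c_def)
  qed
  have ww: "(\<Sum>p<d. cnj (w p) * w p) = (\<Sum>a<r. cnj (c a) * c a)"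
  proof -
    have "(\<Sum>p<d. cnj (w p) * w p) = (\<Sum>p<d. \<Sum>a<r. \<Sum>b<r. cnj (c a) * c b * (cnj (f a p) * f b p))"
      unfolding w_def cnj_sum sum_product by (intro sum.cong refl) (simp add: mult_ac)
    also have "\<dots> = (\<Sum>a<r. \<Sum>p<d. \<Sum>b<r. cnj (c a) * c b * (cnj (f a p) * f b p))"
      by (rule sum.swap)
    also have "\<dots> = (\<Sum>a<r. \<Sum>b<r. \<Sum>p<d. cnj (c a) * c b * (cnj (f a p) * f b p))"
      by (intro sum.cong refl sum.swap)
    also have "\<dots> = (\<Sum>a<r. \<Sum>b<r. if b = a then cnj (c a) * c b else 0)"
      using on by (intro sum.cong refl) (auto simp: orthonormal_def simp flip: sum_distrib_left)
    also have "\<dots> = (\<Sum>a<r. cnj (c a) * c a)" by simp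
    finally show ?thesis .
  qed
  have "0 \<le> (\<Sum>p<d. (cmod (v p - w p))\<^sup>2)" by (intro sum_nonneg) auto
  also have "complex_of_real \<dots> = (\<Sum>p<d. (v p - w p) * cnj (v p - w p))"
    by (simp only: of_real_sum complex_norm_square)
  also have "\<dots> = (\<Sum>p<d. v p * cnj (v p)) - cnj (\<Sum>p<d. cnj (w p) * v p)
      - (\<Sum>p<d. cnj (w p) * v p) + (\<Sum>p<d. cnj (w p) * w p)"
    by (simp add: algebra_simps sum.distrib sum_subtractf)
  also have "\<dots> = of_real ((\<Sum>p<d. (cmod (v p))\<^sup>2) - (\<Sum>a<r. (cmod (c a))\<^sup>2))"
    unfolding vw ww by (simp only: of_real_diff of_real_sum complex_norm_square) (simp add: mult.commute)
  finally show ?thesis by (simp add: c_def less_eq_complex_def)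
qed

text \<open>The Choi matrix of this map is \<open>k 1 - F\<close> with the flip \<open>F\<close>, an unnormalised Werner state.\<close>

definition werner_map :: "nat \<Rightarrow> nat \<Rightarrow> complex mat \<Rightarrow> complex mat" where
  "werner_map d k = (\<lambda>X\<in>carrier_mat d d. mat d d (\<lambda>(a, b).
     of_nat k * (if a = b then \<Sum>c<d. X $$ (c, c) else 0) - X $$ (b, a)))"

lemma werner_map_lin_maps: "werner_map d k \<in> lin_maps d"
proof -
  define F where "F = (\<lambda>X :: complex mat. mat d d (\<lambda>(a, b).
    of_nat k * (if a = b then \<Sum>c<d. X $$ (c, c) else 0) - X $$ (b, a)))"
  have "(\<lambda>X\<in>carrier_mat d d. F X) \<in> lin_maps d"
  proof (rule lin_mapsI_index)
    fix X Y :: "complex mat" and a b z assume X: "X \<in> carrier_mat d d" and ab: "a < d" "b < d"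
    then show "F (z \<cdot>\<^sub>m X) $$ (a, b) = z * F X $$ (a, b)"
      by (simp add: F_def algebra_simps sum_distrib_left)
    assume "Y \<in> carrier_mat d d"
    then show "F (X + Y) $$ (a, b) = F X $$ (a, b) + F Y $$ (a, b)"
      using X ab by (simp add: F_def algebra_simps sum.distrib)
  qed (simp add: F_def)
  then show ?thesis by (simp only: werner_map_def F_def)
qed

lemma id_tensor_werner_map:
  assumes V: "\<And>r s. r < n * d \<Longrightarrow> s < n * d \<Longrightarrow> X $$ (r, s) = (\<Sum>l<N. V l r * cnj (V l s))"
    and ij: "i < n" "j < n" "a < d" "b < d"
  shows "id_tensor n d (werner_map d k) X $$ (i * d + a, j * d + b) =
    (\<Sum>l<N. of_nat k * (if a = b then \<Sum>c<d. V l (i * d + c) * cnj (V l (j * d + c)) else 0)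
       - V l (i * d + b) * cnj (V l (j * d + a)))"
proof -
  have X: "X $$ (i * d + a, j * d + b) = (\<Sum>l<N. V l (i * d + a) * cnj (V l (j * d + b)))"
    if "a < d" "b < d" for a b
    using V pair_index_less ij(1,2) that by blast
  have "id_tensor n d (werner_map d k) X $$ (i * d + a, j * d + b) =
      of_nat k * (if a = b then \<Sum>c<d. X $$ (i * d + c, j * d + c) else 0) - X $$ (i * d + b, j * d + a)"
    using ij by (simp add: id_tensor_index werner_map_def block_index)
  also have "(\<Sum>c<d. X $$ (i * d + c, j * d + c)) =
      (\<Sum>l<N. \<Sum>c<d. V l (i * d + c) * cnj (V l (j * d + c)))"
    by (subst sum.swap) (intro sum.cong refl, simp add: X)
  finally show ?thesis using ij by (simp add: X sum_subtractf sum_distrib_left)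
qed

text \<open>For a vector \<open>V\<close> the quadratic form of \<open>(id \<otimes> \<Phi>)(V V\<^sup>*)\<close> is \<open>k \<Sum> \<bar>u a b\<bar>\<^sup>2 - \<Sum> u a b cnj (u
  b a)\<close> for the contraction \<open>u\<close> of \<open>V\<close> with the test vector. This equals \<open>(k - 1) \<Sum> \<bar>u a b\<bar>\<^sup>2 +
  1/2 \<Sum> \<bar>u a b - u b a\<bar>\<^sup>2\<close>.\<close>

lemma werner_map_CP:
  assumes "k \<ge> 1"
  shows "werner_map d k \<in> CP_cone d"
proof -
  have "id_tensor n d (werner_map d k) X \<in> psd (n * d)" if X: "X \<in> psd (n * d)" for n X
  proof -
    obtain N V where V: "\<And>r s. r < n * d \<Longrightarrow> s < n * d \<Longrightarrow> X $$ (r, s) = (\<Sum>l<N::nat. V l r * cnj (V l s))"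
      using psd_decompose[OF X] by blast
    define F where "F = (\<lambda>l r s. of_nat k * (if r mod d = s mod d then
        \<Sum>c<d. V l (r div d * d + c) * cnj (V l (s div d * d + c)) else 0)
       - V l (r div d * d + s mod d) * cnj (V l (s div d * d + r mod d)))"
    have "0 \<le> qform (n * d) (F l) v" for l v
    proof -
      define u where "u = (\<lambda>a b. \<Sum>i<n. cnj (v (i * d + a)) * V l (i * d + b))"
      have "qform (n * d) (F l) v = (\<Sum>i<n. \<Sum>a<d. \<Sum>j<n. \<Sum>b<d.
          cnj (v (i * d + a)) * (of_nat k * (if a = b then
        \<Sum>c<d. V l (i * d + c) * cnj (V l (j * d + c)) else 0)
       - V l (i * d + b) * cnj (V l (j * d + a))) * v (j * d + b))"
        unfolding qform_pair F_def by (intro sum.cong refl) simp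
      also have "\<dots> = of_nat k * (\<Sum>i<n. \<Sum>a<d. \<Sum>j<n. \<Sum>c<d.
            cnj (v (i * d + a)) * V l (i * d + c) * (cnj (V l (j * d + c)) * v (j * d + a)))
          - (\<Sum>i<n. \<Sum>a<d. \<Sum>j<n. \<Sum>b<d. cnj (v (i * d + a)) * V l (i * d + b) *
             (cnj (V l (j * d + a)) * v (j * d + b)))"
      proof -
        have "(\<Sum>b<d. cnj (v (i * d + a)) * (of_nat k * (if a = b then
              \<Sum>c<d. V l (i * d + c) * cnj (V l (j * d + c)) else 0)
             - V l (i * d + b) * cnj (V l (j * d + a))) * v (j * d + b)) =
           of_nat k * (\<Sum>c<d. cnj (v (i * d + a)) * V l (i * d + c) * (cnj (V l (j * d + c)) * v (j * d + a)))
           - (\<Sum>b<d. cnj (v (i * d + a)) * V l (i * d + b) * (cnj (V l (j * d + a)) * v (j * d + b)))"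
          if "a < d" for i j a
        proof -
          have "(\<Sum>b<d. cnj (v (i * d + a)) * (of_nat k * (if a = b then
              \<Sum>c<d. V l (i * d + c) * cnj (V l (j * d + c)) else 0)
             - V l (i * d + b) * cnj (V l (j * d + a))) * v (j * d + b)) =
             (\<Sum>b<d. (if b = a then of_nat k * (cnj (v (i * d + a)) * (\<Sum>c<d. V l (i * d + c) * cnj (V l
               (j * d + c))) * v (j * d + b)) else 0)
             - cnj (v (i * d + a)) * V l (i * d + b) * (cnj (V l (j * d + a)) * v (j * d + b)))"
            by (intro sum.cong refl) (auto simp: algebra_simps)
          also have "\<dots> = of_nat k * (cnj (v (i * d + a)) * (\<Sum>c<d. V l (i * d + c) * cnj (V l (j * d +
            c))) * v (j * d + a))
             - (\<Sum>b<d. cnj (v (i * d + a)) * V l (i * d + b) * (cnj (V l (j * d + a)) * v (j * d + b)))"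
            using that by (simp add: sum_subtractf)
          finally show ?thesis by (simp add: sum_distrib_left sum_distrib_right mult_ac)
        qed
        then show ?thesis by (simp add: sum_subtractf sum_distrib_left)
      qed
      also have "(\<Sum>i<n. \<Sum>a<d. \<Sum>j<n. \<Sum>c<d.
            cnj (v (i * d + a)) * V l (i * d + c) * (cnj (V l (j * d + c)) * v (j * d + a)))
          = (\<Sum>a<d. \<Sum>c<d. u a c * cnj (u a c))"
      proof -
        have "(\<Sum>a<d. \<Sum>c<d. u a c * cnj (u a c)) = (\<Sum>a<d. \<Sum>c<d. \<Sum>i<n. \<Sum>j<n.
          cnj (v (i * d + a)) * V l (i * d + c) * (cnj (V l (j * d + c)) * v (j * d + a)))"
          unfolding u_def cnj_sum sum_product by (intro sum.cong refl) (simp add: mult_ac)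
        also have "\<dots> = (\<Sum>a<d. \<Sum>i<n. \<Sum>c<d. \<Sum>j<n.
          cnj (v (i * d + a)) * V l (i * d + c) * (cnj (V l (j * d + c)) * v (j * d + a)))"
          by (intro sum.cong refl sum.swap)
        also have "\<dots> = (\<Sum>a<d. \<Sum>i<n. \<Sum>j<n. \<Sum>c<d.
          cnj (v (i * d + a)) * V l (i * d + c) * (cnj (V l (j * d + c)) * v (j * d + a)))"
          by (intro sum.cong refl sum.swap)
        finally show ?thesis by (subst (asm) sum.swap) simp
      qed
      also have "(\<Sum>i<n. \<Sum>a<d. \<Sum>j<n. \<Sum>b<d. cnj (v (i * d + a)) * V l (i * d + b) *
             (cnj (V l (j * d + a)) * v (j * d + b))) = (\<Sum>a<d. \<Sum>b<d. u a b * cnj (u b a))"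
      proof -
        have "(\<Sum>a<d. \<Sum>b<d. u a b * cnj (u b a)) = (\<Sum>a<d. \<Sum>b<d. \<Sum>i<n. \<Sum>j<n.
          cnj (v (i * d + a)) * V l (i * d + b) * (cnj (V l (j * d + a)) * v (j * d + b)))"
          unfolding u_def cnj_sum sum_product by (intro sum.cong refl) (simp add: mult_ac)
        also have "\<dots> = (\<Sum>a<d. \<Sum>i<n. \<Sum>b<d. \<Sum>j<n.
          cnj (v (i * d + a)) * V l (i * d + b) * (cnj (V l (j * d + a)) * v (j * d + b)))"
          by (intro sum.cong refl sum.swap)
        also have "\<dots> = (\<Sum>a<d. \<Sum>i<n. \<Sum>j<n. \<Sum>b<d.
          cnj (v (i * d + a)) * V l (i * d + b) * (cnj (V l (j * d + a)) * v (j * d + b)))"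
          by (intro sum.cong refl sum.swap)
        finally show ?thesis by (subst (asm) sum.swap) simp
      qed
      finally have q: "qform (n * d) (F l) v =
        of_nat k * (\<Sum>a<d. \<Sum>b<d. u a b * cnj (u a b)) - (\<Sum>a<d. \<Sum>b<d. u a b * cnj (u b a))" .
      have sw: "(\<Sum>a<d. \<Sum>b<d. u b a * cnj (u b a)) = (\<Sum>a<d. \<Sum>b<d. u a b * cnj (u a b))"
        "(\<Sum>a<d. \<Sum>b<d. u b a * cnj (u a b)) = (\<Sum>a<d. \<Sum>b<d. u a b * cnj (u b a))"
        by (subst sum.swap, rule refl)+
      have "(\<Sum>a<d. \<Sum>b<d. (u a b - u b a) * cnj (u a b - u b a)) =
          2 * (\<Sum>a<d. \<Sum>b<d. u a b * cnj (u a b)) - 2 * (\<Sum>a<d. \<Sum>b<d. u a b * cnj (u b a))"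
      proof -
        have "(\<Sum>a<d. \<Sum>b<d. (u a b - u b a) * cnj (u a b - u b a)) =
          (\<Sum>a<d. \<Sum>b<d. u a b * cnj (u a b)) + (\<Sum>a<d. \<Sum>b<d. u b a * cnj (u b a))
          - (\<Sum>a<d. \<Sum>b<d. u a b * cnj (u b a)) - (\<Sum>a<d. \<Sum>b<d. u b a * cnj (u a b))"
          by (simp add: algebra_simps sum.distrib sum_subtractf)
        then show ?thesis unfolding sw by simp
      qed
      moreover have "of_nat k * x - y = of_nat (k - 1) * x + (1 / 2) * z"
        if "z = 2 * x - 2 * y" for x y z :: complex
        unfolding that using assms by (simp add: of_nat_diff algebra_simps)
      ultimately have "qform (n * d) (F l) v = of_nat (k - 1) * (\<Sum>a<d. \<Sum>b<d. u a b * cnj (u a b))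
          + (1 / 2) * (\<Sum>a<d. \<Sum>b<d. (u a b - u b a) * cnj (u a b - u b a))"
        unfolding q by blast
      also have "\<dots> = of_real (real (k - 1) * (\<Sum>a<d. \<Sum>b<d. (cmod (u a b))\<^sup>2)
          + (1 / 2) * (\<Sum>a<d. \<Sum>b<d. (cmod (u a b - u b a))\<^sup>2))"
        by (simp only: complex_norm_square of_real_add of_real_mult of_real_sum of_real_of_nat_eq
            of_real_divide of_real_1 of_real_numeral)
      also have "0 \<le> \<dots>"
      proof -
        have "0 \<le> real (k - 1) * (\<Sum>a<d. \<Sum>b<d. (cmod (u a b))\<^sup>2)
          + (1 / 2) * (\<Sum>a<d. \<Sum>b<d. (cmod (u a b - u b a))\<^sup>2)"
          by (intro add_nonneg_nonneg mult_nonneg_nonneg sum_nonneg) auto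
        then show ?thesis by (simp add: less_eq_complex_def)
      qed
      finally show ?thesis .
    qed
    moreover have "qform (n * d) (\<lambda>r s. id_tensor n d (werner_map d k) X $$ (r, s)) v
        = (\<Sum>l<N. qform (n * d) (F l) v)" for v
    proof -
      have "qform (n * d) (\<lambda>r s. id_tensor n d (werner_map d k) X $$ (r, s)) v =
          qform (n * d) (\<lambda>r s. \<Sum>l<N. F l r s) v"
      proof (rule qform_cong)
        fix r s assume "r < n * d" "s < n * d"
        from this(1) obtain i a where r: "r = i * d + a" "i < n" "a < d" by (rule pair_index_cases)
        from \<open>s < n * d\<close> obtain j b where s: "s = j * d + b" "j < n" "b < d" by (rule pair_index_cases)
        show "id_tensor n d (werner_map d k) X $$ (r, s) = (\<Sum>l<N. F l r s)"
          using r s by (simp add: id_tensor_werner_map[OF V] F_def cong: if_cong)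
      qed simp
      then show ?thesis by (simp add: qform_sum)
    qed
    ultimately show ?thesis by (simp add: psd_iff_qform sum_nonneg)
  qed
  then show ?thesis by (simp add: CP_cone_def Pn_cone_def werner_map_lin_maps)
qed

text \<open>Averaging over the fourth roots of unity removes the terms that are of degree \<open>\<plusminus>1\<close> or \<open>\<plusminus>2\<close>
  in \<open>w\<close> and keeps those of degree \<open>0\<close>, among them the two cross terms.\<close>

lemma root_of_unity_average:
  fixes x y s t x' y' s' t' :: complex
  shows "(\<Sum>w\<in>{1, \<i>, -1, -\<i>}. ((x + w * x') * (y + cnj w * y')) * ((s - w * s') * (t - cnj w * t')))
    = 4 * ((x * y + x' * y') * (s * t + s' * t') - (x * y') * (s' * t) - (x' * y) * (s * t'))"
proof -
  have "\<i> \<noteq> 1" "\<i> \<noteq> -1" "\<i> \<noteq> - \<i>" "- \<i> \<noteq> 1" "-1 \<noteq> - \<i>" "(1::complex) \<noteq> - 1"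
    by (auto simp: complex_eq_iff)
  then show ?thesis by (simp add: algebra_simps)
qed

text \<open>Expand the components as \<open>\<psi>\<^sub>i = \<Sum>\<^sub>a A\<^sub>i\<^sub>a f\<^sub>a\<close> in \<open>r \<le> k\<close> orthonormal vectors, let \<open>A\<^sub>a\<close> be
  the columns of \<open>A\<close> and \<open>g\<^sub>a = cnj f\<^sub>a\<close>. With \<open>\<alpha>\<^sub>a = A\<^sub>a A\<^sub>a\<^sup>*\<close> and \<open>\<gamma>\<^sub>a = g\<^sub>a g\<^sub>a\<^sup>*\<close>, the matrix
  is \<open>k (\<Sum>\<^sub>a \<alpha>\<^sub>a) \<otimes> 1 - \<Sum>\<^sub>a\<^sub>b A\<^sub>a A\<^sub>b\<^sup>* \<otimes> g\<^sub>b g\<^sub>a\<^sup>*\<close>. The cross terms with \<open>a \<noteq> b\<close> come with the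
  right sign from the average over \<open>w\<close> of the matrices \<open>v v\<^sup>*\<close> for \<open>v = (A\<^sub>a + w A\<^sub>b) \<otimes> (g\<^sub>a - w
  g\<^sub>b)\<close>; each unordered pair occurs twice, whence the weight \<open>1/8\<close>. What remains is \<open>\<Sum>\<^sub>a \<alpha>\<^sub>a \<otimes> (k
  1 - \<Sum>\<^sub>b \<gamma>\<^sub>b - (r - 1) \<gamma>\<^sub>a)\<close>, and the second factor is positive by Bessel's inequality, as \<open>r \<le>
  k\<close>.\<close>

lemma separable_werner_rank_one:
  fixes \<psi> :: "nat \<Rightarrow> nat \<Rightarrow> complex"
  assumes X: "X \<in> carrier_mat (k * d) (k * d)"
    and e: "\<And>i j p q. i < k \<Longrightarrow> j < k \<Longrightarrow> p < d \<Longrightarrow> q < d \<Longrightarrow> X $$ (i * d + p, j * d + q) =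
      of_nat k * (if p = q then \<Sum>c<d. \<psi> i c * cnj (\<psi> j c) else 0) - \<psi> i q * cnj (\<psi> j p)"
  shows "X \<in> separable k d"
proof -
  obtain r f A where r: "r \<le> k" and on: "orthonormal d r f"
    and \<psi>: "\<And>i p. i < k \<Longrightarrow> p < d \<Longrightarrow> \<psi> i p = (\<Sum>a<r. A i a * f a p)"
    using gram_schmidt_expansion[of k d \<psi>] by blast
  define g where "g = (\<lambda>a p. cnj (f a p))"
  have og: "orthonormal d r g" unfolding g_def using on by (rule orthonormal_cnj)
  define Z where "Z = (\<lambda>u n. mat n n (\<lambda>(i, j). u i * cnj (u j)))"
  have Z: "Z u n \<in> psd n" for u :: "nat \<Rightarrow> complex" and n
    by (rule psdI_rank_ones[where L="{()}" and V="\<lambda>_. u"]) (auto simp: Z_def)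
  define R where "R = (\<lambda>a. mat d d (\<lambda>(p, q). of_nat k * (if p = q then 1 else 0)
    - (\<Sum>b<r. g b p * cnj (g b q)) - of_nat (r - 1) * (g a p * cnj (g a q))))"
  have R: "R a \<in> psd d" if a: "a < r" for a
  proof -
    have "0 \<le> qform d (\<lambda>p q. R a $$ (p, q)) v" for v
    proof -
      define c where "c = (\<lambda>b. (cmod (\<Sum>p<d. cnj (g b p) * v p))\<^sup>2)"
      define s where "s = (\<Sum>p<d. (cmod (v p))\<^sup>2)"
      have bes: "(\<Sum>b<r. c b) \<le> s" unfolding c_def s_def using og by (rule bessel_inequality)
      have "c a \<le> (\<Sum>b<r. c b)" using a by (intro member_le_sum) (auto simp: c_def)
      then have ca: "c a \<le> s" using bes by simp
      have "qform d (\<lambda>p q. R a $$ (p, q)) v = qform d (\<lambda>p q. of_nat k * (if p = q then 1 else 0)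
           - (\<Sum>b<r. g b p * cnj (g b q)) - of_nat (r - 1) * (g a p * cnj (g a q))) v"
        by (intro qform_cong) (auto simp: R_def)
      also have "\<dots> = of_nat k * qform d (\<lambda>p q. if p = q then 1 else 0) v
          - qform d (\<lambda>p q. \<Sum>b<r. g b p * cnj (g b q)) v - of_nat (r - 1) * qform d (\<lambda>p q. g a p * cnj (g
            a q)) v"
        by (simp add: qform_def left_diff_distrib right_diff_distrib sum_subtractf sum_distrib_left mult_ac)
      also have "qform d (\<lambda>p q. if p = q then 1 else 0) v = of_real s"
      proof -
        have "qform d (\<lambda>p q. if p = q then 1 else 0) v = (\<Sum>p<d. \<Sum>q<d. if q = p then cnj (v p) * v q else 0)"
          unfolding qform_def by (intro sum.cong refl) auto
        also have "\<dots> = (\<Sum>p<d. v p * cnj (v p))" by (simp add: mult.commute)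
        finally show ?thesis by (simp only: s_def of_real_sum complex_norm_square)
      qed
      also have "qform d (\<lambda>p q. \<Sum>b<r. g b p * cnj (g b q)) v = of_real (\<Sum>b<r. c b)"
        by (simp only: qform_sum qform_rank_one c_def of_real_sum)
      also have "qform d (\<lambda>p q. g a p * cnj (g a q)) v = of_real (c a)"
        by (simp only: qform_rank_one c_def)
      finally have q: "qform d (\<lambda>p q. R a $$ (p, q)) v =
          of_real (real k * s - (\<Sum>b<r. c b) - real (r - 1) * c a)" by simp
      have s0: "0 \<le> s" unfolding s_def by (intro sum_nonneg) auto
      have "real (r - 1) * c a \<le> real (r - 1) * s" using ca by (rule mult_left_mono) simp
      moreover have "real (r - 1) * s + s \<le> real k * s"
      proof -
        have "(real (r - 1) + 1) * s \<le> real k * s" using s0 a r by (intro mult_right_mono) auto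
        then show ?thesis by (simp add: algebra_simps)
      qed
      ultimately show ?thesis unfolding q using bes by (simp add: less_eq_complex_def)
    qed
    then show ?thesis by (simp add: psd_iff_qform R_def)
  qed
  define P where "P = {..<r} \<times> {..<r} \<times> {1, \<i>, -1, -\<i>}"
  define C where "C = (\<lambda>x :: (nat \<times> nat \<times> complex) + nat.
    case x of Inl (a, b, w) \<Rightarrow> if a = b then 0 else 1 / 8 | Inr a \<Rightarrow> (1 :: real))"
  define AA where "AA = (\<lambda>x :: (nat \<times> nat \<times> complex) + nat.
    case x of Inl (a, b, w) \<Rightarrow> Z (\<lambda>i. A i a + w * A i b) k | Inr a \<Rightarrow> Z (\<lambda>i. A i a) k)"
  define BB where "BB = (\<lambda>x :: (nat \<times> nat \<times> complex) + nat.
    case x of Inl (a, b, w) \<Rightarrow> Z (\<lambda>p. g a p - w * g b p) d | Inr a \<Rightarrow> R a)"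
  show ?thesis
  proof (rule separable_conic_sum[OF X, where I="P <+> {..<r}" and c=C and A=AA and B=BB])
    show "finite (P <+> {..<r})" by (simp add: P_def)
    show "0 \<le> C x" for x by (auto simp: C_def split: sum.splits)
    show "AA x \<in> psd k" for x by (auto simp: AA_def Z split: sum.splits)
    show "BB x \<in> psd d" if "x \<in> P <+> {..<r}" for x
      using that by (auto simp: BB_def Z R split: sum.splits)
  next
    fix i j p q assume ij: "i < k" "j < k" "p < d" "q < d"
    define \<alpha> where "\<alpha> = (\<lambda>a. A i a * cnj (A j a))"
    define \<gamma> where "\<gamma> = (\<lambda>a. g a p * cnj (g a q))"
    define \<kappa> where "\<kappa> = (\<lambda>a b. (A i a * cnj (A j b)) * (g b p * cnj (g a q)))"
    define \<delta> where "\<delta> = (if p = q then 1 else 0 :: complex)"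
    define W where "W = (\<lambda>a b. (\<alpha> a + \<alpha> b) * (\<gamma> a + \<gamma> b) - \<kappa> a b - \<kappa> b a)"
    have "(\<Sum>x\<in>P. complex_of_real (C (Inl x)) * (AA (Inl x) $$ (i, j) * BB (Inl x) $$ (p, q))) =
       (\<Sum>a<r. \<Sum>b<r. \<Sum>w\<in>{1, \<i>, -1, -\<i>}. (if a = b then 0 else 1 / 8) *
        (((A i a + w * A i b) * (cnj (A j a) + cnj w * cnj (A j b))) *
         ((g a p - w * g b p) * (cnj (g a q) - cnj w * cnj (g b q)))))"
      unfolding P_def sum.cartesian_product' using ij
      by (intro sum.cong refl) (simp add: C_def AA_def BB_def Z_def)
    also have "\<dots> = (\<Sum>a<r. \<Sum>b<r. (if a = b then 0 else 1 / 8) * (4 * W a b))"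
      by (simp only: sum_distrib_left[symmetric] root_of_unity_average W_def \<alpha>_def \<gamma>_def \<kappa>_def)
    also have "\<dots> = (\<Sum>a<r. \<Sum>b<r. W a b / 2 - (if b = a then W a b / 2 else 0))"
      by (intro sum.cong refl) auto
    also have "\<dots> = (\<Sum>a<r. \<Sum>b<r. W a b) / 2 - (\<Sum>a<r. W a a) / 2"
      by (simp add: sum_subtractf sum_divide_distrib)
    also have "(\<Sum>a<r. W a a) / 2 = (\<Sum>a<r. \<alpha> a * \<gamma> a)"
      unfolding sum_divide_distrib
      by (intro sum.cong refl) (simp add: W_def \<alpha>_def \<gamma>_def \<kappa>_def algebra_simps)
    also have "(\<Sum>a<r. \<Sum>b<r. W a b) / 2 =
        of_nat r * (\<Sum>a<r. \<alpha> a * \<gamma> a) + (\<Sum>a<r. \<alpha> a) * (\<Sum>a<r. \<gamma> a) - (\<Sum>a<r. \<Sum>b<r. \<kappa> a b)"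
    proof -
      have "(\<Sum>a<r. \<Sum>b<r. W a b) = (\<Sum>a<r. \<Sum>b<r. \<alpha> a * \<gamma> a) + (\<Sum>a<r. \<Sum>b<r. \<alpha> a * \<gamma> b)
         + (\<Sum>a<r. \<Sum>b<r. \<alpha> b * \<gamma> a) + (\<Sum>a<r. \<Sum>b<r. \<alpha> b * \<gamma> b)
         - (\<Sum>a<r. \<Sum>b<r. \<kappa> a b) - (\<Sum>a<r. \<Sum>b<r. \<kappa> b a)"
      proof -
        have "W a b = \<alpha> a * \<gamma> a + \<alpha> a * \<gamma> b + \<alpha> b * \<gamma> a + \<alpha> b * \<gamma> b - \<kappa> a b - \<kappa> b a" for a b
          by (simp add: W_def algebra_simps)
        then show ?thesis by (simp only: sum.distrib sum_subtractf)
      qed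
      moreover have "(\<Sum>a<r. \<Sum>b<r. \<kappa> b a) = (\<Sum>a<r. \<Sum>b<r. \<kappa> a b)" by (rule sum.swap)
      moreover have \<alpha>\<gamma>: "(\<Sum>a<r. \<Sum>b<r. \<alpha> a * \<gamma> b) = (\<Sum>a<r. \<alpha> a) * (\<Sum>a<r. \<gamma> a)"
        by (rule sum_product[symmetric])
      moreover have "(\<Sum>a<r. \<Sum>b<r. \<alpha> b * \<gamma> a) = (\<Sum>a<r. \<alpha> a) * (\<Sum>a<r. \<gamma> a)"
        unfolding \<alpha>\<gamma>[symmetric] by (rule sum.swap)
      moreover have "(\<Sum>a<r. \<Sum>b<r. \<alpha> a * \<gamma> a) = of_nat r * (\<Sum>a<r. \<alpha> a * \<gamma> a)"
        by (simp add: sum_distrib_left)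
      moreover have "(\<Sum>a<r. \<Sum>b<r. \<alpha> b * \<gamma> b) = of_nat r * (\<Sum>a<r. \<alpha> a * \<gamma> a)" by simp
      ultimately show ?thesis by (simp only:) simp
    qed
    finally have pairs: "(\<Sum>x\<in>P. complex_of_real (C (Inl x)) * (AA (Inl x) $$ (i, j) * BB (Inl x) $$ (p, q))) =
        of_nat r * (\<Sum>a<r. \<alpha> a * \<gamma> a) + (\<Sum>a<r. \<alpha> a) * (\<Sum>a<r. \<gamma> a)
        - (\<Sum>a<r. \<Sum>b<r. \<kappa> a b) - (\<Sum>a<r. \<alpha> a * \<gamma> a)" .
    have "(\<Sum>a<r. complex_of_real (C (Inr a)) * (AA (Inr a) $$ (i, j) * BB (Inr a) $$ (p, q))) =
        (\<Sum>a<r. \<alpha> a * (of_nat k * \<delta> - (\<Sum>b<r. \<gamma> b) - of_nat (r - 1) * \<gamma> a))"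
      using ij by (simp add: C_def AA_def BB_def Z_def R_def \<alpha>_def \<gamma>_def \<delta>_def)
    also have "\<dots> = of_nat k * \<delta> * (\<Sum>a<r. \<alpha> a) - (\<Sum>a<r. \<alpha> a) * (\<Sum>b<r. \<gamma> b)
        - of_nat (r - 1) * (\<Sum>a<r. \<alpha> a * \<gamma> a)"
    proof -
      define Q where "Q = (\<Sum>b<r. \<gamma> b)"
      show ?thesis unfolding Q_def[symmetric]
        by (simp add: right_diff_distrib sum_subtractf sum_distrib_left sum_distrib_right mult_ac)
    qed
    finally have rest: "(\<Sum>a<r. complex_of_real (C (Inr a)) * (AA (Inr a) $$ (i, j) * BB (Inr a) $$ (p,
      q))) = \<dots>" .
    have "(\<Sum>x\<in>P <+> {..<r}. complex_of_real (C x) * (AA x $$ (i, j) * BB x $$ (p, q))) =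
        (of_nat r - 1 - of_nat (r - 1)) * (\<Sum>a<r. \<alpha> a * \<gamma> a)
        + of_nat k * \<delta> * (\<Sum>a<r. \<alpha> a) - (\<Sum>a<r. \<Sum>b<r. \<kappa> a b)"
      by (subst sum.Plus) (simp_all add: P_def pairs[unfolded P_def] rest algebra_simps comp_def)
    also have "(of_nat r - 1 - of_nat (r - 1)) * (\<Sum>a<r. \<alpha> a * \<gamma> a) = 0"
      by (cases r) simp_all
    also have "(\<Sum>a<r. \<Sum>b<r. \<kappa> a b) = \<psi> i q * cnj (\<psi> j p)"
      using ij by (simp add: \<psi> \<kappa>_def g_def sum_product mult_ac)
    also have "of_nat k * \<delta> * (\<Sum>a<r. \<alpha> a) = of_nat k * (if p = q then \<Sum>c<d. \<psi> i c * cnj (\<psi> j c) else 0)"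
    proof -
      have "(\<Sum>c<d. \<psi> i c * cnj (\<psi> j c)) = (\<Sum>c<d. \<Sum>a<r. \<Sum>b<r. A i a * cnj (A j b) * (f a c * cnj (f b c)))"
        using ij by (simp add: \<psi> sum_product mult_ac)
      also have "\<dots> = (\<Sum>a<r. \<Sum>c<d. \<Sum>b<r. A i a * cnj (A j b) * (f a c * cnj (f b c)))"
        by (rule sum.swap)
      also have "\<dots> = (\<Sum>a<r. \<Sum>b<r. \<Sum>c<d. A i a * cnj (A j b) * (f a c * cnj (f b c)))"
        by (intro sum.cong refl sum.swap)
      also have "\<dots> = (\<Sum>a<r. \<Sum>b<r. A i a * cnj (A j b) * (\<Sum>c<d. cnj (g a c) * g b c))"
        by (simp add: sum_distrib_left g_def)
      also have "\<dots> = (\<Sum>a<r. \<Sum>b<r. if b = a then A i a * cnj (A j b) else 0)"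
        using og by (intro sum.cong refl) (auto simp: orthonormal_def)
      also have "\<dots> = (\<Sum>a<r. \<alpha> a)" by (simp add: \<alpha>_def)
      finally show ?thesis by (simp add: \<delta>_def)
    qed
    finally show "X $$ (i * d + p, j * d + q) =
        (\<Sum>x\<in>P <+> {..<r}. complex_of_real (C x) * (AA x $$ (i, j) * BB x $$ (p, q)))"
      using e[OF ij] by simp
  qed
qed

lemma werner_map_EBCPk:
  assumes "k \<ge> 1"
  shows "werner_map d k \<in> EBCPk_cone k d"
proof -
  have "id_tensor k d (werner_map d k) X \<in> separable k d" if X: "X \<in> psd (k * d)" for X
  proof -
    obtain N V where V: "\<And>r s. r < k * d \<Longrightarrow> s < k * d \<Longrightarrow> X $$ (r, s) = (\<Sum>l<N::nat. V l r * cnj (V l s))"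
      using psd_decompose[OF X] by blast
    define F where "F = (\<lambda>l. mat (k * d) (k * d) (\<lambda>(r, s). of_nat k * (if r mod d = s mod d then
        \<Sum>c<d. V l (r div d * d + c) * cnj (V l (s div d * d + c)) else 0)
       - V l (r div d * d + s mod d) * cnj (V l (s div d * d + r mod d))))"
    have F: "F l $$ (i * d + p, j * d + q) = of_nat k * (if p = q then
        \<Sum>c<d. V l (i * d + c) * cnj (V l (j * d + c)) else 0) - V l (i * d + q) * cnj (V l (j * d + p))"
      if "i < k" "j < k" "p < d" "q < d" for i j p q l
      using that pair_index_less[of i k p d] pair_index_less[of j k q d] by (simp add: F_def)
    show ?thesis
    proof (rule separable_sum[where I="{..<N}" and F=F])
      show "F l \<in> separable k d" for l
        by (rule separable_werner_rank_one[where \<psi>="\<lambda>i p. V l (i * d + p)"])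
          (simp add: F_def, simp add: F)
    next
      fix i j p q assume ij: "i < k" "j < k" "p < d" "q < d"
      show "id_tensor k d (werner_map d k) X $$ (i * d + p, j * d + q) =
          (\<Sum>x<N. F x $$ (i * d + p, j * d + q))"
        using ij by (simp add: F id_tensor_werner_map[OF V])
    qed auto
  qed
  moreover have "werner_map d k \<in> CP_cone d" using assms by (rule werner_map_CP)
  ultimately show ?thesis using CP_cone_subset_Pn_cone[OF assms, of d]
    by (auto simp: EBCPk_cone_def EBk_cone_def)
qed

section \<open>Kraus maps and a PPT entangled map\<close>

definition unit_mat :: "nat \<Rightarrow> nat \<Rightarrow> nat \<Rightarrow> complex mat" where
  "unit_mat d i j = mat d d (\<lambda>(a, b). if a = i \<and> b = j then 1 else 0)"

lemma unit_mat_carrier [simp]: "unit_mat d i j \<in> carrier_mat d d"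
  by (simp add: unit_mat_def)

text \<open>The matrix \<open>v v\<^sup>*\<close> for the vector \<open>v = \<Sum>\<^sub>i\<^sub><\<^sub>r e\<^sub>i \<otimes> e\<^sub>i\<close>, at which \<open>id \<otimes> \<Phi>\<close> displays the
  values of \<open>\<Phi>\<close> on the matrix units.\<close>

definition max_entangled :: "nat \<Rightarrow> nat \<Rightarrow> nat \<Rightarrow> complex mat" where
  "max_entangled r n d = mat (n * d) (n * d) (\<lambda>(x, y).
     if x div d = x mod d \<and> x div d < r \<and> y div d = y mod d \<and> y div d < r then 1 else 0)"

lemma max_entangled_psd: "max_entangled r n d \<in> psd (n * d)"
  by (rule psdI_rank_ones[where L="{()}" and V="\<lambda>_ x. if x div d = x mod d \<and> x div d < r then 1 else 0"])
     (auto simp: max_entangled_def)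

lemma block_max_entangled:
  assumes "i < n" "j < n" "i < r" "j < r"
  shows "block d (max_entangled r n d) i j = unit_mat d i j"
  using assms by (intro eq_matI) (auto simp: block_def unit_mat_def max_entangled_def pair_index_less)

lemma id_tensor_max_entangled:
  assumes "i < n" "j < n" "i < r" "j < r" "p < d" "q < d"
  shows "id_tensor n d \<Phi> (max_entangled r n d) $$ (i * d + p, j * d + q) = \<Phi> (unit_mat d i j) $$ (p, q)"
  using assms by (simp add: id_tensor_index block_max_entangled)

lemma kraus_index:
  assumes V: "V \<in> carrier_mat d d" and X: "X \<in> carrier_mat d d" and ab: "a < d" "b < d"
  shows "(mat_adjoint V * X * V) $$ (a, b) = (\<Sum>c<d. \<Sum>e<d. cnj (V $$ (c, a)) * X $$ (c, e) * V $$ (e, b))"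
proof -
  have adj: "mat_adjoint V = mat d d (\<lambda>(i, j). cnj (V $$ (j, i)))"
    using V unfolding mat_adjoint_def by (intro eq_matI) (auto simp: mat_of_rows_index)
  have "(mat_adjoint V * X * V) $$ (a, b) = (\<Sum>e<d. (\<Sum>c<d. cnj (V $$ (c, a)) * X $$ (c, e)) * V $$ (e, b))"
    using V X ab by (simp add: adj scalar_prod_def atLeast0LessThan)
  also have "\<dots> = (\<Sum>c<d. \<Sum>e<d. cnj (V $$ (c, a)) * X $$ (c, e) * V $$ (e, b))"
    by (subst sum.swap) (simp add: sum_distrib_right)
  finally show ?thesis .
qed

lemma kraus_CP:
  fixes N :: nat
  assumes lin: "\<Phi> \<in> lin_maps d" and V: "\<And>l. l < N \<Longrightarrow> V l \<in> carrier_mat d d"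
    and \<Phi>: "\<And>X a b. X \<in> carrier_mat d d \<Longrightarrow> a < d \<Longrightarrow> b < d \<Longrightarrow> \<Phi> X $$ (a, b) =
      (\<Sum>l<N. \<Sum>c<d. \<Sum>e<d. cnj (V l $$ (c, a)) * X $$ (c, e) * V l $$ (e, b))"
  shows "\<Phi> \<in> CP_cone d"
proof -
  have "id_tensor n d \<Phi> X \<in> psd (n * d)" if X: "X \<in> psd (n * d)" for n X
  proof -
    obtain S \<psi> where \<psi>: "\<And>r s. r < n * d \<Longrightarrow> s < n * d \<Longrightarrow> X $$ (r, s) = (\<Sum>x<S::nat. \<psi> x r * cnj (\<psi> x s))"
      using psd_decompose[OF X] by blast
    define w where "w = (\<lambda>(l, x) r. \<Sum>c<d. cnj (V l $$ (c, r mod d)) * \<psi> x (r div d * d + c))"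
    show ?thesis
    proof (rule psdI_rank_ones[where L="{..<N} \<times> {..<S}" and V=w])
      fix r s assume "r < n * d" "s < n * d"
      from this(1) obtain i a where r: "r = i * d + a" "i < n" "a < d" by (rule pair_index_cases)
      from \<open>s < n * d\<close> obtain j b where s: "s = j * d + b" "j < n" "b < d" by (rule pair_index_cases)
      have X': "X $$ (i * d + c, j * d + e) = (\<Sum>x<S. \<psi> x (i * d + c) * cnj (\<psi> x (j * d + e)))"
        if "c < d" "e < d" for c e
        using \<psi> pair_index_less r(2) s(2) that by blast
      have "id_tensor n d \<Phi> X $$ (r, s) = \<Phi> (block d X i j) $$ (a, b)"
        unfolding r(1) s(1) by (rule id_tensor_index[OF r(2) s(2) r(3) s(3)])
      also have "\<dots> = (\<Sum>l<N. \<Sum>c<d. \<Sum>e<d.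
          cnj (V l $$ (c, a)) * block d X i j $$ (c, e) * V l $$ (e, b))"
        by (rule \<Phi>[OF block_carrier r(3) s(3)])
      also have "\<dots> = (\<Sum>l<N. \<Sum>c<d. \<Sum>e<d. \<Sum>x<S.
          (cnj (V l $$ (c, a)) * \<psi> x (i * d + c)) * (cnj (\<psi> x (j * d + e)) * V l $$ (e, b)))"
      proof (intro sum.cong refl)
        fix l c e assume "c \<in> {..<d}" "e \<in> {..<d}"
        then have blk: "block d X i j $$ (c, e) = (\<Sum>x<S. \<psi> x (i * d + c) * cnj (\<psi> x (j * d + e)))"
          by (simp add: block_index X')
        show "cnj (V l $$ (c, a)) * block d X i j $$ (c, e) * V l $$ (e, b) = (\<Sum>x<S.
            (cnj (V l $$ (c, a)) * \<psi> x (i * d + c)) * (cnj (\<psi> x (j * d + e)) * V l $$ (e, b)))"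
          unfolding blk sum_distrib_left sum_distrib_right by (simp only: mult.assoc)
      qed
      also have "\<dots> = (\<Sum>l<N. \<Sum>c<d. \<Sum>x<S. \<Sum>e<d.
          (cnj (V l $$ (c, a)) * \<psi> x (i * d + c)) * (cnj (\<psi> x (j * d + e)) * V l $$ (e, b)))"
        by (intro sum.cong refl sum.swap)
      also have "\<dots> = (\<Sum>l<N. \<Sum>x<S. \<Sum>c<d. \<Sum>e<d.
          (cnj (V l $$ (c, a)) * \<psi> x (i * d + c)) * (cnj (\<psi> x (j * d + e)) * V l $$ (e, b)))"
        by (intro sum.cong refl sum.swap)
      also have "\<dots> = (\<Sum>l<N. \<Sum>x<S. w (l, x) r * cnj (w (l, x) s))"
      proof (intro sum.cong refl)
        fix l x
        have "w (l, x) r = (\<Sum>c<d. cnj (V l $$ (c, a)) * \<psi> x (i * d + c))"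
          using r by (simp add: w_def)
        moreover have "cnj (w (l, x) s) = (\<Sum>e<d. cnj (\<psi> x (j * d + e)) * V l $$ (e, b))"
          using s by (simp add: w_def mult.commute)
        ultimately show "(\<Sum>c<d. \<Sum>e<d.
          (cnj (V l $$ (c, a)) * \<psi> x (i * d + c)) * (cnj (\<psi> x (j * d + e)) * V l $$ (e, b))) =
          w (l, x) r * cnj (w (l, x) s)" by (simp add: sum_product)
      qed
      also have "\<dots> = (\<Sum>x\<in>{..<N} \<times> {..<S}. w x r * cnj (w x s))"
        by (simp add: sum.cartesian_product')
      finally show "id_tensor n d \<Phi> X $$ (r, s) = (\<Sum>x\<in>{..<N} \<times> {..<S}. w x r * cnj (w x s))" .
    qed simp
  qed
  with lin show ?thesis by (simp add: CP_cone_def Pn_cone_def)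
qed

lemma kraus_PEB:
  fixes N :: nat
  assumes lin: "\<Phi> \<in> lin_maps d" and V: "\<And>l. l < N \<Longrightarrow> V l \<in> carrier_mat d d"
    and rank: "\<And>l. l < N \<Longrightarrow> vec_space.rank d (V l) \<le> n"
    and \<Phi>: "\<And>X a b. X \<in> carrier_mat d d \<Longrightarrow> a < d \<Longrightarrow> b < d \<Longrightarrow> \<Phi> X $$ (a, b) =
      (\<Sum>l<N. \<Sum>c<d. \<Sum>e<d. cnj (V l $$ (c, a)) * X $$ (c, e) * V l $$ (e, b))"
  shows "\<Phi> \<in> PEB_cone n d"
proof -
  have "\<Phi> X = mat_sum d N (\<lambda>l. mat_adjoint (V l) * X * V l)" if X: "X \<in> carrier_mat d d" for X
    using lin_maps_carrier[OF lin X] X V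
    by (intro eq_matI) (auto simp: mat_sum_def \<Phi> kraus_index[OF V X] intro!: sum.cong)
  then show ?thesis using kraus_CP[OF lin V \<Phi>] V rank unfolding PEB_cone_def by blast
qed

lemma rank_two_rows:
  assumes V: "V \<in> carrier_mat d d" and 0: "\<And>r c. r < d \<Longrightarrow> c < d \<Longrightarrow> r \<ge> 2 \<Longrightarrow> V $$ (r, c) = 0"
  shows "vec_space.rank d (V :: complex mat) \<le> 2"
proof -
  define R where "R = (\<lambda>i. mat d d (\<lambda>(r, c). (if r = i then 1 else 0) * V $$ (i, c)))"
  have R: "R i \<in> carrier_mat d d" for i by (simp add: R_def)
  have "vec_space.rank d (R i) \<le> 1" for i
    by (rule vec_space.rank_le_1_product_entries[OF R, where f="\<lambda>r. if r = i then 1 else 0" and g="\<lambda>c. V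
      $$ (i, c)"])
       (auto simp: R_def)
  moreover have "V = R 0 + R 1"
    using V 0 by (intro eq_matI) (auto simp: R_def Suc_le_eq numeral_2_eq_2 less_Suc_eq_le
        not_less_eq_eq[symmetric])
  ultimately show ?thesis
    using vec_space.rank_subadditive[OF R[of 0] R[of 1]]
    by (metis add_mono one_add_one order_trans)
qed

text \<open>A \<open>2 \<times> 4\<close> matrix of Horodecki type: \<open>ppt_choi i p j q\<close> is the entry at \<open>(i, p)\<close>, \<open>(j, q)\<close> of
  the matrix with blocks \<open>1\<close>, \<open>N\<close>, \<open>N\<^sup>*\<close>, \<open>D\<close>. Here \<open>N\<close> is the shift \<open>e\<^sub>p\<^sub>+\<^sub>1 \<mapsto> e\<^sub>p\<close> on \<open>\<complex>\<^sup>4\<close>, and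
  \<open>D = N\<^sup>* N + u u\<^sup>* = N N\<^sup>* + u' u'\<^sup>*\<close> for \<open>u = (5/4, 0, 0, 3/4)\<close> and \<open>u' = (3/4, 0, 0, 5/4)\<close>.
  The two expressions for \<open>D\<close> show that the matrix and its partial transpose are positive; they
  exist since \<open>(5/4)\<^sup>2 = 1 + (3/4)\<^sup>2\<close>.\<close>

definition ppt_choi :: "nat \<Rightarrow> nat \<Rightarrow> nat \<Rightarrow> nat \<Rightarrow> complex" where
  "ppt_choi i p j q =
    (if i = 0 \<and> j = 0 then (if p = q then 1 else 0)
     else if i = 0 \<and> j = 1 then (if q = p + 1 then 1 else 0)
     else if i = 1 \<and> j = 0 then (if p = q + 1 then 1 else 0)
     else if p = q then (if p = 0 \<or> p = 3 then 25 / 16 else 1)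
     else if p + q = 3 \<and> (p = 0 \<or> q = 0) then 15 / 16 else 0)"

definition ppt_map :: "nat \<Rightarrow> complex mat \<Rightarrow> complex mat" where
  "ppt_map d = (\<lambda>X\<in>carrier_mat d d. mat d d (\<lambda>(p, q).
     if p < 4 \<and> q < 4 then \<Sum>i<2. \<Sum>j<2. X $$ (i, j) * ppt_choi i p j q else 0))"

lemma ppt_map_lin_maps:
  assumes "d \<ge> 4"
  shows "ppt_map d \<in> lin_maps d"
proof -
  define F where "F = (\<lambda>X. mat d d (\<lambda>(p, q).
    if p < 4 \<and> q < 4 then \<Sum>i<2. \<Sum>j<2. X $$ (i, j) * ppt_choi i p j q else 0))"
  have "(\<lambda>X\<in>carrier_mat d d. F X) \<in> lin_maps d"
  proof (rule lin_mapsI_index)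
    fix X Y :: "complex mat" and a b z assume X: "X \<in> carrier_mat d d" and ab: "a < d" "b < d"
    then show "F (z \<cdot>\<^sub>m X) $$ (a, b) = z * F X $$ (a, b)"
      using assms by (simp add: F_def sum_distrib_left mult_ac)
    assume "Y \<in> carrier_mat d d"
    then show "F (X + Y) $$ (a, b) = F X $$ (a, b) + F Y $$ (a, b)"
      using X ab assms by (simp add: F_def algebra_simps sum.distrib)
  qed (simp add: F_def)
  then show ?thesis by (simp only: ppt_map_def F_def)
qed

lemma ppt_map_index:
  assumes "X \<in> carrier_mat d d" "p < d" "q < d"
  shows "ppt_map d X $$ (p, q) =
    (if p < 4 \<and> q < 4 then \<Sum>i<2. \<Sum>j<2. X $$ (i, j) * ppt_choi i p j q else 0)"
  using assms by (simp add: ppt_map_def)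

text \<open>The row \<open>i\<close> of the Kraus operator number \<open>l\<close>, for the map (\<open>t = False\<close>) or its composition
  with the transposition (\<open>t = True\<close>). The operators are read off from the factorisations \<open>(1,
  N)\<^sup>* (1, N) + (0, u) (0, u)\<^sup>*\<close> and \<open>(1, N\<^sup>*)\<^sup>* (1, N\<^sup>*) + (0, u') (0, u')\<^sup>*\<close> of the Choi
  matrices, with columns \<open>(0, u)\<close> and \<open>(0, u')\<close>. Only two rows are nonzero, so that the rank is at
  most \<open>2\<close>.\<close>

definition kraus_row :: "bool \<Rightarrow> nat \<Rightarrow> nat \<Rightarrow> nat \<Rightarrow> complex" where
  "kraus_row t l i p =
    (if p \<ge> 4 then 0
     else if l < 4 then (if i = 0 then if p = l then 1 else 0
       else if i = 1 \<and> (if t then l = p + 1 else p = l + 1) then 1 else 0)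
     else if i = 1 then (if p = 0 then (if t then 3 / 4 else 5 / 4)
       else if p = 3 then (if t then 5 / 4 else 3 / 4) else 0) else 0)"

lemma kraus_row_choi:
  assumes "i < 2" "j < 2" "p < 4" "q < 4"
  shows "(\<Sum>l<5. kraus_row t l i p * kraus_row t l j q) = (if t then ppt_choi j p i q else ppt_choi i p j q)"
proof -
  have "{..<5::nat} = {0, 1, 2, 3, 4}" by auto
  then have sum5: "(\<Sum>l<5. f l) = f 0 + (f 1 + (f 2 + (f 3 + f 4)))" for f :: "nat \<Rightarrow> complex" by simp
  have i: "i = 0 \<or> i = 1" and j: "j = 0 \<or> j = 1" using assms by auto
  have four: "p = 0 \<or> p = 1 \<or> p = 2 \<or> p = 3" if "p < 4" for p :: nat using that by auto
  show ?thesis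
    unfolding sum5 using i j four[OF assms(3)] four[OF assms(4)]
    by (elim disjE; cases t; hypsubst; simp add: kraus_row_def ppt_choi_def)
qed

lemma ppt_choi_kraus_PEB:
  assumes d: "d \<ge> 4" and lin: "\<Phi> \<in> lin_maps d"
    and \<Phi>: "\<And>X p q. X \<in> carrier_mat d d \<Longrightarrow> p < d \<Longrightarrow> q < d \<Longrightarrow> \<Phi> X $$ (p, q) =
      (if p < 4 \<and> q < 4 then \<Sum>i<2. \<Sum>j<2. X $$ (i, j) * (if t then ppt_choi j p i q else ppt_choi i p j
        q) else 0)"
  shows "\<Phi> \<in> PEB_cone 2 d"
proof (rule kraus_PEB[OF lin, where N=5 and V="\<lambda>l. mat d d (\<lambda>(i, p). kraus_row t l i p)"])
  fix l :: nat
  show "vec_space.rank d (mat d d (\<lambda>(i, p). kraus_row t l i p)) \<le> 2"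
    by (rule rank_two_rows) (auto simp: kraus_row_def)
next
  fix X :: "complex mat" and p q assume X: "X \<in> carrier_mat d d" and pq: "p < d" "q < d"
  have real: "cnj (kraus_row t l i p) = kraus_row t l i p" for l i p
    by (simp add: kraus_row_def)
  have rows: "(\<Sum>c<d. f c * kraus_row t l c q) = (\<Sum>c<2. f c * kraus_row t l c q)" for f l q
    using d by (intro sum.mono_neutral_right) (auto simp: kraus_row_def)
  have "(\<Sum>l<5. \<Sum>c<d. \<Sum>e<d. cnj (mat d d (\<lambda>(i, p). kraus_row t l i p) $$ (c, p)) * X $$ (c, e) *
        mat d d (\<lambda>(i, p). kraus_row t l i p) $$ (e, q)) =
      (\<Sum>l<5. \<Sum>c<d. \<Sum>e<d. kraus_row t l c p * X $$ (c, e) * kraus_row t l e q)"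
    using pq by (simp add: real)
  also have "\<dots> = (\<Sum>l<5. \<Sum>c<d. \<Sum>e<2. kraus_row t l c p * X $$ (c, e) * kraus_row t l e q)"
    by (simp only: rows)
  also have "\<dots> = (\<Sum>l<5. \<Sum>c<d. (\<Sum>e<2. X $$ (c, e) * kraus_row t l e q) * kraus_row t l c p)"
    by (simp add: sum_distrib_left sum_distrib_right mult_ac)
  also have "\<dots> = (\<Sum>l<5. \<Sum>c<2. (\<Sum>e<2. X $$ (c, e) * kraus_row t l e q) * kraus_row t l c p)"
    by (simp only: rows)
  also have "\<dots> = (\<Sum>l<5. \<Sum>c<2. \<Sum>e<2. X $$ (c, e) * (kraus_row t l c p * kraus_row t l e q))"
    by (simp add: sum_distrib_left sum_distrib_right mult_ac)
  also have "\<dots> = (\<Sum>c<2. \<Sum>e<2. X $$ (c, e) * (\<Sum>l<5. kraus_row t l c p * kraus_row t l e q))"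
    by (simp only: sum_distrib_left sum.swap[of _ _ "{..<5}"])
  also have "\<dots> = \<Phi> X $$ (p, q)"
  proof (cases "p < 4 \<and> q < 4")
    case True
    then show ?thesis using X pq by (simp add: \<Phi> kraus_row_choi)
  next
    case False
    have "kraus_row t l c p = 0" if "p \<ge> 4" for l c p using that by (simp add: kraus_row_def)
    then have "kraus_row t l c p * kraus_row t l e q = 0" for l c e
      using False by (cases "p < 4") simp_all
    then have "(\<Sum>c<2. \<Sum>e<2. X $$ (c, e) * (\<Sum>l<5. kraus_row t l c p * kraus_row t l e q)) = 0"
      by simp
    moreover have "\<Phi> X $$ (p, q) = 0" using \<Phi>[OF X pq] False by auto
    ultimately show ?thesis by simp
  qed
  finally show "\<Phi> X $$ (p, q) = (\<Sum>l<5. \<Sum>c<d. \<Sum>e<d. cnj (mat d d (\<lambda>(i, p). kraus_row t l i p) $$ (c, p))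
    * X $$ (c, e) *
        mat d d (\<lambda>(i, p). kraus_row t l i p) $$ (e, q))" by simp
qed simp

lemma lin_comp_transpose_index:
  "X \<in> carrier_mat d d \<Longrightarrow> lin_comp d \<Phi> (transpose_map d) X = \<Phi> (transpose_mat X)"
  by (simp add: lin_comp_def compose_def transpose_map_def)

lemma ppt_map_PEB:
  assumes "d \<ge> 4"
  shows "ppt_map d \<in> PEB_cone 2 d" "lin_comp d (ppt_map d) (transpose_map d) \<in> PEB_cone 2 d"
proof -
  show "ppt_map d \<in> PEB_cone 2 d"
    by (rule ppt_choi_kraus_PEB[where t=False]) (use assms in \<open>simp_all add: ppt_map_lin_maps ppt_map_index\<close>)
  show "lin_comp d (ppt_map d) (transpose_map d) \<in> PEB_cone 2 d"
  proof (rule ppt_choi_kraus_PEB[where t=True])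
    fix X :: "complex mat" and p q assume X: "X \<in> carrier_mat d d" and pq: "p < d" "q < d"
    have "(\<Sum>i<2. \<Sum>j<2. transpose_mat X $$ (i, j) * ppt_choi i p j q) =
        (\<Sum>i<2. \<Sum>j<2. X $$ (j, i) * ppt_choi i p j q)"
      using X assms by (intro sum.cong refl) auto
    also have "\<dots> = (\<Sum>i<2. \<Sum>j<2. X $$ (i, j) * ppt_choi j p i q)" by (rule sum.swap)
    finally show "lin_comp d (ppt_map d) (transpose_map d) X $$ (p, q) =
      (if p < 4 \<and> q < 4 then \<Sum>i<2. \<Sum>j<2. X $$ (i, j) * (if True then ppt_choi j p i q else ppt_choi i p
        j q) else 0)"
      using X pq by (simp add: lin_comp_transpose_index ppt_map_index)
  qed (use assms in \<open>simp_all add: ppt_map_lin_maps lin_comp_lin_maps transpose_map_lin_maps\<close>)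
qed

text \<open>If a real combination of three vectors has norm zero, as computed from their Gram matrix, it
  vanishes. For a separable matrix the Gram matrix of the numbers \<open>a\<^sub>l i b\<^sub>l p\<close>, indexed by \<open>l\<close>,
  is given by the entries of the matrix. So a vector of the kernel of the matrix yields a linear
  relation that holds for every product term.\<close>

lemma gram_null_vector:
  fixes x y z :: "nat \<Rightarrow> complex" and \<alpha> \<beta> \<gamma> :: real
  assumes 0: "\<alpha> * \<alpha> * (\<Sum>l<N. x l * cnj (x l)) + \<beta> * \<beta> * (\<Sum>l<N. y l * cnj (y l))
     + \<gamma> * \<gamma> * (\<Sum>l<N. z l * cnj (z l))
     + \<alpha> * \<beta> * ((\<Sum>l<N. x l * cnj (y l)) + (\<Sum>l<N. y l * cnj (x l)))
     + \<alpha> * \<gamma> * ((\<Sum>l<N. x l * cnj (z l)) + (\<Sum>l<N. z l * cnj (x l)))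
     + \<beta> * \<gamma> * ((\<Sum>l<N. y l * cnj (z l)) + (\<Sum>l<N. z l * cnj (y l))) = 0"
    and l: "l < N"
  shows "\<alpha> * x l + \<beta> * y l + \<gamma> * z l = 0"
proof -
  define w where "w = (\<lambda>l. \<alpha> * x l + \<beta> * y l + \<gamma> * z l)"
  have "(\<Sum>l<N. w l * cnj (w l)) = \<alpha> * \<alpha> * (\<Sum>l<N. x l * cnj (x l)) + \<beta> * \<beta> * (\<Sum>l<N. y l * cnj (y l))
     + \<gamma> * \<gamma> * (\<Sum>l<N. z l * cnj (z l))
     + \<alpha> * \<beta> * ((\<Sum>l<N. x l * cnj (y l)) + (\<Sum>l<N. y l * cnj (x l)))
     + \<alpha> * \<gamma> * ((\<Sum>l<N. x l * cnj (z l)) + (\<Sum>l<N. z l * cnj (x l)))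
     + \<beta> * \<gamma> * ((\<Sum>l<N. y l * cnj (z l)) + (\<Sum>l<N. z l * cnj (y l)))"
    by (simp add: w_def algebra_simps sum.distrib sum_distrib_left)
  also have "\<dots> = 0" by (rule 0)
  finally have "complex_of_real (\<Sum>l<N. (cmod (w l))\<^sup>2) = 0"
    by (simp only: of_real_sum complex_norm_square)
  then have "(\<Sum>l<N. (cmod (w l))\<^sup>2) = 0" by (simp only: of_real_eq_0_iff)
  then have "\<forall>l\<in>{..<N}. (cmod (w l))\<^sup>2 = 0" by (subst (asm) sum_nonneg_eq_0_iff) auto
  with l show ?thesis by (simp add: w_def)
qed

text \<open>The range criterion. Kernel vectors of the matrix and of its partial transpose give, for
  each product term \<open>a \<otimes> b\<close>, the relations \<open>k1\<close> to \<open>k3\<close> and \<open>k1'\<close>, \<open>k2'\<close>. If \<open>a\<^sub>0 b\<^sub>0 \<noteq> 0\<close>, then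
  \<open>b\<^sub>1 \<noteq> 0\<close> by \<open>k1\<close>, the ratio \<open>z = a\<^sub>1 / a\<^sub>0\<close> has modulus \<open>1\<close> by \<open>k2\<close> and \<open>k1'\<close>, and \<open>k2'\<close> turns
  \<open>k3\<close> into \<open>3 z b\<^sub>0 = 0\<close>. So \<open>a\<^sub>0 b\<^sub>0 = 0\<close> in every term, although the entry at \<open>(0, 0)\<close>, \<open>(0,
  0)\<close> is \<open>1\<close>.\<close>

lemma ppt_choi_not_separable:
  fixes N :: nat and a b :: "nat \<Rightarrow> nat \<Rightarrow> complex"
  assumes ab: "\<And>i j p q. i < 2 \<Longrightarrow> j < 2 \<Longrightarrow> p < 4 \<Longrightarrow> q < 4 \<Longrightarrow>
     (\<Sum>l<N. (a l i * cnj (a l j)) * (b l p * cnj (b l q))) = ppt_choi i p j q"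
  shows False
proof -
  have null: "\<alpha> * (a l i\<^sub>1 * b l p\<^sub>1) + \<beta> * (a l i\<^sub>2 * b l p\<^sub>2) + \<gamma> * (a l i\<^sub>3 * b l p\<^sub>3) = 0"
    if "l < N" "i\<^sub>1 < 2" "i\<^sub>2 < 2" "i\<^sub>3 < 2" "p\<^sub>1 < 4" "p\<^sub>2 < 4" "p\<^sub>3 < 4"
      and 0: "\<alpha> * \<alpha> * ppt_choi i\<^sub>1 p\<^sub>1 i\<^sub>1 p\<^sub>1 + \<beta> * \<beta> * ppt_choi i\<^sub>2 p\<^sub>2 i\<^sub>2 p\<^sub>2 + \<gamma> * \<gamma> * ppt_choi i\<^sub>3
        p\<^sub>3 i\<^sub>3 p\<^sub>3
       + \<alpha> * \<beta> * (ppt_choi i\<^sub>1 p\<^sub>1 i\<^sub>2 p\<^sub>2 + ppt_choi i\<^sub>2 p\<^sub>2 i\<^sub>1 p\<^sub>1)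
       + \<alpha> * \<gamma> * (ppt_choi i\<^sub>1 p\<^sub>1 i\<^sub>3 p\<^sub>3 + ppt_choi i\<^sub>3 p\<^sub>3 i\<^sub>1 p\<^sub>1)
       + \<beta> * \<gamma> * (ppt_choi i\<^sub>2 p\<^sub>2 i\<^sub>3 p\<^sub>3 + ppt_choi i\<^sub>3 p\<^sub>3 i\<^sub>2 p\<^sub>2) = 0"
    for \<alpha> \<beta> \<gamma> :: real and l i\<^sub>1 i\<^sub>2 i\<^sub>3 p\<^sub>1 p\<^sub>2 p\<^sub>3
  proof -
    have "(\<Sum>l<N. a l i * b l p * cnj (a l j * b l q)) = ppt_choi i p j q"
      if "i < 2" "j < 2" "p < 4" "q < 4" for i j p q
      using ab[OF that] by (simp add: mult_ac)
    with that(2-7) 0 show ?thesis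
      by (intro gram_null_vector[OF _ that(1)]) (simp only:)
  qed
  \<comment> \<open>Conjugating the first factors replaces the matrix by its partial transpose.\<close>
  have null': "\<alpha> * (cnj (a l i\<^sub>1) * b l p\<^sub>1) + \<beta> * (cnj (a l i\<^sub>2) * b l p\<^sub>2) + \<gamma> * (cnj (a l i\<^sub>3) * b l
    p\<^sub>3) = 0"
    if "l < N" "i\<^sub>1 < 2" "i\<^sub>2 < 2" "i\<^sub>3 < 2" "p\<^sub>1 < 4" "p\<^sub>2 < 4" "p\<^sub>3 < 4"
      and 0: "\<alpha> * \<alpha> * ppt_choi i\<^sub>1 p\<^sub>1 i\<^sub>1 p\<^sub>1 + \<beta> * \<beta> * ppt_choi i\<^sub>2 p\<^sub>2 i\<^sub>2 p\<^sub>2 + \<gamma> * \<gamma> * ppt_choi i\<^sub>3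
        p\<^sub>3 i\<^sub>3 p\<^sub>3
       + \<alpha> * \<beta> * (ppt_choi i\<^sub>2 p\<^sub>1 i\<^sub>1 p\<^sub>2 + ppt_choi i\<^sub>1 p\<^sub>2 i\<^sub>2 p\<^sub>1)
       + \<alpha> * \<gamma> * (ppt_choi i\<^sub>3 p\<^sub>1 i\<^sub>1 p\<^sub>3 + ppt_choi i\<^sub>1 p\<^sub>3 i\<^sub>3 p\<^sub>1)
       + \<beta> * \<gamma> * (ppt_choi i\<^sub>3 p\<^sub>2 i\<^sub>2 p\<^sub>3 + ppt_choi i\<^sub>2 p\<^sub>3 i\<^sub>3 p\<^sub>2) = 0"
    for \<alpha> \<beta> \<gamma> :: real and l i\<^sub>1 i\<^sub>2 i\<^sub>3 p\<^sub>1 p\<^sub>2 p\<^sub>3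
  proof -
    have "(\<Sum>l<N. cnj (a l i) * b l p * cnj (cnj (a l j) * b l q)) = ppt_choi j p i q"
      if "i < 2" "j < 2" "p < 4" "q < 4" for i j p q
      using ab[OF that(2,1,3,4)] by (simp add: mult_ac)
    with that(2-7) 0 show ?thesis
      by (intro gram_null_vector[OF _ that(1)]) (simp only:)
  qed
  have "a l 0 * b l 0 = 0" if l: "l < N" for l
  proof (rule ccontr)
    define x y b0 b1 b2 b3 where defs: "x = a l 0" "y = a l 1" "b0 = b l 0" "b1 = b l 1" "b2 = b l 2"
      "b3 = b l 3"
    have k1: "y * b1 = x * b0"
      using null[OF l, of 1 0 0 1 0 0 1 "-1" 0] by (simp add: ppt_choi_def defs)
    have k2: "y * b2 = x * b1"
      using null[OF l, of 1 0 0 2 1 0 1 "-1" 0] by (simp add: ppt_choi_def defs)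
    have k3: "3 * y * b0 - 5 * y * b3 + 5 * x * b2 = 0"
      using null[OF l, of 1 1 0 0 3 2 3 "-5" 5] by (simp add: ppt_choi_def defs mult.assoc)
    have k1': "cnj y * b1 = cnj x * b2"
      using null'[OF l, of 1 0 0 1 2 0 1 "-1" 0] by (simp add: ppt_choi_def defs)
    have k2': "cnj y * b2 = cnj x * b3"
      using null'[OF l, of 1 0 0 2 3 0 1 "-1" 0] by (simp add: ppt_choi_def defs)
    assume "a l 0 * b l 0 \<noteq> 0"
    then have x: "x \<noteq> 0" and b0: "b0 \<noteq> 0" by (auto simp: defs)
    define z where "z = y / x"
    have z1: "z * b1 = b0" using k1 x by (simp add: z_def field_simps)
    have z2: "z * b2 = b1" using k2 x by (simp add: z_def field_simps)
    have z3: "3 * z * b0 - 5 * z * b3 + 5 * b2 = 0"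
    proof -
      have "3 * z * b0 - 5 * z * b3 + 5 * b2 = (3 * y * b0 - 5 * y * b3 + 5 * x * b2) / x"
        using x by (simp add: z_def field_simps)
      then show ?thesis using k3 by simp
    qed
    have z1': "cnj z * b1 = b2" using k1' x by (simp add: z_def field_simps)
    have z2': "cnj z * b2 = b3" using k2' x by (simp add: z_def field_simps)
    have nz: "z \<noteq> 0" "b1 \<noteq> 0" using z1 b0 by auto
    have "(z * cnj z) * b1 = b1" using z2 z1' by (simp add: mult.assoc)
    then have zz: "z * cnj z = 1" using nz by simp
    have "z * b3 = (z * cnj z) * b2" using z2' by (simp add: mult.assoc)
    then have "z * b3 = b2" using zz by simp
    then have "3 * z * b0 = 0" using z3 by (simp add: mult.assoc)
    then show False using nz b0 by simp
  qed
  then have "(\<Sum>l<N. (a l 0 * cnj (a l 0)) * (b l 0 * cnj (b l 0))) = 0"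
    by (intro sum.neutral) auto
  with ab[of 0 0 0 0] show False by (simp add: ppt_choi_def)
qed

text \<open>On the maximally entangled vector of a \<open>2 \<times> 2\<close> corner the output is the Choi matrix
  \<open>ppt_choi\<close>. This needs \<open>k \<ge> 2\<close>.\<close>

lemma ppt_map_not_EBk:
  assumes d: "d \<ge> 4" and k: "k \<ge> 2"
  shows "ppt_map d \<notin> EBk_cone k d"
proof
  assume "ppt_map d \<in> EBk_cone k d"
  then have "id_tensor k d (ppt_map d) (max_entangled 2 k d) \<in> separable k d"
    using max_entangled_psd by (auto simp: EBk_cone_def)
  from separable_decompose[OF this] obtain N a b where ab: "\<And>i j p q. i < k \<Longrightarrow> j < k \<Longrightarrow> p < d \<Longrightarrow> q < d \<Longrightarrow>
     id_tensor k d (ppt_map d) (max_entangled 2 k d) $$ (i * d + p, j * d + q) =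
      (\<Sum>l<N::nat. (a l i * cnj (a l j)) * (b l p * cnj (b l q)))"
    by blast
  show False
  proof (rule ppt_choi_not_separable)
    fix i j p q :: nat assume ij: "i < 2" "j < 2" "p < 4" "q < 4"
    have "(\<Sum>l<N. (a l i * cnj (a l j)) * (b l p * cnj (b l q))) = ppt_map d (unit_mat d i j) $$ (p, q)"
      using ab[of i j p q] ij d k by (simp add: id_tensor_max_entangled)
    also have "\<dots> = (\<Sum>i'<2. \<Sum>j'<2. unit_mat d i j $$ (i', j') * ppt_choi i' p j' q)"
      using ij d by (simp add: ppt_map_index)
    also have "\<dots> = (\<Sum>i'<2. \<Sum>j'<2. if j' = j then if i' = i then ppt_choi i' p j' q else 0 else 0)"
      using d by (intro sum.cong refl) (auto simp: unit_mat_def)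
    also have "\<dots> = ppt_choi i p j q" using ij by simp
    finally show "(\<Sum>l<N. (a l i * cnj (a l j)) * (b l p * cnj (b l q))) = ppt_choi i p j q" .
  qed
qed

section \<open>Typical cones\<close>

text \<open>The pairing of the Choi matrix of \<open>\<Phi>\<close> with \<open>v v\<^sup>*\<close> for \<open>v = \<Sum>\<^sub>i e\<^sub>i \<otimes> e\<^sub>i\<close>, and in
  \<open>flip_functional\<close> the pairing with the flip. Transposition exchanges the two.\<close>

definition diag_functional :: "nat \<Rightarrow> (complex mat \<Rightarrow> complex mat) \<Rightarrow> complex" where
  "diag_functional d \<Phi> = (\<Sum>i<d. \<Sum>j<d. \<Phi> (unit_mat d i j) $$ (i, j))"

definition flip_functional :: "nat \<Rightarrow> (complex mat \<Rightarrow> complex mat) \<Rightarrow> complex" where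
  "flip_functional d \<Phi> = (\<Sum>i<d. \<Sum>j<d. \<Phi> (unit_mat d i j) $$ (j, i))"

text \<open>A closed convex cone that contains the entanglement breaking maps and, by the symmetry of
  its definition, is stable under transposition.\<close>

definition pairing_cone :: "nat \<Rightarrow> (complex mat \<Rightarrow> complex mat) set" where
  "pairing_cone d = {\<Phi> \<in> lin_maps d. 0 \<le> Re (diag_functional d \<Phi>) \<and> 0 \<le> Re (flip_functional d \<Phi>)}"

lemma closedin_pairing_cone: "closedin (lin_maps_topology d) (pairing_cone d)"
proof -
  have half: "closedin (lin_maps_topology d)
      {\<Phi> \<in> lin_maps d. 0 \<le> Re (\<Sum>i<d. \<Sum>j<d. entries d \<Phi> (unit_mat d i j, f i j))}" for f
  proof -
    have "closedin (lin_maps_topology d)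
      {\<Phi> \<in> lin_maps d. (\<lambda>g. \<Sum>i<d. \<Sum>j<d. g (unit_mat d i j, f i j)) (entries d \<Phi>) \<in> {z. 0 \<le> Re z}}"
      by (intro closedin_lin_maps continuous_intros continuous_on_product_coordinates closed_Collect_le)
    then show ?thesis by simp
  qed
  have "pairing_cone d = {\<Phi> \<in> lin_maps d. 0 \<le> Re (\<Sum>i<d. \<Sum>j<d. entries d \<Phi> (unit_mat d i j, (i, j)))} \<inter>
      {\<Phi> \<in> lin_maps d. 0 \<le> Re (\<Sum>i<d. \<Sum>j<d. entries d \<Phi> (unit_mat d i j, (j, i)))}"
    by (auto simp: pairing_cone_def diag_functional_def flip_functional_def entries_def)
  then show ?thesis using half[of "\<lambda>i j. (i, j)"] half[of "\<lambda>i j. (j, i)"] by (simp add: closedin_Int)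
qed

lemma functional_lin_add:
  assumes "\<Phi> \<in> lin_maps d" "\<Psi> \<in> lin_maps d"
  shows "diag_functional d (lin_add d \<Phi> \<Psi>) = diag_functional d \<Phi> + diag_functional d \<Psi>"
    and "flip_functional d (lin_add d \<Phi> \<Psi>) = flip_functional d \<Phi> + flip_functional d \<Psi>"
proof -
  have "lin_add d \<Phi> \<Psi> (unit_mat d i j) $$ (a, b) = \<Phi> (unit_mat d i j) $$ (a, b) + \<Psi> (unit_mat d i j) $$ (a, b)"
    if "a < d" "b < d" for i j a b
    using that carrier_matD[OF lin_maps_carrier[OF assms(2) unit_mat_carrier]]
    by (simp add: lin_add_def)
  then show "diag_functional d (lin_add d \<Phi> \<Psi>) = diag_functional d \<Phi> + diag_functional d \<Psi>"
    "flip_functional d (lin_add d \<Phi> \<Psi>) = flip_functional d \<Phi> + flip_functional d \<Psi>"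
    by (simp_all add: diag_functional_def flip_functional_def sum.distrib)
qed

lemma functional_lin_scale:
  assumes "\<Phi> \<in> lin_maps d"
  shows "diag_functional d (lin_scale d t \<Phi>) = of_real t * diag_functional d \<Phi>"
    and "flip_functional d (lin_scale d t \<Phi>) = of_real t * flip_functional d \<Phi>"
proof -
  have "lin_scale d t \<Phi> (unit_mat d i j) $$ (a, b) = of_real t * \<Phi> (unit_mat d i j) $$ (a, b)"
    if "a < d" "b < d" for i j a b
    using that carrier_matD[OF lin_maps_carrier[OF assms unit_mat_carrier]]
    by (simp add: lin_scale_def)
  then show "diag_functional d (lin_scale d t \<Phi>) = of_real t * diag_functional d \<Phi>"
    "flip_functional d (lin_scale d t \<Phi>) = of_real t * flip_functional d \<Phi>"
    by (simp_all add: diag_functional_def flip_functional_def sum_distrib_left)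
qed

lemma functional_transpose:
  shows "diag_functional d (lin_comp d \<Phi> (transpose_map d)) = flip_functional d \<Phi>"
    and "flip_functional d (lin_comp d \<Phi> (transpose_map d)) = diag_functional d \<Phi>"
proof -
  have "transpose_mat (unit_mat d i j) = unit_mat d j i" for i j
    by (intro eq_matI) (auto simp: unit_mat_def)
  then have t: "lin_comp d \<Phi> (transpose_map d) (unit_mat d i j) = \<Phi> (unit_mat d j i)" for i j
    by (simp add: lin_comp_transpose_index)
  show "diag_functional d (lin_comp d \<Phi> (transpose_map d)) = flip_functional d \<Phi>"
    unfolding diag_functional_def flip_functional_def t by (rule sum.swap)
  show "flip_functional d (lin_comp d \<Phi> (transpose_map d)) = diag_functional d \<Phi>"
    unfolding diag_functional_def flip_functional_def t by (rule sum.swap)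
qed

lemma closed_convex_cone_pairing_cone: "closed_convex_cone d (pairing_cone d)"
proof -
  have "(\<lambda>X\<in>carrier_mat d d. 0\<^sub>m d d) \<in> lin_maps d"
    by (rule lin_mapsI_index) auto
  then have "(\<lambda>X\<in>carrier_mat d d. 0\<^sub>m d d) \<in> pairing_cone d"
    by (simp add: pairing_cone_def diag_functional_def flip_functional_def)
  then have "pairing_cone d \<noteq> {}" by blast
  then show ?thesis unfolding closed_convex_cone_def
    using closedin_pairing_cone
    by (auto simp: pairing_cone_def lin_add_lin_maps lin_scale_lin_maps functional_lin_add functional_lin_scale)
qed

text \<open>For a product term \<open>a a\<^sup>* \<otimes> b b\<^sup>*\<close> of the Choi matrix the two pairings are the squared
  moduli of \<open>\<Sum> a\<^sub>i b\<^sub>i\<close> and \<open>\<Sum> a\<^sub>i cnj b\<^sub>i\<close>.\<close>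

lemma EB_cone_subset_pairing_cone:
  assumes "d \<ge> 1"
  shows "EB_cone d \<subseteq> pairing_cone d"
proof
  fix \<Phi> assume \<Phi>: "\<Phi> \<in> EB_cone d"
  then have "id_tensor d d \<Phi> (max_entangled d d d) \<in> separable d d"
    using max_entangled_psd assms by (auto simp: EB_cone_def)
  from separable_decompose[OF this] obtain N a b where "\<And>i j p q. i < d \<Longrightarrow> j < d \<Longrightarrow> p < d \<Longrightarrow> q < d \<Longrightarrow>
     id_tensor d d \<Phi> (max_entangled d d d) $$ (i * d + p, j * d + q) =
      (\<Sum>l<N::nat. (a l i * cnj (a l j)) * (b l p * cnj (b l q)))"
    by blast
  then have ab: "\<Phi> (unit_mat d i j) $$ (p, q) = (\<Sum>l<N. (a l i * cnj (a l j)) * (b l p * cnj (b l q)))"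
    if "i < d" "j < d" "p < d" "q < d" for i j p q
    using that by (simp add: id_tensor_max_entangled)
  have "diag_functional d \<Phi> = (\<Sum>i<d. \<Sum>j<d. \<Sum>l<N. (a l i * b l i) * cnj (a l j * b l j))"
    unfolding diag_functional_def by (intro sum.cong refl) (simp add: ab mult_ac)
  also have "\<dots> = (\<Sum>l<N. (\<Sum>i<d. a l i * b l i) * cnj (\<Sum>i<d. a l i * b l i))"
    unfolding cnj_sum sum_product by (simp only: sum.swap[of _ _ "{..<N}"])
  also have "\<dots> = of_real (\<Sum>l<N. (cmod (\<Sum>i<d. a l i * b l i))\<^sup>2)"
    by (simp only: of_real_sum complex_norm_square)
  finally have d1: "0 \<le> Re (diag_functional d \<Phi>)" by (simp add: sum_nonneg)
  have "flip_functional d \<Phi> = (\<Sum>i<d. \<Sum>j<d. \<Sum>l<N. (a l i * cnj (b l i)) * cnj (a l j * cnj (b l j)))"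
    unfolding flip_functional_def by (intro sum.cong refl) (simp add: ab mult_ac)
  also have "\<dots> = (\<Sum>l<N. (\<Sum>i<d. a l i * cnj (b l i)) * cnj (\<Sum>i<d. a l i * cnj (b l i)))"
    unfolding cnj_sum sum_product by (simp only: sum.swap[of _ _ "{..<N}"])
  also have "\<dots> = of_real (\<Sum>l<N. (cmod (\<Sum>i<d. a l i * cnj (b l i)))\<^sup>2)"
    by (simp only: of_real_sum complex_norm_square)
  finally have "0 \<le> Re (flip_functional d \<Phi>)" by (simp add: sum_nonneg)
  with d1 \<Phi> show "\<Phi> \<in> pairing_cone d" by (simp add: pairing_cone_def EB_cone_def)
qed

text \<open>The pairing of \<open>k 1 - F\<close> with the flip \<open>F\<close> is \<open>k d - d\<^sup>2\<close>.\<close>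

lemma werner_map_not_pairing_cone:
  assumes "k < d"
  shows "werner_map d k \<notin> pairing_cone d"
proof -
  have "werner_map d k (unit_mat d i j) $$ (j, i) = (if j = i then of_nat k else 0) - 1"
    if ij: "i < d" "j < d" for i j
  proof -
    have "(\<Sum>c<d. unit_mat d i i $$ (c, c)) = (\<Sum>c<d. if c = i then 1 else 0)"
      by (intro sum.cong) (auto simp: unit_mat_def)
    then have "(\<Sum>c<d. unit_mat d i i $$ (c, c)) = 1" using ij by simp
    then show ?thesis using ij by (auto simp: werner_map_def) (auto simp: unit_mat_def)
  qed
  then have "flip_functional d (werner_map d k) = of_nat d * (of_nat k - of_nat d)"
    by (simp add: flip_functional_def sum_subtractf)
  then have "flip_functional d (werner_map d k) = of_real (real d * (real k - real d))"
    by simp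
  then have "Re (flip_functional d (werner_map d k)) = real d * (real k - real d)"
    by (simp only: Re_complex_of_real)
  also have "\<dots> < 0" using assms by (simp add: mult_pos_neg)
  finally show ?thesis by (simp add: pairing_cone_def)
qed

definition ppt_pair :: "nat \<Rightarrow> (complex mat \<Rightarrow> complex mat) set" where
  "ppt_pair d = {ppt_map d, lin_comp d (ppt_map d) (transpose_map d)}"

lemma cone_transpose_ppt_pair:
  assumes "d \<ge> 4" "ppt_pair d \<subseteq> C"
  shows "ppt_pair d \<subseteq> cone_transpose d C"
proof -
  have lin: "ppt_map d \<in> lin_maps d" using assms by (simp add: ppt_map_lin_maps)
  have "lin_comp d (lin_comp d (ppt_map d) (transpose_map d)) (transpose_map d) = ppt_map d"
    by (rule lin_maps_ext[OF _ lin])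
      (auto simp: lin_comp_lin_maps lin transpose_map_lin_maps lin_comp_transpose_index)
  then show ?thesis using assms unfolding ppt_pair_def cone_transpose_def by force
qed

lemma PEB_cone_mono: "m \<le> n \<Longrightarrow> PEB_cone m d \<subseteq> PEB_cone n d"
  unfolding PEB_cone_def by (blast intro: order_trans)

text \<open>All generating cones except that of the entanglement breaking maps contain the completely
  positive maps with Kraus operators of rank at most \<open>2\<close>, hence \<open>ppt_pair\<close>. The three operations
  keep the dichotomy: both alternatives are stable under transposition; an intersection lies in
  \<open>pairing_cone\<close> as soon as one of the two cones does, and a join contains \<open>ppt_pair\<close> as soon as
  one does; the join of two subcones of the closed convex cone \<open>pairing_cone\<close> remains inside.\<close>

lemma typical_dichotomy:
  assumes "typical d C" and d: "d \<ge> 4"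
  shows "C \<subseteq> pairing_cone d \<or> ppt_pair d \<subseteq> C"
  using assms(1)
proof induction
  have PEB: "ppt_pair d \<subseteq> PEB_cone 2 d" using ppt_map_PEB[OF d] by (simp add: ppt_pair_def)
  also have "\<dots> \<subseteq> CP_cone d" by (auto simp: PEB_cone_def)
  finally have CP: "ppt_pair d \<subseteq> CP_cone d" .
  {
    case P
    then show ?case using CP CP_cone_subset_Pn_cone[of 1 d] Pn_cone_subset_P_cone[of 1 d] by blast
  next
    case (Pn n)
    then show ?case using CP CP_cone_subset_Pn_cone[of n d] by auto
  next
    case CP
    show ?case using \<open>ppt_pair d \<subseteq> CP_cone d\<close> by blast
  next
    case (PEB n)
    then show ?case using \<open>ppt_pair d \<subseteq> PEB_cone 2 d\<close> PEB_cone_mono[of 2 n d] by auto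
  next
    case EB
    show ?case using EB_cone_subset_pairing_cone[of d] d by simp
  next
    case (transpose C)
    from transpose.IH show ?case
    proof
      assume "C \<subseteq> pairing_cone d"
      then have "cone_transpose d C \<subseteq> pairing_cone d"
        by (auto simp: cone_transpose_def pairing_cone_def functional_transpose lin_comp_lin_maps
          transpose_map_lin_maps)
      then show ?thesis ..
    next
      assume "ppt_pair d \<subseteq> C"
      then show ?thesis using cone_transpose_ppt_pair[OF d] by blast
    qed
  next
    case (inter C1 C2)
    then show ?case by blast
  next
    case (join C1 C2)
    have "cone_join d C1 C2 \<subseteq> pairing_cone d" if "C1 \<subseteq> pairing_cone d" "C2 \<subseteq> pairing_cone d"
      using that closed_convex_cone_pairing_cone[of d] unfolding cone_join_def by blast
    moreover have "C1 \<union> C2 \<subseteq> cone_join d C1 C2" unfolding cone_join_def by blast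
    ultimately show ?case using join.IH by blast
  }
qed

theorem theorem3p20:
  fixes d k :: nat
  assumes "d \<ge> 4" and "1 < k" and "k < d"
  shows "mapping_cone d (EBk_cone k d) \<and> \<not> typical d (EBk_cone k d) \<and>
         mapping_cone d (EBCPk_cone k d) \<and> \<not> typical d (EBCPk_cone k d)"
proof -
  have sub: "EBCPk_cone k d \<subseteq> EBk_cone k d" by (simp add: EBCPk_cone_def)
  have w: "werner_map d k \<in> EBCPk_cone k d" using assms by (intro werner_map_EBCPk) simp
  have nw: "werner_map d k \<notin> pairing_cone d" using assms by (intro werner_map_not_pairing_cone)
  have np: "ppt_map d \<notin> EBk_cone k d" using assms by (intro ppt_map_not_EBk) simp_all
  \<comment> \<open>\<open>werner_map\<close> excludes the first alternative of the dichotomy, \<open>ppt_map\<close> the second.\<close>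
  have untypical: "\<not> typical d C" if "EBCPk_cone k d \<subseteq> C" "C \<subseteq> EBk_cone k d" for C
    using typical_dichotomy[OF _ assms(1), of C] w nw np that by (auto simp: ppt_pair_def)
  show ?thesis
    using untypical[of "EBk_cone k d"] untypical[of "EBCPk_cone k d"] sub w assms
      mapping_cone_EBk[of k d] mapping_cone_EBCPk[of k d] by auto
qed

end
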